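(* Let $R$ be an affine commutative $\mathbb{K}$-algebra generated by a set $X=\{x_1,\ldots,x_n\}$, let $G$ be a finitely generated abelian group acting on $R$ by algebra automorphisms via $g\cdot x_i=\chi_i(g)^{-1}x_i$ for characters $\chi_1,\ldots,\chi_n\in\widehat{G}$ of finite order, and let $R\#G$ be the skew group ring. Let $N=\bigcap_{i=1}^n\ker(\chi_i)$ and let $\Lambda\subseteq G$ be a set of coset representatives of $G/N$. Let $V=\mathbb{K}v$ be an $X$-torsion-free simple $R[N]$-module. Then: (1) The induced module $\overline{V}=(R\#G)\otimes_{R[N]}V$ is a simple $R\#G$-module. (2) A $\mathbb{K}$-basis for $\overline{V}$ is $\{v_g:=g\otimes v\mid g\in\Lambda\}$. Thus $\dim(\overline{V})=|G/N|$. (3) The action of $R\#G$ on $\overline{V}$ is given by $$x_i\cdot v_g=\chi_i(g)k_iv_g\quad\text{for all }1\le i\le n,\ g\in\Lambda,$$ $$hg\cdot v_{g'}=\lambda(\gamma(g,g')h)\,v_{gg'}\quad\text{for all }g,g'\in\Lambda,\ h\in N,$$ where $x_i\cdot v=k_iv$ with $k_i\in\mathbb{K}^\times$ and $h\cdot v=\lambda(h)v$ for $h\in N$, for some $\lambda\in\widehat{N}$. (4) Any $X$-torsion-free simple left $R\#G$-module is isomorphic to $\overline{V}$ for some $X$-torsion-free simple $R[N]$-module $V$.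
   Context: $\mathbb{K}$ is an algebraically closed field of characteristic zero; $\widehat{G}$ is the group of homomorphisms $G\to\mathbb{K}^\times$ (similarly $\widehat{N}$). In $R\#G$ one has $x_ig=\chi_i(g)gx_i$ for $g\in G$. $N$ acts trivially on $R$, so the subalgebra $R\#N=R[N]$ of $R\#G$ is the (commutative) group ring of $N$ over $R$; $R\#G$ is a free left $R[N]$-module with basis $\Lambda$. For $g,g'\in\Lambda$, the subscript in $v_{gg'}$ stands for the representative $\overline{gg'}\in\Lambda$ of the coset $gg'N$, and $\gamma(g,g')\in N$ is defined by $gg'=\gamma(g,g')\,\overline{gg'}$. A module $M$ is $X$-torsion-free if for every $i$, $x_i^km=0$ with $m\in M$, $k\ge1$ implies $m=0$. $R[N]$ is affine commutative, so its simple modules are one-dimensional over $\mathbb{K}$. *)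

theory Defs
  imports
    "HOL-Algebra.Algebra"
    "Jordan_Normal_Form.Missing_VectorSpace"
begin

section \<open>Skew group rings\<close>

definition generate_algebra ::
    "('k, 'c) ring_scheme \<Rightarrow> ('k, 'r, 'd) module_scheme \<Rightarrow> 'r set \<Rightarrow> 'r set" where
  "generate_algebra K R S =
     generate_ring R (S \<union> (\<lambda>c. c \<odot>\<^bsub>R\<^esub> \<one>\<^bsub>R\<^esub>) ` carrier K)"

text \<open>
  An element \<open>\<Sum>\<^sub>g r\<^sub>g g\<close> of \<open>R # G\<close> is its coefficient function \<open>g \<mapsto> r\<^sub>g\<close>, which vanishes
  outside a finite subset of \<open>carrier G\<close>. The product is determined by
  \<open>(r g) (s h) = (r (g \<cdot> s)) (g h)\<close>. For a subgroup \<open>N\<close> of \<open>G\<close>, the subring \<open>R # N\<close> is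
  \<open>skew_group_ring R (G\<lparr>carrier := N\<rparr>) act\<close>; its elements are literally elements of \<open>R # G\<close>.
\<close>

definition skew_group_ring ::
    "('k, 'r, 'c) module_scheme \<Rightarrow> ('g, 'd) monoid_scheme \<Rightarrow> ('g \<Rightarrow> 'r \<Rightarrow> 'r)
      \<Rightarrow> ('k, 'g \<Rightarrow> 'r) module" where
  "skew_group_ring R G act =
    \<lparr>carrier = {f. range f \<subseteq> carrier R \<and> finite {g. f g \<noteq> \<zero>\<^bsub>R\<^esub>} \<and> {g. f g \<noteq> \<zero>\<^bsub>R\<^esub>} \<subseteq> carrier G},
     monoid.mult = (\<lambda>a b k. \<Oplus>\<^bsub>R\<^esub>p \<in> {(g, h). a g \<noteq> \<zero>\<^bsub>R\<^esub> \<and> b h \<noteq> \<zero>\<^bsub>R\<^esub> \<and> g \<otimes>\<^bsub>G\<^esub> h = k}.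
               a (fst p) \<otimes>\<^bsub>R\<^esub> act (fst p) (b (snd p))),
     one = (\<lambda>g. if g = \<one>\<^bsub>G\<^esub> then \<one>\<^bsub>R\<^esub> else \<zero>\<^bsub>R\<^esub>),
     ring.zero = (\<lambda>g. \<zero>\<^bsub>R\<^esub>),
     add = (\<lambda>a b g. a g \<oplus>\<^bsub>R\<^esub> b g),
     smult = (\<lambda>c a g. c \<odot>\<^bsub>R\<^esub> a g)\<rparr>"

text \<open>The element \<open>r g\<close> of \<open>R # G\<close>.\<close>

definition skew_monom :: "('r, 'c) ring_scheme \<Rightarrow> 'r \<Rightarrow> 'g \<Rightarrow> ('g \<Rightarrow> 'r)" where
  "skew_monom R r g = (\<lambda>h. if h = g then r else \<zero>\<^bsub>R\<^esub>)"


section \<open>Left modules over a not necessarily commutative ring\<close>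

text \<open>The library's \<^locale>\<open>module\<close> requires a commutative base ring.\<close>

locale left_module = A?: ring A + M?: abelian_group M
  for A :: "('a, 'c) ring_scheme" (structure)
    and M :: "('a, 'm, 'd) module_scheme" (structure) +
  assumes smult_closed:
      "\<lbrakk>a \<in> carrier A; m \<in> carrier M\<rbrakk> \<Longrightarrow> a \<odot>\<^bsub>M\<^esub> m \<in> carrier M"
    and smult_l_distr:
      "\<lbrakk>a \<in> carrier A; b \<in> carrier A; m \<in> carrier M\<rbrakk> \<Longrightarrow>
       (a \<oplus> b) \<odot>\<^bsub>M\<^esub> m = a \<odot>\<^bsub>M\<^esub> m \<oplus>\<^bsub>M\<^esub> b \<odot>\<^bsub>M\<^esub> m"
    and smult_r_distr:
      "\<lbrakk>a \<in> carrier A; m \<in> carrier M; m' \<in> carrier M\<rbrakk> \<Longrightarrow>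
       a \<odot>\<^bsub>M\<^esub> (m \<oplus>\<^bsub>M\<^esub> m') = a \<odot>\<^bsub>M\<^esub> m \<oplus>\<^bsub>M\<^esub> a \<odot>\<^bsub>M\<^esub> m'"
    and smult_assoc1:
      "\<lbrakk>a \<in> carrier A; b \<in> carrier A; m \<in> carrier M\<rbrakk> \<Longrightarrow>
       (a \<otimes> b) \<odot>\<^bsub>M\<^esub> m = a \<odot>\<^bsub>M\<^esub> (b \<odot>\<^bsub>M\<^esub> m)"
    and smult_one:
      "m \<in> carrier M \<Longrightarrow> \<one> \<odot>\<^bsub>M\<^esub> m = m"

definition simple_module :: "('a, 'c) ring_scheme \<Rightarrow> ('a, 'm, 'd) module_scheme \<Rightarrow> bool" where
  "simple_module A M \<longleftrightarrow>
     left_module A M \<and> carrier M \<noteq> {\<zero>\<^bsub>M\<^esub>} \<and>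
     (\<forall>H. Module.submodule H A M \<longrightarrow> H = {\<zero>\<^bsub>M\<^esub>} \<or> H = carrier M)"

definition isomorphic_modules ::
    "('a, 'c) ring_scheme \<Rightarrow> ('a, 'm, 'd) module_scheme \<Rightarrow> ('a, 'n, 'e) module_scheme \<Rightarrow> bool" where
  "isomorphic_modules A M M' \<longleftrightarrow>
     (\<exists>\<phi> \<in> module_hom A M M'. bij_betw \<phi> (carrier M) (carrier M'))"

definition torsion_free_wrt ::
    "('a, 'c) ring_scheme \<Rightarrow> 'a set \<Rightarrow> ('a, 'm, 'd) module_scheme \<Rightarrow> bool" where
  "torsion_free_wrt A S M \<longleftrightarrow>
     (\<forall>a\<in>S. \<forall>k::nat. \<forall>m\<in>carrier M. 1 \<le> k \<and> (a [^]\<^bsub>A\<^esub> k) \<odot>\<^bsub>M\<^esub> m = \<zero>\<^bsub>M\<^esub> \<longrightarrow> m = \<zero>\<^bsub>M\<^esub>)"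

text \<open>
  A module over a \<open>K\<close>-algebra \<open>A\<close>, viewed as a \<open>K\<close>-module along \<open>c \<mapsto> c \<cdot> 1\<^sub>A\<close>.
  (The fields \<open>mult\<close> and \<open>one\<close> of a module record carry no meaning.)
\<close>

definition restrict_scalars ::
    "('k, 'a, 'c) module_scheme \<Rightarrow> ('a, 'm, 'd) module_scheme \<Rightarrow> ('k, 'm) module" where
  "restrict_scalars A M =
    \<lparr>carrier = carrier M, monoid.mult = monoid.mult M, one = one M,
     ring.zero = \<zero>\<^bsub>M\<^esub>, add = add M,
     smult = (\<lambda>c m. (c \<odot>\<^bsub>A\<^esub> \<one>\<^bsub>A\<^esub>) \<odot>\<^bsub>M\<^esub> m)\<rparr>"


section \<open>Induced modules\<close>

text \<open>
  For a subring \<open>B\<close> of \<open>A\<close> and a left \<open>B\<close>-module \<open>V\<close>, the tensor product \<open>A \<otimes>\<^sub>B V\<close> is the free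
  abelian group on \<open>carrier A \<times> carrier V\<close> modulo the subgroup generated by the relations of
  biadditivity and \<open>B\<close>-balancedness. The ring \<open>A\<close> acts by \<open>a (a' \<otimes> v) = (a a') \<otimes> v\<close>.
\<close>

definition tensor_relations ::
    "('a, 'c) ring_scheme \<Rightarrow> ('a, 'd) ring_scheme \<Rightarrow> ('a, 'v, 'e) module_scheme
      \<Rightarrow> ('a \<times> 'v \<Rightarrow>\<^sub>0 int) set" where
  "tensor_relations A B V =
     {frag_of (a \<oplus>\<^bsub>A\<^esub> a', v) - frag_of (a, v) - frag_of (a', v) | a a' v.
        a \<in> carrier A \<and> a' \<in> carrier A \<and> v \<in> carrier V} \<union>
     {frag_of (a, v \<oplus>\<^bsub>V\<^esub> v') - frag_of (a, v) - frag_of (a, v') | a v v'.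
        a \<in> carrier A \<and> v \<in> carrier V \<and> v' \<in> carrier V} \<union>
     {frag_of (a \<otimes>\<^bsub>A\<^esub> b, v) - frag_of (a, b \<odot>\<^bsub>V\<^esub> v) | a b v.
        a \<in> carrier A \<and> b \<in> carrier B \<and> v \<in> carrier V}"

definition tensor_kernel ::
    "('a, 'c) ring_scheme \<Rightarrow> ('a, 'd) ring_scheme \<Rightarrow> ('a, 'v, 'e) module_scheme
      \<Rightarrow> ('a \<times> 'v \<Rightarrow>\<^sub>0 int) set" where
  "tensor_kernel A B V =
     generate (free_Abelian_group (carrier A \<times> carrier V)) (tensor_relations A B V)"

definition tensor_class ::
    "('a, 'c) ring_scheme \<Rightarrow> ('a, 'd) ring_scheme \<Rightarrow> ('a, 'v, 'e) module_scheme
      \<Rightarrow> ('a \<times> 'v \<Rightarrow>\<^sub>0 int) \<Rightarrow> ('a \<times> 'v \<Rightarrow>\<^sub>0 int) set" where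
  "tensor_class A B V c =
     tensor_kernel A B V #>\<^bsub>free_Abelian_group (carrier A \<times> carrier V)\<^esub> c"

definition pure_tensor ::
    "('a, 'c) ring_scheme \<Rightarrow> ('a, 'd) ring_scheme \<Rightarrow> ('a, 'v, 'e) module_scheme
      \<Rightarrow> 'a \<Rightarrow> 'v \<Rightarrow> ('a \<times> 'v \<Rightarrow>\<^sub>0 int) set" where
  "pure_tensor A B V a v = tensor_class A B V (frag_of (a, v))"

text \<open>
  In \<open>smult\<close> all members \<open>c\<close> of a coset \<open>C\<close> yield the same coset, so that the union is that coset.
\<close>

definition induced_module ::
    "('a, 'c) ring_scheme \<Rightarrow> ('a, 'd) ring_scheme \<Rightarrow> ('a, 'v, 'e) module_scheme
      \<Rightarrow> ('a, ('a \<times> 'v \<Rightarrow>\<^sub>0 int) set) module" where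
  "induced_module A B V =
    (let T = free_Abelian_group (carrier A \<times> carrier V) Mod tensor_kernel A B V in
     \<lparr>carrier = carrier T, monoid.mult = (\<lambda>_ _. \<one>\<^bsub>T\<^esub>), one = \<one>\<^bsub>T\<^esub>,
      ring.zero = \<one>\<^bsub>T\<^esub>, add = monoid.mult T,
      smult = (\<lambda>a C. \<Union>c\<in>C.
        tensor_class A B V (frag_extend (\<lambda>(a', v). frag_of (a \<otimes>\<^bsub>A\<^esub> a', v)) c))\<rparr>)"


section \<open>Coset representatives\<close>

definition coset_representatives :: "('g, 'c) monoid_scheme \<Rightarrow> 'g set \<Rightarrow> 'g set \<Rightarrow> bool" where
  "coset_representatives G N \<Lambda> \<longleftrightarrow>
     \<Lambda> \<subseteq> carrier G \<and> (\<forall>C \<in> rcosets\<^bsub>G\<^esub> N. \<exists>!l. l \<in> \<Lambda> \<and> l \<in> C)"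

definition coset_rep :: "('g, 'c) monoid_scheme \<Rightarrow> 'g set \<Rightarrow> 'g set \<Rightarrow> 'g \<Rightarrow> 'g" where
  "coset_rep G N \<Lambda> g = (THE l. l \<in> \<Lambda> \<and> l \<in> N #>\<^bsub>G\<^esub> g)"

text \<open>\<open>g g' = \<gamma>(g, g') \<cdot> l\<close>, where \<open>l\<close> is the representative of the coset of \<open>g g'\<close>.\<close>

definition coset_cocycle ::
    "('g, 'c) monoid_scheme \<Rightarrow> 'g set \<Rightarrow> 'g set \<Rightarrow> 'g \<Rightarrow> 'g \<Rightarrow> 'g" where
  "coset_cocycle G N \<Lambda> g g' =
     (g \<otimes>\<^bsub>G\<^esub> g') \<otimes>\<^bsub>G\<^esub> inv\<^bsub>G\<^esub> (coset_rep G N \<Lambda> (g \<otimes>\<^bsub>G\<^esub> g'))"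

end

theory Submission
  imports Defs
begin

text \<open>
  Write \<open>A\<close> for \<open>R # G\<close> and \<open>B\<close> for its commutative subring \<open>R # N = R[N]\<close>, and let \<open>x\<^sub>i v = k\<^sub>i v\<close>.

  The induced module. Every element of \<open>A\<close> is a sum of products \<open>l b\<close> with \<open>l \<in> \<Lambda>\<close> and \<open>b \<in> B\<close>, and \<open>B\<close> acts
  on the line \<open>V\<close> by scalars, so the vectors \<open>v\<^sub>l = l \<otimes> v\<close> span \<open>A \<otimes>\<^sub>B V\<close> (\<open>spanning\<close>). They are independent
  because restricting coefficient functions to \<open>N\<close> is a \<open>B\<close>-linear projection \<open>A \<rightarrow> B\<close>: it induces a map
  \<open>A \<otimes>\<^sub>B V \<rightarrow> V\<close> which, after translation by \<open>l\<^sup>-\<^sup>1\<close>, reads off the coefficient of \<open>v\<^sub>l\<close> (\<open>coordinate\<close>). The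
  relation \<open>x\<^sub>i g = \<chi>\<^sub>i(g) g x\<^sub>i\<close> shows that \<open>v\<^sub>g\<close> is an eigenvector of \<open>x\<^sub>i\<close> for the eigenvalue \<open>\<chi>\<^sub>i(g) k\<^sub>i\<close>. Here
  \<open>k\<^sub>i \<noteq> 0\<close> by torsion-freeness, and \<open>N\<close> is the common kernel of the characters, so two different \<open>v\<^sub>l\<close> are always
  separated by some \<open>x\<^sub>i\<close>. A product of factors \<open>x\<^sub>i - c\<close> therefore isolates a single \<open>v\<^sub>l\<close> inside any nonzero
  submodule (\<open>isolating_operator\<close>), and \<open>G\<close> moves this \<open>v\<^sub>l\<close> to every other one. Hence the module is simple.

  The converse. Let \<open>M\<close> be a simple \<open>A\<close>-module. It suffices to find a nonzero \<open>w \<in> M\<close> on which \<open>B\<close> acts by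
  scalars: then \<open>a \<otimes> u \<mapsto> a u\<close> is a nonzero homomorphism from the simple module induced by \<open>K w\<close> to the simple
  module \<open>M\<close>. Since \<open>G/N\<close> is finite, \<open>M\<close> is finitely generated over \<open>B\<close> and has a maximal \<open>B\<close>-submodule \<open>M'\<close>;
  let \<open>I\<close> be the maximal ideal of \<open>B\<close> with \<open>I M \<subseteq> M'\<close>. The intersection of the translates \<open>g M'\<close> is a proper
  \<open>A\<close>-submodule, hence zero. If \<open>I\<close> annihilated no nonzero vector, then a nonzero vector could be moved by
  conjugates of elements of \<open>I\<close> into one translate after the other, and would end in that intersection
  (\<open>killed_vector\<close>). So \<open>I w = 0\<close> for some \<open>w \<noteq> 0\<close>. Finally \<open>B\<close> is a finitely generated algebra, since \<open>N\<close> has finite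
  index in the finitely generated group \<open>G\<close>, and so \<open>B = K + I\<close> by the Nullstellensatz.

  The Nullstellensatz is needed in the form of Zariski's lemma (\<open>finitely_generated_residue_field\<close>): a field
  that is finitely generated as a ring over the algebraically closed field \<open>K\<close> equals \<open>K\<close>. It is obtained by
  extending homomorphisms into \<open>K\<close> from a domain \<open>D\<close> to \<open>D[u]\<close>, one generator \<open>u\<close> at a time
  (\<open>hom_extension_step\<close>).
\<close>


section \<open>Roots of polynomials written as power sums\<close>

text \<open>
  Coefficient lists begin with the leading coefficient, hence the reversal. This carries facts about roots of
  coefficient lists over to power sums, the form in which polynomials of type \<^typ>\<open>nat \<Rightarrow> 'a\<close> are evaluated.
\<close>

lemma (in ring) eval_list_eq_finsum:
  assumes "\<And>i. a i \<in> carrier R" and "x \<in> carrier R"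
  shows "eval (map a (rev [0..<Suc d])) x = (\<Oplus>i\<in>{..d}. a i \<otimes> x [^] i)"
proof (induction d)
  case 0
  then show ?case using assms by simp
next
  case (Suc d)
  have "eval (map a (rev [0..<Suc (Suc d)])) x
        = a (Suc d) \<otimes> x [^] Suc d \<oplus> eval (map a (rev [0..<Suc d])) x"
    by simp
  also have "\<dots> = (\<Oplus>i\<in>{..Suc d}. a i \<otimes> x [^] i)"
    unfolding Suc.IH using assms by (simp add: atMost_Suc del: nat_pow_Suc)
  finally show ?case .
qed

lemma (in algebraically_closed) exists_root_sum:
  fixes a :: "nat \<Rightarrow> 'a"
  assumes "\<And>i. a i \<in> carrier L" and "a d \<noteq> \<zero>" and "0 < d"
  obtains x where "x \<in> carrier L" and "(\<Oplus>i\<in>{..d}. a i \<otimes> x [^] i) = \<zero>"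
proof -
  let ?p = "map a (rev [0..<Suc d])"
  have p: "?p \<in> carrier (poly_ring L)"
    using assms unfolding univ_poly_carrier[symmetric] polynomial_def by auto
  have "size (roots ?p) = degree ?p"
    using roots_over_carrier[OF p] unfolding splitted_def .
  then have "size (roots ?p) = d" by simp
  then obtain x where "x \<in># roots ?p"
    using assms(3) by (cases "roots ?p") auto
  then have "is_root ?p x" using roots_mem_iff_is_root[OF p] by blast
  then have x: "x \<in> carrier L" and "eval ?p x = \<zero>" unfolding is_root_def by auto
  then show ?thesis using that[OF x] eval_list_eq_finsum[of a x d, OF assms(1) x] by simp
qed

lemma (in domain) finite_roots_sum:
  fixes a :: "nat \<Rightarrow> 'a"
  assumes "\<And>i. a i \<in> carrier R" and "a d \<noteq> \<zero>"
  shows "finite {x \<in> carrier R. (\<Oplus>i\<in>{..d}. a i \<otimes> x [^] i) = \<zero>}"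
proof -
  let ?p = "map a (rev [0..<Suc d])"
  have p: "?p \<in> carrier (poly_ring R)"
    using assms unfolding univ_poly_carrier[symmetric] polynomial_def by auto
  have "{x \<in> carrier R. (\<Oplus>i\<in>{..d}. a i \<otimes> x [^] i) = \<zero>} \<subseteq> {x. is_root ?p x}"
  proof
    fix x assume x: "x \<in> {x \<in> carrier R. (\<Oplus>i\<in>{..d}. a i \<otimes> x [^] i) = \<zero>}"
    then have "eval ?p x = \<zero>" using eval_list_eq_finsum[of a x d] assms(1) by simp
    moreover have "?p \<noteq> []" by simp
    ultimately show "x \<in> {x. is_root ?p x}" using x unfolding is_root_def by blast
  qed
  then show ?thesis using finite_number_of_roots[OF p] finite_subset by blast
qed

lemma (in domain) finite_roots_of_unity:
  assumes "0 < m"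
  shows "finite {x \<in> carrier R. x [^] (m::nat) = \<one>}"
proof -
  obtain d where m: "m = Suc d" using assms by (cases m) auto
  define a where "a i = (if i = 0 then \<ominus> \<one> else if i = m then \<one> else \<zero>)" for i :: nat
  have a: "\<And>i. a i \<in> carrier R" by (simp add: a_def)
  have "(\<Oplus>i\<in>{..m}. a i \<otimes> x [^] i) = \<zero>" if x: "x \<in> carrier R" and xm: "x [^] m = \<one>" for x
  proof -
    have low: "(\<Oplus>i\<in>{..k}. a i \<otimes> x [^] i) = \<ominus> \<one>" if "k < m" for k
      using that
    proof (induction k)
      case 0
      then show ?case using x by (simp add: a_def)
    next
      case (Suc k)
      have "(\<Oplus>i\<in>{..Suc k}. a i \<otimes> x [^] i) = a (Suc k) \<otimes> x [^] Suc k \<oplus> (\<Oplus>i\<in>{..k}. a i \<otimes> x [^] i)"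
        using a x by (simp add: atMost_Suc del: nat_pow_Suc)
      moreover have "a (Suc k) = \<zero>" using Suc.prems by (simp add: a_def)
      ultimately show ?case using Suc x by (simp del: nat_pow_Suc)
    qed
    have "(\<Oplus>i\<in>{..m}. a i \<otimes> x [^] i) = a m \<otimes> x [^] m \<oplus> (\<Oplus>i\<in>{..d}. a i \<otimes> x [^] i)"
      unfolding m using a x by (simp add: atMost_Suc del: nat_pow_Suc)
    also have "\<dots> = \<one> \<oplus> \<ominus> \<one>"
      using low[of d] xm by (simp add: a_def m del: nat_pow_Suc)
    finally show ?thesis by (simp add: r_neg)
  qed
  then have "{x \<in> carrier R. x [^] m = \<one>} \<subseteq> {x \<in> carrier R. (\<Oplus>i\<in>{..m}. a i \<otimes> x [^] i) = \<zero>}"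
    by blast
  moreover have "a m \<noteq> \<zero>" using assms by (simp add: a_def)
  ultimately show ?thesis using finite_roots_sum[of a m, OF a] by (rule_tac finite_subset)
qed

section \<open>Extending homomorphisms into an algebraically closed field\<close>

text \<open>
  The kernel condition is what makes the assignment \<open>e p \<mapsto> h p\<close> independent of the choice of \<open>p\<close>.
\<close>

lemma (in ring_hom_ring) factor_through_image:
  assumes ev: "e \<in> ring_hom R T" and T: "ring T"
    and ker: "\<And>p. p \<in> carrier R \<Longrightarrow> e p = \<zero>\<^bsub>T\<^esub> \<Longrightarrow> h p = \<zero>\<^bsub>S\<^esub>"
  shows "\<exists>\<psi> \<in> ring_hom (T\<lparr>carrier := e ` carrier R\<rparr>) S. \<forall>p \<in> carrier R. \<psi> (e p) = h p"
proof -
  interpret T: ring T by fact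
  interpret e: ring_hom_ring R T e using ev by (intro ring_hom_ringI2) unfold_locales
  define \<psi> where "\<psi> y = h (SOME p. p \<in> carrier R \<and> e p = y)" for y
  have \<psi>: "\<psi> (e p) = h p" if p: "p \<in> carrier R" for p
  proof -
    define q where "q = (SOME q. q \<in> carrier R \<and> e q = e p)"
    have q: "q \<in> carrier R \<and> e q = e p" unfolding q_def by (rule someI[of _ p]) (use p in simp)
    then have "e (q \<ominus>\<^bsub>R\<^esub> p) = \<zero>\<^bsub>T\<^esub>"
      using p e.hom_closed[OF p] by (simp add: R.minus_eq T.r_neg del: e.hom_closed)
    then have "h (q \<ominus>\<^bsub>R\<^esub> p) = \<zero>\<^bsub>S\<^esub>" using ker q p by (meson R.minus_closed)
    then have "h q \<ominus>\<^bsub>S\<^esub> h p = \<zero>\<^bsub>S\<^esub>" using p q by (simp add: R.minus_eq S.minus_eq)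
    then have "h q = h p" using p q by (meson S.r_right_minus_eq hom_closed)
    then show ?thesis unfolding \<psi>_def q_def .
  qed
  show ?thesis
  proof (rule bexI[of _ \<psi>])
    show "\<forall>p \<in> carrier R. \<psi> (e p) = h p" using \<psi> by blast
    show "\<psi> \<in> ring_hom (T\<lparr>carrier := e ` carrier R\<rparr>) S"
    proof (rule ring_hom_memI)
      fix y assume "y \<in> carrier (T\<lparr>carrier := e ` carrier R\<rparr>)"
      then show "\<psi> y \<in> carrier S" using \<psi> by auto
    next
      fix y z assume "y \<in> carrier (T\<lparr>carrier := e ` carrier R\<rparr>)" "z \<in> carrier (T\<lparr>carrier := e ` carrier R\<rparr>)"
      then obtain p q where pq: "p \<in> carrier R" "q \<in> carrier R" "y = e p" "z = e q" by auto
      show "\<psi> (y \<otimes>\<^bsub>T\<lparr>carrier := e ` carrier R\<rparr>\<^esub> z) = \<psi> y \<otimes>\<^bsub>S\<^esub> \<psi> z"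
        using pq(1,2) \<psi>[of "p \<otimes>\<^bsub>R\<^esub> q"] \<psi>[of p] \<psi>[of q] unfolding pq(3,4) by simp
      show "\<psi> (y \<oplus>\<^bsub>T\<lparr>carrier := e ` carrier R\<rparr>\<^esub> z) = \<psi> y \<oplus>\<^bsub>S\<^esub> \<psi> z"
        using pq(1,2) \<psi>[of "p \<oplus>\<^bsub>R\<^esub> q"] \<psi>[of p] \<psi>[of q] unfolding pq(3,4) by simp
    next
      show "\<psi> \<one>\<^bsub>T\<lparr>carrier := e ` carrier R\<rparr>\<^esub> = \<one>\<^bsub>S\<^esub>" using \<psi>[of "\<one>\<^bsub>R\<^esub>"] by simp
    qed
  qed
qed


lemma UP_eval_ring_hom:
  assumes "cring D" and "cring S" and "h \<in> ring_hom D S" and "s \<in> carrier S"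
  shows "eval D S h s \<in> ring_hom (UP D) S"
    and "\<And>r. r \<in> carrier D \<Longrightarrow> eval D S h s (monom (UP D) r 0) = h r"
proof -
  interpret D: cring D by fact
  interpret S: cring S by fact
  interpret h: ring_hom_cring D S h
    using assms(3) by (intro ring_hom_cring.intro ring_hom_cring_axioms.intro) unfold_locales
  interpret U: UP_pre_univ_prop D S h "UP D"
    by (unfold_locales) simp
  show "eval D S h s \<in> ring_hom (UP D) S" using U.eval_ring_hom[OF assms(4)] .
  show "\<And>r. r \<in> carrier D \<Longrightarrow> eval D S h s (monom (UP D) r 0) = h r"
    using U.eval_const[OF assms(4)] .
qed

text \<open>
  Allowing an arbitrary value \<open>k\<close> covers two needs: roots (\<open>k = 0\<close>) and points at which the polynomial does not
  vanish (\<open>k = 1\<close>). Both come from a root of the polynomial with \<open>k\<close> subtracted from its constant term, which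
  still has positive degree.
\<close>

lemma UP_eval_root:
  assumes D: "cring D" and K: "algebraically_closed K" and \<phi>: "\<phi> \<in> ring_hom D K"
    and p: "p \<in> carrier (UP D)" and lead: "\<phi> (coeff (UP D) p (deg D p)) \<noteq> \<zero>\<^bsub>K\<^esub>"
    and deg: "0 < deg D p" and k: "k \<in> carrier K"
  obtains c where "c \<in> carrier K" and "eval D K \<phi> c p = k"
proof -
  interpret D: cring D by fact
  interpret K: algebraically_closed K by fact
  interpret U: UP_cring D "UP D" by unfold_locales simp
  have co: "\<phi> (coeff (UP D) p i) \<in> carrier K" for i
    using ring_hom_closed[OF \<phi>] U.coeff_closed[OF p] .
  define a where "a i = (if i = 0 then \<phi> (coeff (UP D) p 0) \<ominus>\<^bsub>K\<^esub> k else \<phi> (coeff (UP D) p i))" for i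
  have a: "\<And>i. a i \<in> carrier K" using co k by (simp add: a_def)
  have "a (deg D p) \<noteq> \<zero>\<^bsub>K\<^esub>" using lead deg by (simp add: a_def)
  from K.exists_root_sum[of a, OF a this deg]
  obtain c where c: "c \<in> carrier K" and r: "(\<Oplus>\<^bsub>K\<^esub>i\<in>{..deg D p}. a i \<otimes>\<^bsub>K\<^esub> c [^]\<^bsub>K\<^esub> i) = \<zero>\<^bsub>K\<^esub>" .
  let ?s = "\<lambda>a. \<Oplus>\<^bsub>K\<^esub>i\<in>{0<..deg D p}. a i \<otimes>\<^bsub>K\<^esub> c [^]\<^bsub>K\<^esub> i"
  have split: "(\<Oplus>\<^bsub>K\<^esub>i\<in>{..deg D p}. f i \<otimes>\<^bsub>K\<^esub> c [^]\<^bsub>K\<^esub> i) = f 0 \<oplus>\<^bsub>K\<^esub> ?s f"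
    if "\<And>i. f i \<in> carrier K" for f
  proof -
    have "{..deg D p} = insert 0 {0<..deg D p}" by auto
    then show ?thesis using that c by simp
  qed
  have "?s a = ?s (\<lambda>i. \<phi> (coeff (UP D) p i))"
    using co c by (intro K.add.finprod_cong') (auto simp: a_def)
  then have "(\<phi> (coeff (UP D) p 0) \<ominus>\<^bsub>K\<^esub> k) \<oplus>\<^bsub>K\<^esub> ?s (\<lambda>i. \<phi> (coeff (UP D) p i)) = \<zero>\<^bsub>K\<^esub>"
    using split[of a, OF a] r by (simp add: a_def)
  moreover have "?s (\<lambda>i. \<phi> (coeff (UP D) p i)) \<in> carrier K"
    using co c by (intro K.finsum_closed) auto
  ultimately have "\<phi> (coeff (UP D) p 0) \<oplus>\<^bsub>K\<^esub> ?s (\<lambda>i. \<phi> (coeff (UP D) p i)) = k"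
    using co[of 0] k
    by (smt (verit) K.a_ac(1,2) K.a_closed K.add.inv_closed K.l_neg K.l_zero K.minus_eq K.r_zero)
  then have "eval D K \<phi> c p = k"
    using split[of "\<lambda>i. \<phi> (coeff (UP D) p i)", OF co] U.eval_on_carrier[OF p, of K \<phi> c] by simp
  with c that show ?thesis by blast
qed

text \<open>
  This presents \<open>D[u]\<close> as an image of the polynomial ring over \<open>D\<close>, so that a homomorphism on \<open>D[u]\<close> may be defined
  by evaluating polynomials elsewhere.
\<close>

lemma subring_extension_image:
  assumes F: "domain F" and D: "subring D F" and u: "u \<in> carrier F"
  shows "eval (F\<lparr>carrier := D\<rparr>) F id u \<in> ring_hom (UP (F\<lparr>carrier := D\<rparr>)) F"
    and "\<And>d. d \<in> D \<Longrightarrow> eval (F\<lparr>carrier := D\<rparr>) F id u (monom (UP (F\<lparr>carrier := D\<rparr>)) d 0) = d"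
    and "generate_ring F (insert u D) \<subseteq> eval (F\<lparr>carrier := D\<rparr>) F id u ` carrier (UP (F\<lparr>carrier := D\<rparr>))"
proof -
  interpret F: domain F by fact
  let ?D = "F\<lparr>carrier := D\<rparr>"
  have DF: "D \<subseteq> carrier F" using subringE(1)[OF D] .
  interpret D: domain ?D using F.subring_is_domain[OF D] .
  have id: "id \<in> ring_hom ?D F" using DF by (auto intro!: ring_hom_memI)
  show e: "eval ?D F id u \<in> ring_hom (UP ?D) F"
    and ed: "\<And>d. d \<in> D \<Longrightarrow> eval ?D F id u (monom (UP ?D) d 0) = d"
    using UP_eval_ring_hom[OF D.cring_axioms F.cring_axioms id u] by auto
  interpret U: UP_domain ?D "UP ?D" by unfold_locales simp
  interpret e: ring_hom_ring "UP ?D" F "eval ?D F id u"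
    using e by (intro ring_hom_ringI2) unfold_locales
  interpret idh: UP_pre_univ_prop ?D F id "UP ?D"
    using id by (unfold_locales) auto
  have "subring (eval ?D F id u ` carrier (UP ?D)) F"
    using e.img_is_subring[OF U.P.carrier_is_subring] .
  moreover have "u \<in> eval ?D F id u ` carrier (UP ?D)"
    using idh.eval_monom1[OF u] U.monom_closed[of "\<one>\<^bsub>F\<^esub>" 1] D.one_closed
    by (intro image_eqI[where x = "monom (UP ?D) \<one>\<^bsub>F\<^esub> 1"]) simp_all
  moreover have "D \<subseteq> eval ?D F id u ` carrier (UP ?D)"
  proof
    fix d assume d: "d \<in> D"
    show "d \<in> eval ?D F id u ` carrier (UP ?D)"
      using ed[OF d] U.monom_closed[of d 0] d
      by (intro image_eqI[where x = "monom (UP ?D) d 0"]) simp_all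
  qed
  ultimately show "generate_ring F (insert u D) \<subseteq> eval ?D F id u ` carrier (UP ?D)"
    using F.generate_ring_min_subring1[of "insert u D"] u DF by auto
qed


lemma (in domain) nat_pow_nonzero:
  assumes "x \<in> carrier R" and "x \<noteq> \<zero>"
  shows "x [^] (k::nat) \<noteq> \<zero>"
  using assms by (induction k) (auto simp: integral_iff)

text \<open>
  Homomorphisms \<open>D \<rightarrow> K\<close> cannot all be extended, for instance not when an element of \<open>D\<close> that becomes invertible in \<open>E\<close>
  is sent to zero. The element \<open>a\<close> collects the finitely many elements of \<open>D\<close> that must not be sent to zero. Asking
  the extension to be nonzero at a prescribed \<open>b\<close> makes the notion transitive.
\<close>

definition homs_extend ::
    "('k, 'c) ring_scheme \<Rightarrow> ('a, 'd) ring_scheme \<Rightarrow> 'a set \<Rightarrow> 'a \<Rightarrow> 'a set \<Rightarrow> 'a \<Rightarrow> bool" where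
  "homs_extend K F D a E b \<longleftrightarrow>
     (\<forall>\<phi> \<in> ring_hom (F\<lparr>carrier := D\<rparr>) K. \<phi> a \<noteq> \<zero>\<^bsub>K\<^esub> \<longrightarrow>
       (\<exists>\<psi> \<in> ring_hom (F\<lparr>carrier := E\<rparr>) K. (\<forall>d\<in>D. \<psi> d = \<phi> d) \<and> \<psi> b \<noteq> \<zero>\<^bsub>K\<^esub>))"

lemma homs_extend_trans:
  assumes "homs_extend K F D a D' a'" and "homs_extend K F D' a' E b" and "D \<subseteq> D'"
  shows "homs_extend K F D a E b"
  unfolding homs_extend_def
proof (intro ballI impI)
  fix \<phi> assume \<phi>: "\<phi> \<in> ring_hom (F\<lparr>carrier := D\<rparr>) K" "\<phi> a \<noteq> \<zero>\<^bsub>K\<^esub>"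
  obtain \<psi>1 where \<psi>1: "\<psi>1 \<in> ring_hom (F\<lparr>carrier := D'\<rparr>) K" "\<forall>d\<in>D. \<psi>1 d = \<phi> d" "\<psi>1 a' \<noteq> \<zero>\<^bsub>K\<^esub>"
    using assms(1) \<phi> unfolding homs_extend_def by blast
  obtain \<psi> where \<psi>: "\<psi> \<in> ring_hom (F\<lparr>carrier := E\<rparr>) K" "\<forall>d\<in>D'. \<psi> d = \<psi>1 d" "\<psi> b \<noteq> \<zero>\<^bsub>K\<^esub>"
    using assms(2) \<psi>1 unfolding homs_extend_def by blast
  have "\<forall>d\<in>D. \<psi> d = \<phi> d" using \<psi>(2) \<psi>1(2) assms(3) by (simp add: subset_iff)
  then show "\<exists>\<psi> \<in> ring_hom (F\<lparr>carrier := E\<rparr>) K. (\<forall>d\<in>D. \<psi> d = \<phi> d) \<and> \<psi> b \<noteq> \<zero>\<^bsub>K\<^esub>"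
    using \<psi> by blast
qed

lemma homs_extend_restrict:
  assumes "homs_extend K F D a E b" and "E' \<subseteq> E"
  shows "homs_extend K F D a E' b"
proof -
  have "ring_hom (F\<lparr>carrier := E\<rparr>) K \<subseteq> ring_hom (F\<lparr>carrier := E'\<rparr>) K"
    using assms(2) unfolding ring_hom_def by (auto simp: subset_iff)
  then show ?thesis using assms(1) unfolding homs_extend_def by blast
qed

text \<open>
  If \<open>u\<close> is transcendental over \<open>D\<close>, then \<open>u\<close> may be sent to any element of \<open>K\<close> at which the polynomial representing \<open>b\<close>
  does not vanish; its leading coefficient serves as \<open>a\<close>.

  If \<open>u\<close> is algebraic, take a polynomial \<open>p\<close> of least degree with \<open>p(u) = 0\<close>, and send \<open>u\<close> to a root of the image of
  \<open>p\<close>. Division by \<open>p\<close>, up to a power of its leading coefficient, shows that every polynomial vanishing at \<open>u\<close> then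
  vanishes at this root. To keep \<open>b\<close> nonzero, one finds a nonzero multiple \<open>d\<close> of \<open>b\<close> in \<open>D\<close>, and asks
  for the leading coefficient of \<open>p\<close> and \<open>d\<close> to stay nonzero.
\<close>

lemma hom_extension_step:
  assumes K: "algebraically_closed K" and F: "domain F" and D: "subring D F"
    and u: "u \<in> carrier F" and b: "b \<in> generate_ring F (insert u D)" "b \<noteq> \<zero>\<^bsub>F\<^esub>"
  obtains a where "a \<in> D" and "a \<noteq> \<zero>\<^bsub>F\<^esub>"
    and "homs_extend K F D a (generate_ring F (insert u D)) b"
proof -
  let ?D = "F\<lparr>carrier := D\<rparr>" and ?E = "generate_ring F (insert u D)"
  let ?P = "UP (F\<lparr>carrier := D\<rparr>)"
  define e where "e = eval ?D F id u"
  interpret K: algebraically_closed K by fact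
  interpret F: domain F by fact
  have DF: "D \<subseteq> carrier F" using subringE(1)[OF D] .
  interpret D: domain ?D using F.subring_is_domain[OF D] .
  interpret U: UP_domain ?D ?P by unfold_locales simp
  note ext = subring_extension_image[OF F D u, folded e_def]
  interpret e: ring_hom_ring ?P F e using ext(1) by (intro ring_hom_ringI2) unfold_locales
  have e_smult: "e (d \<odot>\<^bsub>?P\<^esub> p) = d \<otimes>\<^bsub>F\<^esub> e p" if "d \<in> D" "p \<in> carrier ?P" for d p
  proof -
    have "d \<odot>\<^bsub>?P\<^esub> p = monom ?P d 0 \<otimes>\<^bsub>?P\<^esub> p" using U.monom_mult_is_smult that by simp
    then show ?thesis using e.hom_mult[OF _ that(2)] U.monom_closed[of d 0] that(1) ext(2) by simp
  qed
  have lift: "\<exists>\<psi> \<in> ring_hom (F\<lparr>carrier := ?E\<rparr>) K. (\<forall>d\<in>D. \<psi> d = \<phi> d) \<and>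
      (\<forall>p \<in> carrier ?P. e p \<in> ?E \<longrightarrow> \<psi> (e p) = eval ?D K \<phi> c p)"
    if \<phi>: "\<phi> \<in> ring_hom ?D K" and c: "c \<in> carrier K"
      and ker: "\<And>p. p \<in> carrier ?P \<Longrightarrow> e p = \<zero>\<^bsub>F\<^esub> \<Longrightarrow> eval ?D K \<phi> c p = \<zero>\<^bsub>K\<^esub>" for \<phi> c
  proof -
    note h = UP_eval_ring_hom[OF D.cring_axioms K.cring_axioms \<phi> c]
    interpret h: ring_hom_ring ?P K "eval ?D K \<phi> c" using h(1) by (intro ring_hom_ringI2) unfold_locales
    obtain \<psi> where \<psi>: "\<psi> \<in> ring_hom (F\<lparr>carrier := e ` carrier ?P\<rparr>) K"
      and \<psi>e: "\<forall>p \<in> carrier ?P. \<psi> (e p) = eval ?D K \<phi> c p"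
      using h.factor_through_image[OF ext(1) F.ring_axioms ker] by blast
    have "\<psi> \<in> ring_hom (F\<lparr>carrier := ?E\<rparr>) K"
      using \<psi> ext(3) unfolding ring_hom_def by (auto simp: subset_iff)
    moreover have "\<psi> d = \<phi> d" if d: "d \<in> D" for d
      using bspec[OF \<psi>e, of "monom ?P d 0"] h(2)[of d] ext(2)[OF d] U.monom_closed[of d 0] d by simp
    ultimately show ?thesis using \<psi>e by blast
  qed
  obtain f where f: "f \<in> carrier ?P" and bf: "b = e f" using ext(3) b(1) by auto
  have f0: "f \<noteq> \<zero>\<^bsub>?P\<^esub>" using b(2) bf by auto
  show ?thesis
  proof (cases "\<forall>p \<in> carrier ?P. e p = \<zero>\<^bsub>F\<^esub> \<longrightarrow> p = \<zero>\<^bsub>?P\<^esub>")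
    case True
    let ?a = "coeff ?P f (deg ?D f)"
    have a: "?a \<in> D" "?a \<noteq> \<zero>\<^bsub>F\<^esub>" using U.lcoeff_closed[OF f] U.lcoeff_nonzero2[OF f f0] by simp_all
    show ?thesis
    proof (rule that[OF a], unfold homs_extend_def, intro ballI impI)
      fix \<phi> assume \<phi>: "\<phi> \<in> ring_hom ?D K" and nz: "\<phi> ?a \<noteq> \<zero>\<^bsub>K\<^esub>"
      have "\<exists>c \<in> carrier K. eval ?D K \<phi> c f \<noteq> \<zero>\<^bsub>K\<^esub>"
      proof (cases "deg ?D f = 0")
        case True
        then have "f = monom ?P ?a 0" using U.deg_zero_impl_monom[OF f] by simp
        then have "eval ?D K \<phi> \<zero>\<^bsub>K\<^esub> f = \<phi> ?a"
          using UP_eval_ring_hom(2)[OF D.cring_axioms K.cring_axioms \<phi> K.zero_closed, of ?a] a(1) by simp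
        then show ?thesis using nz by (intro bexI[of _ "\<zero>\<^bsub>K\<^esub>"]) simp_all
      next
        case False
        then obtain c where "c \<in> carrier K" "eval ?D K \<phi> c f = \<one>\<^bsub>K\<^esub>"
          using UP_eval_root[OF D.cring_axioms K \<phi> f nz _ K.one_closed] by auto
        then show ?thesis by (intro bexI[of _ c]) simp_all
      qed
      then obtain c where c: "c \<in> carrier K" "eval ?D K \<phi> c f \<noteq> \<zero>\<^bsub>K\<^esub>" by blast
      have ker: "eval ?D K \<phi> c p = \<zero>\<^bsub>K\<^esub>" if "p \<in> carrier ?P" "e p = \<zero>\<^bsub>F\<^esub>" for p
      proof -
        have "p = \<zero>\<^bsub>?P\<^esub>" using True that by blast
        then show ?thesis
          using ring_hom_zero[OF UP_eval_ring_hom(1)[OF D.cring_axioms K.cring_axioms \<phi> c(1)]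
              U.P.ring_axioms K.ring_axioms] by simp
      qed
      show "\<exists>\<psi> \<in> ring_hom (F\<lparr>carrier := ?E\<rparr>) K. (\<forall>d\<in>D. \<psi> d = \<phi> d) \<and> \<psi> b \<noteq> \<zero>\<^bsub>K\<^esub>"
        using lift[OF \<phi> c(1) ker] f b(1) c(2) unfolding bf by metis
    qed
  next
    case False
    define p where "p = (ARG_MIN (deg ?D) p. p \<in> carrier ?P \<and> e p = \<zero>\<^bsub>F\<^esub> \<and> p \<noteq> \<zero>\<^bsub>?P\<^esub>)"
    have "\<exists>p. p \<in> carrier ?P \<and> e p = \<zero>\<^bsub>F\<^esub> \<and> p \<noteq> \<zero>\<^bsub>?P\<^esub>" using False by blast
    from arg_min_natI[of "\<lambda>p. p \<in> carrier ?P \<and> e p = \<zero>\<^bsub>F\<^esub> \<and> p \<noteq> \<zero>\<^bsub>?P\<^esub>", OF someI_ex[OF this]]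
    have p: "p \<in> carrier ?P" "e p = \<zero>\<^bsub>F\<^esub>" "p \<noteq> \<zero>\<^bsub>?P\<^esub>" unfolding p_def by blast+
    have p_min: "deg ?D p \<le> deg ?D q" if "q \<in> carrier ?P" "e q = \<zero>\<^bsub>F\<^esub>" "q \<noteq> \<zero>\<^bsub>?P\<^esub>" for q
      unfolding p_def
      by (rule arg_min_nat_le[of "\<lambda>p. p \<in> carrier ?P \<and> e p = \<zero>\<^bsub>F\<^esub> \<and> p \<noteq> \<zero>\<^bsub>?P\<^esub>" q "deg ?D"])
        (use that in blast)
    let ?l = "coeff ?P p (deg ?D p)"
    have l: "?l \<in> D" "?l \<noteq> \<zero>\<^bsub>F\<^esub>" using U.lcoeff_closed[OF p(1)] U.lcoeff_nonzero2[OF p(1,3)] by simp_all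
    have p_pos: "0 < deg ?D p"
    proof (rule ccontr)
      assume "\<not> 0 < deg ?D p"
      then have z: "deg ?D p = 0" by simp
      then have "p = monom ?P ?l 0" using U.deg_zero_impl_monom[OF p(1)] by simp
      then have "e p = ?l" using ext(2)[OF l(1)] by metis
      then show False using p(2) l(2) by simp
    qed
    \<comment> \<open>Among the polynomials whose value at \<open>u\<close> is a nonzero multiple of \<open>b\<close>, one of least degree is constant:
      it has smaller degree than \<open>p\<close>, and then it divides a multiple of \<open>p\<close>, with a cofactor that vanishes at \<open>u\<close>
      and therefore has at least the degree of \<open>p\<close>.\<close>
    define Q where "Q r \<longleftrightarrow> r \<in> carrier ?P \<and> e r \<noteq> \<zero>\<^bsub>F\<^esub> \<and> (\<exists>t \<in> carrier ?P. e r = e t \<otimes>\<^bsub>F\<^esub> b)" for r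
    define r where "r = (ARG_MIN (deg ?D) r. Q r)"
    have "Q f" unfolding Q_def using f b(2) bf by (auto intro!: bexI[of _ "\<one>\<^bsub>?P\<^esub>"])
    from arg_min_natI[of Q, OF this] have Qr: "Q r" unfolding r_def .
    have r_min: "deg ?D r \<le> deg ?D s" if "Q s" for s
      unfolding r_def by (rule arg_min_nat_le[of Q s "deg ?D"]) (rule that)
    from Qr obtain t where r: "r \<in> carrier ?P" "e r \<noteq> \<zero>\<^bsub>F\<^esub>" and t: "t \<in> carrier ?P" "e r = e t \<otimes>\<^bsub>F\<^esub> b"
      unfolding Q_def by blast
    have r0: "r \<noteq> \<zero>\<^bsub>?P\<^esub>" using r(2) by auto
    have bF: "b \<in> carrier F" using bf f by simp
    have lpow: "?l [^]\<^bsub>?D\<^esub> (k::nat) \<in> D" "?l [^]\<^bsub>?D\<^esub> k \<noteq> \<zero>\<^bsub>F\<^esub>" for k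
      using l D.nat_pow_closed[of ?l k] D.nat_pow_nonzero[of ?l k] by auto
    have r_less: "deg ?D r < deg ?D p"
    proof -
      obtain q s and k :: nat where q: "q \<in> carrier ?P" and s: "s \<in> carrier ?P"
        and eq: "?l [^]\<^bsub>?D\<^esub> k \<odot>\<^bsub>?P\<^esub> r = p \<otimes>\<^bsub>?P\<^esub> q \<oplus>\<^bsub>?P\<^esub> s" and sd: "s = \<zero>\<^bsub>?P\<^esub> \<or> deg ?D s < deg ?D p"
        using U.long_div_theorem[OF p(1) r(1) p(3)] by blast
      have "e (?l [^]\<^bsub>?D\<^esub> k \<odot>\<^bsub>?P\<^esub> r) = e s" unfolding eq using p q s by simp
      then have es: "e s = ?l [^]\<^bsub>?D\<^esub> k \<otimes>\<^bsub>F\<^esub> e r" using e_smult[OF lpow(1) r(1)] by simp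
      then have "e s \<noteq> \<zero>\<^bsub>F\<^esub>"
        using F.integral_iff[of "?l [^]\<^bsub>?D\<^esub> k" "e r"] lpow[of k] r DF by auto
      moreover have "e s = e (?l [^]\<^bsub>?D\<^esub> k \<odot>\<^bsub>?P\<^esub> t) \<otimes>\<^bsub>F\<^esub> b"
        unfolding es t(2) e_smult[OF lpow(1) t(1)]
        using F.m_assoc[of "?l [^]\<^bsub>?D\<^esub> k" "e t" b] lpow(1)[of k] DF t(1) bF by auto
      moreover have "?l [^]\<^bsub>?D\<^esub> k \<odot>\<^bsub>?P\<^esub> t \<in> carrier ?P"
        using U.smult_closed[of "?l [^]\<^bsub>?D\<^esub> k" t] lpow(1)[of k] t(1) by simp
      ultimately have "Q s" unfolding Q_def using s by blast
      then have "deg ?D r \<le> deg ?D s" by (rule r_min)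
      moreover have "s \<noteq> \<zero>\<^bsub>?P\<^esub>" using \<open>e s \<noteq> \<zero>\<^bsub>F\<^esub>\<close> by auto
      ultimately show ?thesis using sd by auto
    qed
    have "deg ?D r = 0"
    proof -
      let ?lr = "coeff ?P r (deg ?D r)"
      have lr: "?lr \<in> D" "?lr \<noteq> \<zero>\<^bsub>F\<^esub>" using U.lcoeff_closed[OF r(1)] U.lcoeff_nonzero2[OF r(1) r0] by simp_all
      have lrpow: "?lr [^]\<^bsub>?D\<^esub> (k::nat) \<in> D" "?lr [^]\<^bsub>?D\<^esub> k \<noteq> \<zero>\<^bsub>F\<^esub>" for k
        using lr D.nat_pow_closed[of ?lr k] D.nat_pow_nonzero[of ?lr k] by auto
      obtain q s and k :: nat where q: "q \<in> carrier ?P" and s: "s \<in> carrier ?P"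
        and eq: "?lr [^]\<^bsub>?D\<^esub> k \<odot>\<^bsub>?P\<^esub> p = r \<otimes>\<^bsub>?P\<^esub> q \<oplus>\<^bsub>?P\<^esub> s" and sd: "s = \<zero>\<^bsub>?P\<^esub> \<or> deg ?D s < deg ?D r"
        using U.long_div_theorem[OF r(1) p(1) r0] by blast
      have z: "e r \<otimes>\<^bsub>F\<^esub> e q \<oplus>\<^bsub>F\<^esub> e s = \<zero>\<^bsub>F\<^esub>"
      proof -
        have "e (r \<otimes>\<^bsub>?P\<^esub> q \<oplus>\<^bsub>?P\<^esub> s) = \<zero>\<^bsub>F\<^esub>"
          unfolding eq[symmetric] e_smult[OF lrpow(1) p(1)] p(2) using lrpow(1)[of k] DF by auto
        then show ?thesis using r q s by simp
      qed
      have "e s = e (\<ominus>\<^bsub>?P\<^esub> (q \<otimes>\<^bsub>?P\<^esub> t)) \<otimes>\<^bsub>F\<^esub> b"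
      proof -
        have comm: "e t \<otimes>\<^bsub>F\<^esub> b \<otimes>\<^bsub>F\<^esub> e q = e q \<otimes>\<^bsub>F\<^esub> e t \<otimes>\<^bsub>F\<^esub> b"
          using q t(1) bF by (simp add: F.m_ac)
        have "e s = \<ominus>\<^bsub>F\<^esub> (e r \<otimes>\<^bsub>F\<^esub> e q)"
          using F.minus_equality[of "e s" "e r \<otimes>\<^bsub>F\<^esub> e q"] z r q s F.a_comm by simp
        also have "\<dots> = e (\<ominus>\<^bsub>?P\<^esub> (q \<otimes>\<^bsub>?P\<^esub> t)) \<otimes>\<^bsub>F\<^esub> b"
          unfolding t(2) comm using q t(1) bF by (simp add: F.l_minus)
        finally show ?thesis .
      qed
      moreover have "\<ominus>\<^bsub>?P\<^esub> (q \<otimes>\<^bsub>?P\<^esub> t) \<in> carrier ?P" using q t(1) by simp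
      ultimately have Qs: "e s \<noteq> \<zero>\<^bsub>F\<^esub> \<Longrightarrow> Q s" unfolding Q_def using s by blast
      have "s = \<zero>\<^bsub>?P\<^esub>"
      proof (rule ccontr)
        assume s0: "s \<noteq> \<zero>\<^bsub>?P\<^esub>"
        then have lt: "deg ?D s < deg ?D r" using sd by simp
        have "e s = \<zero>\<^bsub>F\<^esub>" using Qs r_min[of s] lt by auto
        then show False using p_min[OF s _ s0] lt r_less by simp
      qed
      then have eq': "?lr [^]\<^bsub>?D\<^esub> k \<odot>\<^bsub>?P\<^esub> p = r \<otimes>\<^bsub>?P\<^esub> q" using eq r q by simp
      have "e q = \<zero>\<^bsub>F\<^esub>" using z \<open>s = \<zero>\<^bsub>?P\<^esub>\<close> F.integral_iff[of "e r" "e q"] r q by auto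
      moreover have q0: "q \<noteq> \<zero>\<^bsub>?P\<^esub>"
      proof
        assume "q = \<zero>\<^bsub>?P\<^esub>"
        then have "?lr [^]\<^bsub>?D\<^esub> k \<odot>\<^bsub>?P\<^esub> p = \<zero>\<^bsub>?P\<^esub>" using eq' r by simp
        then have "coeff ?P (?lr [^]\<^bsub>?D\<^esub> k \<odot>\<^bsub>?P\<^esub> p) (deg ?D p) = \<zero>\<^bsub>F\<^esub>" by simp
        then have "?lr [^]\<^bsub>?D\<^esub> k \<otimes>\<^bsub>F\<^esub> ?l = \<zero>\<^bsub>F\<^esub>" using lrpow(1)[of k] p(1) by simp
        then show False
          using F.integral_iff[of "?lr [^]\<^bsub>?D\<^esub> k" ?l] lrpow[of k] l DF by auto
      qed
      ultimately have "deg ?D p \<le> deg ?D q" using p_min[OF q] by simp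
      moreover have "deg ?D r + deg ?D q = deg ?D (r \<otimes>\<^bsub>?P\<^esub> q)" using U.deg_mult[OF r0 q0 r(1) q] by simp
      moreover have "deg ?D (r \<otimes>\<^bsub>?P\<^esub> q) \<le> deg ?D p"
        unfolding eq'[symmetric] using U.deg_smult_decr[of "?lr [^]\<^bsub>?D\<^esub> k" p] lrpow(1)[of k] p(1) by simp
      ultimately show ?thesis by simp
    qed
    define d where "d = coeff ?P r 0"
    have rd: "r = monom ?P d 0" using U.deg_zero_impl_monom[OF r(1) \<open>deg ?D r = 0\<close>] unfolding d_def .
    have d: "d \<in> D" using U.coeff_closed[OF r(1), of 0] unfolding d_def by simp
    have db: "d = e t \<otimes>\<^bsub>F\<^esub> b" and d0: "d \<noteq> \<zero>\<^bsub>F\<^esub>" using ext(2)[OF d] rd t r by metis+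
    let ?a = "?l \<otimes>\<^bsub>F\<^esub> d"
    have a: "?a \<in> D" "?a \<noteq> \<zero>\<^bsub>F\<^esub>"
      using subringE(6)[OF D l(1) d] F.integral_iff[of ?l d] l d d0 DF by auto
    show ?thesis
    proof (rule that[OF a], unfold homs_extend_def, intro ballI impI)
      fix \<phi> assume \<phi>: "\<phi> \<in> ring_hom ?D K" and nz: "\<phi> ?a \<noteq> \<zero>\<^bsub>K\<^esub>"
      interpret \<phi>: ring_hom_ring ?D K \<phi> using \<phi> by (intro ring_hom_ringI2) unfold_locales
      have "\<phi> ?a = \<phi> ?l \<otimes>\<^bsub>K\<^esub> \<phi> d" using \<phi>.hom_mult[of ?l d] l d by simp
      moreover have \<phi>c: "\<phi> ?l \<in> carrier K" "\<phi> d \<in> carrier K" using \<phi>.hom_closed l d by simp_all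
      ultimately have nl: "\<phi> ?l \<noteq> \<zero>\<^bsub>K\<^esub>" and nd: "\<phi> d \<noteq> \<zero>\<^bsub>K\<^esub>" using nz by auto
      \<comment> \<open>This root exists because the leading coefficient and the positive degree of \<open>p\<close> survive \<open>\<phi>\<close>.\<close>
      obtain c where c: "c \<in> carrier K" "eval ?D K \<phi> c p = \<zero>\<^bsub>K\<^esub>"
        using UP_eval_root[OF D.cring_axioms K \<phi> p(1) nl p_pos K.zero_closed] .
      note h = UP_eval_ring_hom[OF D.cring_axioms K.cring_axioms \<phi> c(1)]
      let ?h = "eval ?D K \<phi> c"
      interpret h: ring_hom_ring ?P K ?h using h(1) by (intro ring_hom_ringI2) unfold_locales
      have h_smult: "?h (d \<odot>\<^bsub>?P\<^esub> p) = \<phi> d \<otimes>\<^bsub>K\<^esub> ?h p" if "d \<in> D" "p \<in> carrier ?P" for d p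
      proof -
        have "d \<odot>\<^bsub>?P\<^esub> p = monom ?P d 0 \<otimes>\<^bsub>?P\<^esub> p" using U.monom_mult_is_smult that by simp
        then show ?thesis using h.hom_mult[OF _ that(2)] U.monom_closed[of d 0] that(1) h(2) by simp
      qed
      have ker: "?h g = \<zero>\<^bsub>K\<^esub>" if g: "g \<in> carrier ?P" and eg: "e g = \<zero>\<^bsub>F\<^esub>" for g
      proof -
        obtain q s and k :: nat where q: "q \<in> carrier ?P" and s: "s \<in> carrier ?P"
          and eq: "?l [^]\<^bsub>?D\<^esub> k \<odot>\<^bsub>?P\<^esub> g = p \<otimes>\<^bsub>?P\<^esub> q \<oplus>\<^bsub>?P\<^esub> s" and sd: "s = \<zero>\<^bsub>?P\<^esub> \<or> deg ?D s < deg ?D p"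
          using U.long_div_theorem[OF p(1) g p(3)] by blast
        have "e (?l [^]\<^bsub>?D\<^esub> k \<odot>\<^bsub>?P\<^esub> g) = e s" unfolding eq using p q s by simp
        then have "e s = \<zero>\<^bsub>F\<^esub>" using e_smult[OF lpow(1) g] eg lpow(1)[of k] DF by auto
        then have "s = \<zero>\<^bsub>?P\<^esub>" using p_min[OF s] sd by force
        then have "?h (?l [^]\<^bsub>?D\<^esub> k \<odot>\<^bsub>?P\<^esub> g) = \<zero>\<^bsub>K\<^esub>" unfolding eq using p q c by simp
        then have "\<phi> (?l [^]\<^bsub>?D\<^esub> k) \<otimes>\<^bsub>K\<^esub> ?h g = \<zero>\<^bsub>K\<^esub>" using h_smult[OF lpow(1) g] by simp
        moreover have "\<phi> (?l [^]\<^bsub>?D\<^esub> k) = \<phi> ?l [^]\<^bsub>K\<^esub> k"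
          using \<phi>.hom_nat_pow[of ?l k] l(1) by simp
        moreover have "\<phi> ?l [^]\<^bsub>K\<^esub> k \<noteq> \<zero>\<^bsub>K\<^esub>" using K.nat_pow_nonzero[OF \<phi>c(1) nl] by simp
        ultimately show ?thesis
          using K.integral_iff[of "\<phi> ?l [^]\<^bsub>K\<^esub> k" "?h g"] \<phi>c h.hom_closed[OF g] by auto
      qed
      obtain \<psi> where \<psi>: "\<psi> \<in> ring_hom (F\<lparr>carrier := ?E\<rparr>) K" and \<psi>\<phi>: "\<forall>d\<in>D. \<psi> d = \<phi> d"
        and \<psi>e: "\<forall>p \<in> carrier ?P. e p \<in> ?E \<longrightarrow> \<psi> (e p) = ?h p"
        using lift[OF \<phi> c(1) ker] by blast
      have "?h t \<otimes>\<^bsub>K\<^esub> ?h f = \<phi> d"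
      proof -
        have "e (r \<ominus>\<^bsub>?P\<^esub> t \<otimes>\<^bsub>?P\<^esub> f) = \<zero>\<^bsub>F\<^esub>"
          using r t f bf by (simp add: U.P.minus_eq F.r_neg)
        then have "?h (r \<ominus>\<^bsub>?P\<^esub> t \<otimes>\<^bsub>?P\<^esub> f) = \<zero>\<^bsub>K\<^esub>" using ker r t f by simp
        then have "?h r = ?h t \<otimes>\<^bsub>K\<^esub> ?h f"
          using r t f K.r_right_minus_eq[of "?h r" "?h t \<otimes>\<^bsub>K\<^esub> ?h f"]
          by (simp add: U.P.minus_eq K.minus_eq)
        moreover have "?h r = \<phi> d" unfolding rd using h(2)[of d] d by simp
        ultimately show ?thesis by simp
      qed
      then have "?h f \<noteq> \<zero>\<^bsub>K\<^esub>" using nd t(1) by auto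
      then have "\<psi> b \<noteq> \<zero>\<^bsub>K\<^esub>" using \<psi>e f b(1) unfolding bf by auto
      then show "\<exists>\<psi> \<in> ring_hom (F\<lparr>carrier := ?E\<rparr>) K. (\<forall>d\<in>D. \<psi> d = \<phi> d) \<and> \<psi> b \<noteq> \<zero>\<^bsub>K\<^esub>"
        using \<psi> \<psi>\<phi> by blast
    qed
  qed
qed


text \<open>
  Generators are added one at a time; the element that the last step requires to be nonzero is handed down to the
  steps before it.
\<close>

lemma hom_extension_finite:
  assumes K: "algebraically_closed K" and F: "domain F" and D: "subring D F"
    and U: "finite U" "U \<subseteq> carrier F" and b: "b \<in> generate_ring F (D \<union> U)" "b \<noteq> \<zero>\<^bsub>F\<^esub>"
  shows "\<exists>a \<in> D. a \<noteq> \<zero>\<^bsub>F\<^esub> \<and> homs_extend K F D a (generate_ring F (D \<union> U)) b"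
  using U b
proof (induction U arbitrary: b rule: finite_induct)
  interpret F: domain F by fact
  have DF: "D \<subseteq> carrier F" using subringE(1)[OF D] .
  {
    case empty
    have "generate_ring F D = D"
      using F.generate_ring_min_subring1[OF DF D] F.generate_ring_incl[OF DF] generate_ring.incl[of _ D F] by auto
    then show ?case using empty by (auto simp: homs_extend_def)
  next
    case (insert u U)
    let ?D1 = "generate_ring F (D \<union> U)" and ?E = "generate_ring F (D \<union> insert u U)"
    have sub: "D \<union> U \<subseteq> carrier F" and u: "u \<in> carrier F" using DF insert.prems by auto
    have D1: "subring ?D1 F" using F.generate_ring_is_subring[OF sub] .
    have D1F: "?D1 \<subseteq> carrier F" using subringE(1)[OF D1] .
    have "D \<union> insert u U \<subseteq> generate_ring F (insert u ?D1)"
      by (auto intro: generate_ring.incl)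
    then have E: "?E \<subseteq> generate_ring F (insert u ?D1)"
      using F.generate_ring_min_subring1[OF _ F.generate_ring_is_subring] sub u D1F by auto
    then have "b \<in> generate_ring F (insert u ?D1)" using insert.prems by auto
    then obtain a1 where a1: "a1 \<in> ?D1" "a1 \<noteq> \<zero>\<^bsub>F\<^esub>"
      and ext1: "homs_extend K F ?D1 a1 (generate_ring F (insert u ?D1)) b"
      by (rule hom_extension_step[OF K F D1 u _ insert.prems(3)])
    obtain a where a: "a \<in> D" "a \<noteq> \<zero>\<^bsub>F\<^esub>" and ext: "homs_extend K F D a ?D1 a1"
      using insert.IH[OF _ a1] insert.prems(1) by auto
    have "D \<subseteq> ?D1" by (auto intro: generate_ring.incl)
    from homs_extend_restrict[OF homs_extend_trans[OF ext ext1 this] E] show ?case using a by blast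
  }
qed

section \<open>Zariski's lemma\<close>

lemma field_hom_eq_zero:
  assumes "field F" and "ring S" and "\<one>\<^bsub>S\<^esub> \<noteq> \<zero>\<^bsub>S\<^esub>" and h: "h \<in> ring_hom F S"
    and x: "x \<in> carrier F" "h x = \<zero>\<^bsub>S\<^esub>"
  shows "x = \<zero>\<^bsub>F\<^esub>"
proof (rule ccontr)
  interpret F: field F by fact
  interpret S: ring S by fact
  assume "x \<noteq> \<zero>\<^bsub>F\<^esub>"
  then have u: "x \<in> Units F" using x F.field_Units by simp
  then have "h (inv\<^bsub>F\<^esub> x) \<in> carrier S" using ring_hom_closed[OF h] by simp
  moreover have "h (inv\<^bsub>F\<^esub> x) \<otimes>\<^bsub>S\<^esub> h x = \<one>\<^bsub>S\<^esub>"
    using ring_hom_mult[OF h, of "inv\<^bsub>F\<^esub> x" x] u x F.Units_l_inv[OF u] ring_hom_one[OF h] by simp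
  ultimately show False using x(2) assms(3) by simp
qed

text \<open>
  Zariski's lemma for the field \<open>B/I\<close>: the inverse of \<open>K \<rightarrow> B/I\<close>, defined on the image of \<open>K\<close>, extends to a homomorphism
  \<open>\<psi>\<close> from all of \<open>B/I\<close> to \<open>K\<close>. As a homomorphism out of a field, \<open>\<psi>\<close> is injective, and so every \<open>y\<close> agrees
  with the scalar \<open>\<psi>(y)\<close>.
\<close>

theorem finitely_generated_residue_field:
  assumes K: "algebraically_closed K" and B: "cring B" and I: "maximalideal I B"
    and \<kappa>: "\<kappa> \<in> ring_hom K B" and U: "finite U" "U \<subseteq> carrier B"
    and gen: "carrier B \<subseteq> generate_ring B (\<kappa> ` carrier K \<union> U)"
    and b: "b \<in> carrier B"
  obtains c where "c \<in> carrier K" and "b \<ominus>\<^bsub>B\<^esub> \<kappa> c \<in> I"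
proof -
  interpret K: algebraically_closed K by fact
  interpret B: cring B by fact
  interpret I: maximalideal I B by fact
  let ?F = "B Quot I"
  interpret F: field ?F using I.quotient_is_field[OF B] .
  let ?\<pi> = "(+>\<^bsub>B\<^esub>) I"
  have \<pi>: "?\<pi> \<in> ring_hom B ?F" using I.rcos_ring_hom .
  interpret \<pi>: ring_hom_ring B ?F ?\<pi> by (rule ring_hom_ringI2[OF B.ring_axioms F.ring_axioms \<pi>])
  define \<iota> where "\<iota> c = ?\<pi> (\<kappa> c)" for c
  have \<iota>: "\<iota> \<in> ring_hom K ?F"
    unfolding \<iota>_def using ring_hom_trans[OF \<kappa> \<pi>] by (simp add: comp_def)
  interpret \<iota>: ring_hom_ring K ?F \<iota> by (rule ring_hom_ringI2[OF K.ring_axioms F.ring_axioms \<iota>])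
  let ?D = "\<iota> ` carrier K"
  have D: "subring ?D ?F" using \<iota>.img_is_subring[OF K.carrier_is_subring] .
  have subB: "\<kappa> ` carrier K \<union> U \<subseteq> carrier B" using ring_hom_closed[OF \<kappa>] U by auto
  have gF: "?\<pi> y \<in> generate_ring ?F (?D \<union> ?\<pi> ` U)" if "y \<in> generate_ring B (\<kappa> ` carrier K \<union> U)" for y
    using that
  proof (induction rule: generate_ring.induct)
    case one
    then show ?case using generate_ring.one[of ?F] by simp
  next
    case (incl h)
    then have "?\<pi> h \<in> ?D \<union> ?\<pi> ` U" unfolding \<iota>_def by blast
    then show ?case by (rule generate_ring.incl)
  next
    case (a_inv h)
    have "h \<in> carrier B" by (rule B.generate_ring_in_carrier[OF subB a_inv.hyps])
    then show ?case using generate_ring.a_inv[OF a_inv.IH] by (simp only: \<pi>.hom_a_inv)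
  next
    case (eng_add h1 h2)
    have "h1 \<in> carrier B" "h2 \<in> carrier B"
      by (rule B.generate_ring_in_carrier[OF subB eng_add.hyps(1)], rule B.generate_ring_in_carrier[OF subB eng_add.hyps(2)])
    then show ?case using generate_ring.eng_add[OF eng_add.IH] by (simp only: \<pi>.hom_add)
  next
    case (eng_mult h1 h2)
    have "h1 \<in> carrier B" "h2 \<in> carrier B"
      by (rule B.generate_ring_in_carrier[OF subB eng_mult.hyps(1)], rule B.generate_ring_in_carrier[OF subB eng_mult.hyps(2)])
    then show ?case using generate_ring.eng_mult[OF eng_mult.IH] by (simp only: \<pi>.hom_mult)
  qed
  have carF: "carrier ?F = ?\<pi> ` carrier B" unfolding FactRing_def A_RCOSETS_def' by auto
  have UF: "finite (?\<pi> ` U)" "?\<pi> ` U \<subseteq> carrier ?F"     by (rule finite_imageI[OF U(1)], rule image_subsetI, rule \<pi>.hom_closed, rule subsetD[OF U(2)])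
  have "generate_ring ?F (?D \<union> ?\<pi> ` U) \<subseteq> carrier ?F"
    by (rule F.generate_ring_incl) (use UF(2) subringE(1)[OF D] in simp)
  then have genF: "generate_ring ?F (?D \<union> ?\<pi> ` U) = carrier ?F"
    unfolding carF by (rule antisym) (intro image_subsetI gF, erule subsetD[OF gen])
  obtain \<phi> where \<phi>: "\<phi> \<in> ring_hom (?F\<lparr>carrier := ?D\<rparr>) K" and \<phi>\<iota>: "\<And>c. c \<in> carrier K \<Longrightarrow> \<phi> (\<iota> c) = c"
  proof -
    have "id \<in> ring_hom K K" by (auto intro!: ring_hom_memI)
    then interpret ring_hom_ring K K id by (rule ring_hom_ringI2[OF K.ring_axioms K.ring_axioms])
    have "id c = \<zero>\<^bsub>K\<^esub>" if "c \<in> carrier K" "\<iota> c = \<zero>\<^bsub>?F\<^esub>" for c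
      using field_hom_eq_zero[OF K.field_axioms F.ring_axioms F.one_not_zero \<iota> that] by simp
    from factor_through_image[OF \<iota> F.ring_axioms this]
    obtain \<phi> where "\<phi> \<in> ring_hom (?F\<lparr>carrier := ?D\<rparr>) K" "\<forall>c \<in> carrier K. \<phi> (\<iota> c) = id c" by blast
    then show thesis using that[of \<phi>] by simp
  qed
  \<comment> \<open>Only the extension itself matters here, and \<open>1\<close> is a convenient element to keep nonzero.\<close>
  have one: "\<one>\<^bsub>?F\<^esub> \<in> generate_ring ?F (?D \<union> ?\<pi> ` U)" by (rule generate_ring.one)
  from hom_extension_finite[OF K F.domain_axioms D UF one F.one_not_zero, unfolded genF]
  obtain a where a: "a \<in> ?D" "a \<noteq> \<zero>\<^bsub>?F\<^esub>"
    and ext: "homs_extend K ?F ?D a (carrier ?F) \<one>\<^bsub>?F\<^esub>"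
    by (elim bexE conjE)
  obtain k where k: "k \<in> carrier K" "a = \<iota> k" using a(1) by (rule imageE)
  have "\<phi> a \<noteq> \<zero>\<^bsub>K\<^esub>"
  proof
    assume "\<phi> a = \<zero>\<^bsub>K\<^esub>"
    then have "k = \<zero>\<^bsub>K\<^esub>" using \<phi>\<iota>[OF k(1)] k(2) by simp
    then show False using a(2) k(2) \<iota>.hom_zero by simp
  qed
  with bspec[OF ext[unfolded homs_extend_def] \<phi>]
  obtain \<psi> where \<psi>: "\<psi> \<in> ring_hom ?F K" and \<psi>\<phi>: "\<forall>d\<in>?D. \<psi> d = \<phi> d"
    by (elim impE) auto
  interpret \<psi>: ring_hom_ring ?F K \<psi> by (rule ring_hom_ringI2[OF F.ring_axioms K.ring_axioms \<psi>])
  define c where "c = \<psi> (?\<pi> b)"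
  have c: "c \<in> carrier K" unfolding c_def using b by simp
  have bc: "b \<ominus>\<^bsub>B\<^esub> \<kappa> c \<in> carrier B" using b ring_hom_closed[OF \<kappa> c] by simp
  have \<kappa>c: "\<kappa> c \<in> carrier B" using ring_hom_closed[OF \<kappa> c] .
  have eq: "?\<pi> (b \<ominus>\<^bsub>B\<^esub> \<kappa> c) = ?\<pi> b \<ominus>\<^bsub>?F\<^esub> \<iota> c"
    unfolding B.minus_eq F.minus_eq \<iota>_def
    using \<pi>.hom_add[OF b B.a_inv_closed[OF \<kappa>c]] \<pi>.hom_a_inv[OF \<kappa>c] by simp
  have "\<psi> (?\<pi> b \<ominus>\<^bsub>?F\<^esub> \<iota> c) = \<psi> (?\<pi> b) \<oplus>\<^bsub>K\<^esub> \<ominus>\<^bsub>K\<^esub> \<psi> (\<iota> c)"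
    unfolding F.minus_eq
    using \<psi>.hom_add[OF \<pi>.hom_closed[OF b] F.a_inv_closed[OF \<iota>.hom_closed[OF c]]]
    unfolding \<psi>.hom_a_inv[OF \<iota>.hom_closed[OF c]] .
  then have "\<psi> (?\<pi> b \<ominus>\<^bsub>?F\<^esub> \<iota> c) = c \<ominus>\<^bsub>K\<^esub> \<psi> (\<iota> c)"
    unfolding K.minus_eq c_def .
  then have "\<psi> (?\<pi> (b \<ominus>\<^bsub>B\<^esub> \<kappa> c)) = c \<ominus>\<^bsub>K\<^esub> \<psi> (\<iota> c)" unfolding eq .
  also have "\<dots> = \<zero>\<^bsub>K\<^esub>" using bspec[OF \<psi>\<phi> imageI[OF c]] \<phi>\<iota>[OF c] c by (simp add: K.minus_eq K.r_neg)
  finally have "?\<pi> (b \<ominus>\<^bsub>B\<^esub> \<kappa> c) = \<zero>\<^bsub>?F\<^esub>"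
    using field_hom_eq_zero[OF F.field_axioms K.ring_axioms K.one_not_zero \<psi> \<pi>.hom_closed[OF bc]] by simp
  then have "b \<ominus>\<^bsub>B\<^esub> \<kappa> c \<in> I"
    using I.a_rcos_self[OF bc] unfolding FactRing_def by (simp only: ring_record_simps)
  with c that show thesis by blast
qed


section \<open>The skew group ring\<close>

locale skew_action = R: cring R + G: group G
  for R :: "('k, 'r, 'c) module_scheme" (structure) and G :: "('g, 'd) monoid_scheme" +
  fixes act :: "'g \<Rightarrow> 'r \<Rightarrow> 'r"
  assumes act_hom: "g \<in> carrier G \<Longrightarrow> act g \<in> ring_hom R R"
    and act_one: "r \<in> carrier R \<Longrightarrow> act \<one>\<^bsub>G\<^esub> r = r"
    and act_mult: "\<lbrakk>g \<in> carrier G; h \<in> carrier G; r \<in> carrier R\<rbrakk> \<Longrightarrow> act (g \<otimes>\<^bsub>G\<^esub> h) r = act g (act h r)"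
begin

abbreviation A :: "('k, 'g \<Rightarrow> 'r) module" where "A \<equiv> skew_group_ring R G act"

abbreviation mon :: "'r \<Rightarrow> 'g \<Rightarrow> 'g \<Rightarrow> 'r" where "mon \<equiv> skew_monom R"

lemma act_simps [simp]:
  assumes "g \<in> carrier G"
  shows "r \<in> carrier R \<Longrightarrow> act g r \<in> carrier R"
    and "act g \<one> = \<one>"
    and "act g \<zero> = \<zero>"
    and "\<lbrakk>r \<in> carrier R; s \<in> carrier R\<rbrakk> \<Longrightarrow> act g (r \<oplus> s) = act g r \<oplus> act g s"
    and "\<lbrakk>r \<in> carrier R; s \<in> carrier R\<rbrakk> \<Longrightarrow> act g (r \<otimes> s) = act g r \<otimes> act g s"
  using act_hom[OF assms] ring_hom_zero[OF act_hom[OF assms] R.ring_axioms R.ring_axioms]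
  by (auto simp: ring_hom_def)

lemma act_inv_cancel [simp]:
  assumes "g \<in> carrier G" and "r \<in> carrier R"
  shows "act g (act (inv\<^bsub>G\<^esub> g) r) = r" and "act (inv\<^bsub>G\<^esub> g) (act g r) = r"
  using assms act_mult[of g "inv\<^bsub>G\<^esub> g" r] act_mult[of "inv\<^bsub>G\<^esub> g" g r] act_one by simp_all

lemma skew_carrier:
  "a \<in> carrier A \<longleftrightarrow>
     (\<forall>g. a g \<in> carrier R) \<and> finite {g. a g \<noteq> \<zero>} \<and> {g. a g \<noteq> \<zero>} \<subseteq> carrier G"
  unfolding skew_group_ring_def by auto

lemma skew_coeff [simp]: "a \<in> carrier A \<Longrightarrow> a g \<in> carrier R"
  and skew_outside: "\<lbrakk>a \<in> carrier A; g \<notin> carrier G\<rbrakk> \<Longrightarrow> a g = \<zero>"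
  and skew_finite: "a \<in> carrier A \<Longrightarrow> finite {g. a g \<noteq> \<zero>}"
  unfolding skew_carrier by auto

lemma skew_ops:
  "\<zero>\<^bsub>A\<^esub> = (\<lambda>g. \<zero>)" "a \<oplus>\<^bsub>A\<^esub> b = (\<lambda>g. a g \<oplus> b g)" "\<one>\<^bsub>A\<^esub> = mon \<one> \<one>\<^bsub>G\<^esub>"
  "c \<odot>\<^bsub>A\<^esub> a = (\<lambda>g. c \<odot> a g)"
  by (simp_all add: skew_group_ring_def skew_monom_def)

lemma mon_closed [simp]: "\<lbrakk>r \<in> carrier R; g \<in> carrier G\<rbrakk> \<Longrightarrow> mon r g \<in> carrier A"
  unfolding skew_carrier skew_monom_def by (auto intro: finite_subset[of _ "{g}"])

lemma skew_mult_eq: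
  "(a \<otimes>\<^bsub>A\<^esub> b) k =
     (\<Oplus>p \<in> {(g, h). a g \<noteq> \<zero> \<and> b h \<noteq> \<zero> \<and> g \<otimes>\<^bsub>G\<^esub> h = k}.
        a (fst p) \<otimes> act (fst p) (b (snd p)))"
  by (simp add: skew_group_ring_def)

lemma mult_outside:
  assumes "a \<in> carrier A" "b \<in> carrier A" "k \<notin> carrier G"
  shows "(a \<otimes>\<^bsub>A\<^esub> b) k = \<zero>"
proof -
  have "{(g, h). a g \<noteq> \<zero> \<and> b h \<noteq> \<zero> \<and> g \<otimes>\<^bsub>G\<^esub> h = k} = {}"
    using assms skew_outside by (auto dest: G.m_closed) (metis G.m_closed)
  then show ?thesis unfolding skew_mult_eq by (simp only: R.finsum_empty)
qed

text \<open>
  A pair \<open>(g, h)\<close> with \<open>g h = k\<close> is determined by \<open>g\<close>. The index set \<open>S\<close> may be larger than the support of \<open>a\<close>, so that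
  the products \<open>a b\<close> and \<open>a' b\<close> can be compared term by term.
\<close>

lemma mult_convolution:
  assumes a: "a \<in> carrier A" and b: "b \<in> carrier A" and k: "k \<in> carrier G"
    and S: "finite S" "{g. a g \<noteq> \<zero>} \<subseteq> S" "S \<subseteq> carrier G"
  shows "(a \<otimes>\<^bsub>A\<^esub> b) k = (\<Oplus>g \<in> S. a g \<otimes> act g (b (inv\<^bsub>G\<^esub> g \<otimes>\<^bsub>G\<^esub> k)))"
proof -
  let ?P = "{(g, h). a g \<noteq> \<zero> \<and> b h \<noteq> \<zero> \<and> g \<otimes>\<^bsub>G\<^esub> h = k}"
  let ?f = "\<lambda>g. a g \<otimes> act g (b (inv\<^bsub>G\<^esub> g \<otimes>\<^bsub>G\<^esub> k))"
  have P: "g \<in> carrier G \<and> h = inv\<^bsub>G\<^esub> g \<otimes>\<^bsub>G\<^esub> k" if "(g, h) \<in> ?P" for g h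
  proof -
    have "g \<in> carrier G" "h \<in> carrier G" using that skew_outside[OF a] skew_outside[OF b] by auto
    then show ?thesis using that by (auto simp: G.m_assoc[symmetric])
  qed
  have inj: "inj_on fst ?P" using P by (auto intro!: inj_onI) (metis)+
  have closed: "?f g \<in> carrier R" if "g \<in> S" for g using that S(3) a b by (simp add: subset_iff)
  have fst_P: "fst ` ?P \<subseteq> S" using S(2) by auto
  have "(a \<otimes>\<^bsub>A\<^esub> b) k = (\<Oplus>p \<in> ?P. a (fst p) \<otimes> act (fst p) (b (snd p)))"
    by (rule skew_mult_eq)
  also have "\<dots> = (\<Oplus>p \<in> ?P. ?f (fst p))"
  proof (rule R.finsum_cong')
    show "(\<lambda>p. ?f (fst p)) \<in> ?P \<rightarrow> carrier R" using closed fst_P by blast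
    show "a (fst p) \<otimes> act (fst p) (b (snd p)) = ?f (fst p)" if "p \<in> ?P" for p
      using P[of "fst p" "snd p"] that by (metis prod.collapse)
  qed simp
  also have "\<dots> = (\<Oplus>g \<in> fst ` ?P. ?f g)"
    by (rule R.finsum_reindex[symmetric]) (use closed fst_P inj in auto)
  also have "\<dots> = (\<Oplus>g \<in> S. ?f g)"
  proof (rule R.add.finprod_mono_neutral_cong_left[OF S(1) fst_P])
    fix g assume g: "g \<in> S - fst ` ?P"
    then have gG: "g \<in> carrier G" using S(3) by auto
    have "g \<otimes>\<^bsub>G\<^esub> (inv\<^bsub>G\<^esub> g \<otimes>\<^bsub>G\<^esub> k) = k"
      using gG k by (simp add: G.m_assoc[symmetric])
    then have "a g = \<zero> \<or> b (inv\<^bsub>G\<^esub> g \<otimes>\<^bsub>G\<^esub> k) = \<zero>" using g by force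
    then show "?f g = \<zero>" using a b gG by auto
  qed (use closed in auto)
  finally show ?thesis .
qed

lemma mult_closed:
  assumes a: "a \<in> carrier A" and b: "b \<in> carrier A"
  shows "a \<otimes>\<^bsub>A\<^esub> b \<in> carrier A"
proof -
  let ?Sa = "{g. a g \<noteq> \<zero>}" and ?Sb = "{g. b g \<noteq> \<zero>}"
  have sa: "?Sa \<subseteq> carrier G" using a unfolding skew_carrier by simp
  have zero: "(a \<otimes>\<^bsub>A\<^esub> b) k = \<zero>" if "k \<notin> (\<lambda>p. fst p \<otimes>\<^bsub>G\<^esub> snd p) ` (?Sa \<times> ?Sb)" for k
  proof -
    have "{(g, h). a g \<noteq> \<zero> \<and> b h \<noteq> \<zero> \<and> g \<otimes>\<^bsub>G\<^esub> h = k} = {}" using that by force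
    then show ?thesis unfolding skew_mult_eq by (simp only: R.finsum_empty)
  qed
  have "finite {k. (a \<otimes>\<^bsub>A\<^esub> b) k \<noteq> \<zero>}"
    by (rule finite_subset[of _ "(\<lambda>p. fst p \<otimes>\<^bsub>G\<^esub> snd p) ` (?Sa \<times> ?Sb)"])
      (use zero skew_finite a b in auto)
  moreover have "(a \<otimes>\<^bsub>A\<^esub> b) k \<in> carrier R" for k
  proof (cases "k \<in> carrier G")
    case True
    show ?thesis
      unfolding mult_convolution[OF a b True skew_finite[OF a] subset_refl sa]
      using sa a b by (intro R.finsum_closed) auto
  qed (simp add: mult_outside[OF a b])
  moreover have "{k. (a \<otimes>\<^bsub>A\<^esub> b) k \<noteq> \<zero>} \<subseteq> carrier G" using mult_outside[OF a b] by auto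
  ultimately show ?thesis unfolding skew_carrier by simp
qed

lemma mon_mult:
  assumes r: "r \<in> carrier R" and g: "g \<in> carrier G" and b: "b \<in> carrier A" and k: "k \<in> carrier G"
  shows "(mon r g \<otimes>\<^bsub>A\<^esub> b) k = r \<otimes> act g (b (inv\<^bsub>G\<^esub> g \<otimes>\<^bsub>G\<^esub> k))"
proof -
  have sub: "{h. mon r g h \<noteq> \<zero>} \<subseteq> {g}" by (auto simp: skew_monom_def)
  have "(mon r g \<otimes>\<^bsub>A\<^esub> b) k = (\<Oplus>h \<in> {g}. mon r g h \<otimes> act h (b (inv\<^bsub>G\<^esub> h \<otimes>\<^bsub>G\<^esub> k)))"
    using sub g by (intro mult_convolution mon_closed r b k) auto
  then show ?thesis using r g b by (simp add: skew_monom_def)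
qed

lemma mon_mult_mon:
  assumes r: "r \<in> carrier R" "s \<in> carrier R" and g: "g \<in> carrier G" "h \<in> carrier G"
  shows "mon r g \<otimes>\<^bsub>A\<^esub> mon s h = mon (r \<otimes> act g s) (g \<otimes>\<^bsub>G\<^esub> h)"
proof
  fix k
  show "(mon r g \<otimes>\<^bsub>A\<^esub> mon s h) k = mon (r \<otimes> act g s) (g \<otimes>\<^bsub>G\<^esub> h) k"
  proof (cases "k \<in> carrier G")
    case True
    have "inv\<^bsub>G\<^esub> g \<otimes>\<^bsub>G\<^esub> k = h \<longleftrightarrow> k = g \<otimes>\<^bsub>G\<^esub> h"
      using True g by (metis G.inv_solve_left')
    then show ?thesis
      using mon_mult[OF r(1) g(1) mon_closed[OF r(2) g(2)] True] r g by (simp add: skew_monom_def)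
  next
    case False
    then have "k \<noteq> g \<otimes>\<^bsub>G\<^esub> h" using g by auto
    then show ?thesis
      using mult_outside[OF mon_closed[OF r(1) g(1)] mon_closed[OF r(2) g(2)] False]
      by (simp add: skew_monom_def)
  qed
qed

lemma add_closed:
  assumes a: "a \<in> carrier A" and b: "b \<in> carrier A"
  shows "a \<oplus>\<^bsub>A\<^esub> b \<in> carrier A"
proof -
  have "{g. a g \<oplus> b g \<noteq> \<zero>} \<subseteq> {g. a g \<noteq> \<zero>} \<union> {g. b g \<noteq> \<zero>}" by auto
  moreover have "\<dots> \<subseteq> carrier G" using a b unfolding skew_carrier by auto
  moreover have "finite ({g. a g \<noteq> \<zero>} \<union> {g. b g \<noteq> \<zero>})" using skew_finite a b by simp
  ultimately show ?thesis
    unfolding skew_carrier skew_ops using a b by (auto intro: finite_subset)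
qed

text \<open>
  There is no case for zero, because zero is the element \<open>0 g\<close> for any \<open>g\<close>.
\<close>

lemma skew_induct [consumes 1, case_names mon add]:
  assumes a: "a \<in> carrier A"
    and mon: "\<And>r g. \<lbrakk>r \<in> carrier R; g \<in> carrier G\<rbrakk> \<Longrightarrow> P (mon r g)"
    and add: "\<And>a b. \<lbrakk>a \<in> carrier A; b \<in> carrier A; P a; P b\<rbrakk> \<Longrightarrow> P (a \<oplus>\<^bsub>A\<^esub> b)"
  shows "P a"
proof -
  have "P a" if "finite F" "a \<in> carrier A" "{g. a g \<noteq> \<zero>} \<subseteq> F" for F a
    using that
  proof (induction F arbitrary: a rule: finite_induct)
    case empty
    then have "a = mon \<zero> \<one>\<^bsub>G\<^esub>" by (auto simp: skew_monom_def)
    then show ?case using mon[of "\<zero>" "\<one>\<^bsub>G\<^esub>"] by simp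
  next
    case (insert g F)
    show ?case
    proof (cases "a g = \<zero>")
      case True
      then have "{g. a g \<noteq> \<zero>} \<subseteq> F" using insert.prems by auto
      then show ?thesis using insert.IH insert.prems by blast
    next
      case False
      then have g: "g \<in> carrier G" using skew_outside insert.prems(1) by blast
      let ?b = "a(g := \<zero>)"
      have "{h. ?b h \<noteq> \<zero>} \<subseteq> {h. a h \<noteq> \<zero>}" by auto
      then have b: "?b \<in> carrier A"
        using insert.prems(1) unfolding skew_carrier by (auto intro: finite_subset)
      have Pb: "P ?b" by (rule insert.IH[OF b]) (use insert.prems in auto)
      have "a = mon (a g) g \<oplus>\<^bsub>A\<^esub> ?b"
        using insert.prems(1) by (auto simp: skew_ops skew_monom_def)
      then show ?thesis
        using add[OF mon_closed b mon Pb] g insert.prems(1) by (metis skew_coeff)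
    qed
  qed
  then show ?thesis using a skew_finite[OF a] by blast
qed

lemma skew_l_distr:
  assumes a: "a \<in> carrier A" and a': "a' \<in> carrier A" and b: "b \<in> carrier A"
  shows "(a \<oplus>\<^bsub>A\<^esub> a') \<otimes>\<^bsub>A\<^esub> b = (a \<otimes>\<^bsub>A\<^esub> b) \<oplus>\<^bsub>A\<^esub> (a' \<otimes>\<^bsub>A\<^esub> b)"
proof
  fix k
  let ?S = "{g. a g \<noteq> \<zero>} \<union> {g. a' g \<noteq> \<zero>}"
  have S: "finite ?S" "?S \<subseteq> carrier G" using a a' unfolding skew_carrier by auto
  have sum: "{g. (a \<oplus>\<^bsub>A\<^esub> a') g \<noteq> \<zero>} \<subseteq> ?S" by (auto simp: skew_ops)
  show "((a \<oplus>\<^bsub>A\<^esub> a') \<otimes>\<^bsub>A\<^esub> b) k = ((a \<otimes>\<^bsub>A\<^esub> b) \<oplus>\<^bsub>A\<^esub> (a' \<otimes>\<^bsub>A\<^esub> b)) k"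
  proof (cases "k \<in> carrier G")
    case True
    let ?c = "\<lambda>g. act g (b (inv\<^bsub>G\<^esub> g \<otimes>\<^bsub>G\<^esub> k))"
    have c: "?c g \<in> carrier R" if "g \<in> ?S" for g using that S(2) b by (intro act_simps) auto
    have "((a \<oplus>\<^bsub>A\<^esub> a') \<otimes>\<^bsub>A\<^esub> b) k = (\<Oplus>g \<in> ?S. (a \<oplus>\<^bsub>A\<^esub> a') g \<otimes> ?c g)"
      by (rule mult_convolution[OF add_closed[OF a a'] b True S(1) sum S(2)])
    also have "\<dots> = (\<Oplus>g \<in> ?S. a g \<otimes> ?c g \<oplus> a' g \<otimes> ?c g)"
      using c a a' by (intro R.finsum_cong') (auto simp: skew_ops R.l_distr)
    also have "\<dots> = (\<Oplus>g \<in> ?S. a g \<otimes> ?c g) \<oplus> (\<Oplus>g \<in> ?S. a' g \<otimes> ?c g)"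
      using c a a' by (intro R.finsum_addf) auto
    also have "(\<Oplus>g \<in> ?S. a g \<otimes> ?c g) = (a \<otimes>\<^bsub>A\<^esub> b) k"
      by (rule mult_convolution[symmetric, OF a b True S(1) _ S(2)]) auto
    also have "(\<Oplus>g \<in> ?S. a' g \<otimes> ?c g) = (a' \<otimes>\<^bsub>A\<^esub> b) k"
      by (rule mult_convolution[symmetric, OF a' b True S(1) _ S(2)]) auto
    finally show ?thesis by (simp add: skew_ops)
  next
    case False
    then show ?thesis
      using mult_outside[OF add_closed[OF a a'] b False] mult_outside[OF a b False] mult_outside[OF a' b False]
      by (simp add: skew_ops)
  qed
qed

lemma skew_r_distr:
  assumes a: "a \<in> carrier A" and b: "b \<in> carrier A" and b': "b' \<in> carrier A"
  shows "a \<otimes>\<^bsub>A\<^esub> (b \<oplus>\<^bsub>A\<^esub> b') = (a \<otimes>\<^bsub>A\<^esub> b) \<oplus>\<^bsub>A\<^esub> (a \<otimes>\<^bsub>A\<^esub> b')"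
proof
  fix k
  let ?S = "{g. a g \<noteq> \<zero>}"
  have S: "finite ?S" "?S \<subseteq> carrier G" using a unfolding skew_carrier by auto
  show "(a \<otimes>\<^bsub>A\<^esub> (b \<oplus>\<^bsub>A\<^esub> b')) k = ((a \<otimes>\<^bsub>A\<^esub> b) \<oplus>\<^bsub>A\<^esub> (a \<otimes>\<^bsub>A\<^esub> b')) k"
  proof (cases "k \<in> carrier G")
    case True
    let ?c = "\<lambda>b g. act g (b (inv\<^bsub>G\<^esub> g \<otimes>\<^bsub>G\<^esub> k))"
    have c: "?c b g \<in> carrier R" "?c b' g \<in> carrier R" if "g \<in> ?S" for g
      using that S(2) b b' by (auto intro!: act_simps)
    have "(a \<otimes>\<^bsub>A\<^esub> (b \<oplus>\<^bsub>A\<^esub> b')) k = (\<Oplus>g \<in> ?S. a g \<otimes> ?c (b \<oplus>\<^bsub>A\<^esub> b') g)"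
      by (rule mult_convolution[OF a add_closed[OF b b'] True S(1) subset_refl S(2)])
    also have "\<dots> = (\<Oplus>g \<in> ?S. a g \<otimes> ?c b g \<oplus> a g \<otimes> ?c b' g)"
      using c a b b' S(2) by (intro R.finsum_cong') (auto simp: skew_ops R.r_distr subset_iff)
    also have "\<dots> = (\<Oplus>g \<in> ?S. a g \<otimes> ?c b g) \<oplus> (\<Oplus>g \<in> ?S. a g \<otimes> ?c b' g)"
      using c a by (intro R.finsum_addf) auto
    also have "(\<Oplus>g \<in> ?S. a g \<otimes> ?c b g) = (a \<otimes>\<^bsub>A\<^esub> b) k"
      by (rule mult_convolution[symmetric, OF a b True S(1) subset_refl S(2)])
    also have "(\<Oplus>g \<in> ?S. a g \<otimes> ?c b' g) = (a \<otimes>\<^bsub>A\<^esub> b') k"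
      by (rule mult_convolution[symmetric, OF a b' True S(1) subset_refl S(2)])
    finally show ?thesis by (simp add: skew_ops)
  next
    case False
    then show ?thesis
      using mult_outside[OF a add_closed[OF b b'] False] mult_outside[OF a b False] mult_outside[OF a b' False]
      by (simp add: skew_ops)
  qed
qed

lemma mon_mult_assoc:
  assumes r: "r \<in> carrier R" and g: "g \<in> carrier G" and s: "s \<in> carrier R" and h: "h \<in> carrier G"
    and c: "c \<in> carrier A"
  shows "(mon r g \<otimes>\<^bsub>A\<^esub> mon s h) \<otimes>\<^bsub>A\<^esub> c = mon r g \<otimes>\<^bsub>A\<^esub> (mon s h \<otimes>\<^bsub>A\<^esub> c)"
proof
  fix k
  have sh: "mon s h \<otimes>\<^bsub>A\<^esub> c \<in> carrier A" using mult_closed s h c by simp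
  show "((mon r g \<otimes>\<^bsub>A\<^esub> mon s h) \<otimes>\<^bsub>A\<^esub> c) k = (mon r g \<otimes>\<^bsub>A\<^esub> (mon s h \<otimes>\<^bsub>A\<^esub> c)) k"
  proof (cases "k \<in> carrier G")
    case True
    have "inv\<^bsub>G\<^esub> (g \<otimes>\<^bsub>G\<^esub> h) \<otimes>\<^bsub>G\<^esub> k = inv\<^bsub>G\<^esub> h \<otimes>\<^bsub>G\<^esub> (inv\<^bsub>G\<^esub> g \<otimes>\<^bsub>G\<^esub> k)"
      using g h True by (simp add: G.inv_mult_group G.m_assoc)
    then show ?thesis
      using mon_mult[OF r g sh True] mon_mult[OF s h c, of "inv\<^bsub>G\<^esub> g \<otimes>\<^bsub>G\<^esub> k"] r s g h c True
      by (simp add: mon_mult_mon mon_mult[of _ "g \<otimes>\<^bsub>G\<^esub> h"] act_mult R.m_assoc)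
  next
    case False
    then show ?thesis
      using mult_outside[OF _ c False] mult_outside[OF _ sh False] r s g h by (simp add: mult_closed)
  qed
qed

text \<open>
  Both sides are additive in \<open>a\<close> and in \<open>b\<close>, which leaves the case \<open>(r g) (s h) c\<close>. There each coefficient of the
  product is a single term, and associativity is the compatibility of the action with products in \<open>R\<close> and in \<open>G\<close>.
\<close>

lemma skew_assoc:
  assumes a: "a \<in> carrier A" and b: "b \<in> carrier A" and c: "c \<in> carrier A"
  shows "(a \<otimes>\<^bsub>A\<^esub> b) \<otimes>\<^bsub>A\<^esub> c = a \<otimes>\<^bsub>A\<^esub> (b \<otimes>\<^bsub>A\<^esub> c)"
  using a
proof (induction rule: skew_induct)
  case (mon r g)
  show ?case using b
  proof (induction rule: skew_induct)
    case (mon s h)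
    then show ?case using mon_mult_assoc c \<open>r \<in> carrier R\<close> \<open>g \<in> carrier G\<close> by blast
  next
    case (add b b')
    then show ?case using \<open>r \<in> carrier R\<close> \<open>g \<in> carrier G\<close> c
      by (simp add: skew_l_distr skew_r_distr mult_closed)
  qed
next
  case (add a a')
  then show ?case using b c by (simp add: skew_l_distr mult_closed)
qed

lemma skew_one:
  assumes a: "a \<in> carrier A"
  shows "\<one>\<^bsub>A\<^esub> \<otimes>\<^bsub>A\<^esub> a = a" and "a \<otimes>\<^bsub>A\<^esub> \<one>\<^bsub>A\<^esub> = a"
proof -
  have one: "mon \<one> \<one>\<^bsub>G\<^esub> \<in> carrier A" by simp
  show "\<one>\<^bsub>A\<^esub> \<otimes>\<^bsub>A\<^esub> a = a" using a unfolding skew_ops(3)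
  proof (induction rule: skew_induct)
    case (mon r g)
    then show ?case using mon_mult_mon[of "\<one>" r "\<one>\<^bsub>G\<^esub>" g] act_one by simp
  next
    case (add a b)
    then show ?case using skew_r_distr[OF one] by simp
  qed
  show "a \<otimes>\<^bsub>A\<^esub> \<one>\<^bsub>A\<^esub> = a" using a unfolding skew_ops(3)
  proof (induction rule: skew_induct)
    case (mon r g)
    then show ?case using mon_mult_mon[of r "\<one>" g "\<one>\<^bsub>G\<^esub>"] by simp
  next
    case (add a b)
    then show ?case using skew_l_distr[OF _ _ one] by simp
  qed
qed

lemma ring_A: "ring A"
proof (rule ringI)
  show "abelian_group A"
  proof (rule abelian_groupI)
    show zero: "\<zero>\<^bsub>A\<^esub> \<in> carrier A" unfolding skew_carrier skew_ops by simp
    fix a assume a: "a \<in> carrier A"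
    show "\<zero>\<^bsub>A\<^esub> \<oplus>\<^bsub>A\<^esub> a = a" using a by (simp add: skew_ops)
    have "{g. \<ominus> a g \<noteq> \<zero>} \<subseteq> {g. a g \<noteq> \<zero>}" by auto
    then have "(\<lambda>g. \<ominus> a g) \<in> carrier A"
      using a unfolding skew_carrier by (auto intro: finite_subset)
    moreover have "(\<lambda>g. \<ominus> a g) \<oplus>\<^bsub>A\<^esub> a = \<zero>\<^bsub>A\<^esub>" using a by (simp add: skew_ops R.l_neg)
    ultimately show "\<exists>b \<in> carrier A. b \<oplus>\<^bsub>A\<^esub> a = \<zero>\<^bsub>A\<^esub>" by blast
    fix b assume b: "b \<in> carrier A"
    show "a \<oplus>\<^bsub>A\<^esub> b \<in> carrier A" by (rule add_closed[OF a b])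
    show "a \<oplus>\<^bsub>A\<^esub> b = b \<oplus>\<^bsub>A\<^esub> a" using a b by (simp add: skew_ops R.a_comm)
    fix c assume c: "c \<in> carrier A"
    show "a \<oplus>\<^bsub>A\<^esub> b \<oplus>\<^bsub>A\<^esub> c = a \<oplus>\<^bsub>A\<^esub> (b \<oplus>\<^bsub>A\<^esub> c)" using a b c by (simp add: skew_ops R.a_assoc)
  qed
  show "monoid A"
    by (rule monoidI) (use mult_closed skew_assoc skew_one mon_closed in \<open>simp_all add: skew_ops(3)\<close>)
qed (simp_all add: skew_l_distr skew_r_distr)

end

lemma (in skew_action) skew_action_subgroup:
  assumes "subgroup N G"
  shows "skew_action R (G\<lparr>carrier := N\<rparr>) act"
proof -
  interpret N: group "G\<lparr>carrier := N\<rparr>" using G.subgroup_imp_group[OF assms] .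
  have "N \<subseteq> carrier G" using subgroup.subset[OF assms] .
  then show ?thesis using act_hom act_one act_mult by unfold_locales (simp_all add: subset_iff)
qed

lemma skew_group_ring_subgroup:
  "skew_group_ring R (G\<lparr>carrier := N\<rparr>) act =
     (skew_group_ring R G act)\<lparr>carrier := carrier (skew_group_ring R (G\<lparr>carrier := N\<rparr>) act)\<rparr>"
  by (simp add: skew_group_ring_def)

lemma (in skew_action) skew_ring_subgroup_incl:
  assumes "subgroup N G"
  shows "carrier (skew_group_ring R (G\<lparr>carrier := N\<rparr>) act) = {a \<in> carrier A. \<forall>g. g \<notin> N \<longrightarrow> a g = \<zero>}"
  using subgroup.subset[OF assms] unfolding skew_group_ring_def by auto


section \<open>Left modules and their submodules\<close>

context left_module
begin

lemma smult_r_zero [simp]: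
  assumes "a \<in> carrier A" shows "a \<odot>\<^bsub>M\<^esub> \<zero>\<^bsub>M\<^esub> = \<zero>\<^bsub>M\<^esub>"
proof -
  have "a \<odot>\<^bsub>M\<^esub> \<zero>\<^bsub>M\<^esub> \<oplus>\<^bsub>M\<^esub> a \<odot>\<^bsub>M\<^esub> \<zero>\<^bsub>M\<^esub> = a \<odot>\<^bsub>M\<^esub> \<zero>\<^bsub>M\<^esub>"
    using smult_r_distr[OF assms M.zero_closed M.zero_closed] by simp
  then show ?thesis using smult_closed[OF assms M.zero_closed] by (simp add: M.add.l_cancel_one)
qed

lemma smult_l_zero [simp]:
  assumes "m \<in> carrier M" shows "\<zero> \<odot>\<^bsub>M\<^esub> m = \<zero>\<^bsub>M\<^esub>"
proof -
  have "\<zero> \<odot>\<^bsub>M\<^esub> m \<oplus>\<^bsub>M\<^esub> \<zero> \<odot>\<^bsub>M\<^esub> m = \<zero> \<odot>\<^bsub>M\<^esub> m"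
    using smult_l_distr[OF A.zero_closed A.zero_closed assms] by simp
  then show ?thesis using smult_closed[OF A.zero_closed assms] by (simp add: M.add.l_cancel_one)
qed

lemma smult_l_minus:
  assumes "a \<in> carrier A" "m \<in> carrier M" shows "(\<ominus> a) \<odot>\<^bsub>M\<^esub> m = \<ominus>\<^bsub>M\<^esub> (a \<odot>\<^bsub>M\<^esub> m)"
proof (rule M.minus_equality[symmetric])
  show "(\<ominus> a) \<odot>\<^bsub>M\<^esub> m \<oplus>\<^bsub>M\<^esub> a \<odot>\<^bsub>M\<^esub> m = \<zero>\<^bsub>M\<^esub>"
    using smult_l_distr[of "\<ominus> a" a m] assms by (simp add: A.l_neg)
qed (use assms smult_closed in auto)

lemma smult_finsum:
  assumes "finite S" "a \<in> carrier A" "f \<in> S \<rightarrow> carrier M"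
  shows "a \<odot>\<^bsub>M\<^esub> (\<Oplus>\<^bsub>M\<^esub>s\<in>S. f s) = (\<Oplus>\<^bsub>M\<^esub>s\<in>S. a \<odot>\<^bsub>M\<^esub> f s)"
  using assms(1,3)
proof (induction rule: finite_induct)
  case (insert s S)
  then show ?case using assms(2) smult_r_distr[of a "f s" "finsum M f S"] smult_closed
    by (simp add: Pi_def)
qed (use assms in simp)

text \<open>
  Negatives come for free: they are multiples by \<open>-1\<close>.
\<close>

lemma left_submoduleI:
  assumes "H \<subseteq> carrier M" and "\<zero>\<^bsub>M\<^esub> \<in> H"
    and add: "\<And>x y. x \<in> H \<Longrightarrow> y \<in> H \<Longrightarrow> x \<oplus>\<^bsub>M\<^esub> y \<in> H"
    and smult: "\<And>a x. a \<in> carrier A \<Longrightarrow> x \<in> H \<Longrightarrow> a \<odot>\<^bsub>M\<^esub> x \<in> H"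
  shows "Module.submodule H A M"
proof (intro Module.submodule.intro submodule_axioms.intro M.add.subgroupI)
  fix x assume x: "x \<in> H"
  have "\<ominus>\<^bsub>M\<^esub> x = (\<ominus> \<one>) \<odot>\<^bsub>M\<^esub> x" using smult_l_minus[of "\<one>" x] smult_one x assms(1) by auto
  then have "\<ominus>\<^bsub>M\<^esub> x \<in> H" using smult[OF _ x, of "\<ominus> \<one>"] by simp
  then show "\<ominus>\<^bsub>M\<^esub> x \<in> H" .
qed (use assms in auto)

lemma left_submoduleD:
  assumes "Module.submodule H A M"
  shows "H \<subseteq> carrier M" and "\<zero>\<^bsub>M\<^esub> \<in> H"
    and "\<And>x y. x \<in> H \<Longrightarrow> y \<in> H \<Longrightarrow> x \<oplus>\<^bsub>M\<^esub> y \<in> H"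
    and "\<And>x. x \<in> H \<Longrightarrow> \<ominus>\<^bsub>M\<^esub> x \<in> H"
    and "\<And>a x. a \<in> carrier A \<Longrightarrow> x \<in> H \<Longrightarrow> a \<odot>\<^bsub>M\<^esub> x \<in> H"
proof -
  interpret H: Module.submodule H A M by fact
  show "H \<subseteq> carrier M" "\<zero>\<^bsub>M\<^esub> \<in> H" using H.subset H.one_closed by simp_all
  show "\<And>x y. x \<in> H \<Longrightarrow> y \<in> H \<Longrightarrow> x \<oplus>\<^bsub>M\<^esub> y \<in> H" using H.m_closed by simp
  show "\<And>x. x \<in> H \<Longrightarrow> \<ominus>\<^bsub>M\<^esub> x \<in> H" using H.m_inv_closed by (simp add: a_inv_def)
  show "\<And>a x. a \<in> carrier A \<Longrightarrow> x \<in> H \<Longrightarrow> a \<odot>\<^bsub>M\<^esub> x \<in> H" by (rule H.smult_closed)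
qed

lemma left_submodule_is_left_module:
  assumes "Module.submodule H A M"
  shows "left_module A (M\<lparr>carrier := H\<rparr>)"
proof -
  note H = left_submoduleD[OF assms]
  have "abelian_group (M\<lparr>carrier := H\<rparr>)"
  proof (rule abelian_groupI)
    fix x assume x: "x \<in> carrier (M\<lparr>carrier := H\<rparr>)"
    then show "\<exists>y \<in> carrier (M\<lparr>carrier := H\<rparr>). y \<oplus>\<^bsub>M\<lparr>carrier := H\<rparr>\<^esub> x = \<zero>\<^bsub>M\<lparr>carrier := H\<rparr>\<^esub>"
      using H(1,4) M.l_neg by (intro bexI[of _ "\<ominus>\<^bsub>M\<^esub> x"]) auto
  next
    fix x y assume "x \<in> carrier (M\<lparr>carrier := H\<rparr>)" "y \<in> carrier (M\<lparr>carrier := H\<rparr>)"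
    then have xy: "x \<in> carrier M" "y \<in> carrier M" "x \<in> H" "y \<in> H" using H(1) by auto
    then show "x \<oplus>\<^bsub>M\<lparr>carrier := H\<rparr>\<^esub> y = y \<oplus>\<^bsub>M\<lparr>carrier := H\<rparr>\<^esub> x" by (simp add: M.a_comm)
    show "x \<oplus>\<^bsub>M\<lparr>carrier := H\<rparr>\<^esub> y \<in> carrier (M\<lparr>carrier := H\<rparr>)" using xy H(3) by simp
    fix z assume "z \<in> carrier (M\<lparr>carrier := H\<rparr>)"
    then have "z \<in> carrier M" using H(1) by auto
    then show "x \<oplus>\<^bsub>M\<lparr>carrier := H\<rparr>\<^esub> y \<oplus>\<^bsub>M\<lparr>carrier := H\<rparr>\<^esub> z = x \<oplus>\<^bsub>M\<lparr>carrier := H\<rparr>\<^esub> (y \<oplus>\<^bsub>M\<lparr>carrier := H\<rparr>\<^esub> z)"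
      using xy by (simp add: M.a_assoc)
  qed (use H in auto)
  then show ?thesis
    using H A.ring_axioms smult_l_distr smult_r_distr smult_assoc1 smult_one
    by (intro left_module.intro left_module_axioms.intro) (auto simp: subset_iff)
qed

lemma left_module_subring:
  assumes "ring (A\<lparr>carrier := C\<rparr>)" and "C \<subseteq> carrier A"
  shows "left_module (A\<lparr>carrier := C\<rparr>) M"
  using assms M.abelian_group_axioms smult_closed smult_l_distr smult_r_distr smult_assoc1 smult_one
  by (intro left_module.intro left_module_axioms.intro) (auto simp: subset_iff)

end

section \<open>The tensor product over a subring\<close>

locale induced = A: ring A + V: left_module B V
  for A :: "('a, 'c) ring_scheme" (structure) and B :: "('a, 'd) ring_scheme" and V :: "('a, 'v, 'e) module_scheme" +
  assumes sub: "carrier B \<subseteq> carrier A"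
begin

abbreviation "Fr \<equiv> free_Abelian_group (carrier A \<times> carrier V)"
abbreviation "tker \<equiv> tensor_kernel A B V"
abbreviation "cl \<equiv> tensor_class A B V"
abbreviation "T \<equiv> induced_module A B V"
abbreviation "pure \<equiv> pure_tensor A B V"
abbreviation "L a \<equiv> frag_extend (\<lambda>(a', v). frag_of (a \<otimes> a', v))"

text \<open>
  \<open>Fr\<close> is the free abelian group of formal sums of pairs \<open>(a, v)\<close>, \<open>tker\<close> the subgroup that is factored out, and
  \<open>L a\<close> the left multiplication by \<open>a\<close> on formal sums.
\<close>

lemma Fr_diff: "\<lbrakk>x \<in> carrier Fr; y \<in> carrier Fr\<rbrakk> \<Longrightarrow> x - y \<in> carrier Fr"
  and Fr_add: "\<lbrakk>x \<in> carrier Fr; y \<in> carrier Fr\<rbrakk> \<Longrightarrow> x + y \<in> carrier Fr"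
  and Fr_minus: "x \<in> carrier Fr \<Longrightarrow> - x \<in> carrier Fr"
  and Fr_zero: "0 \<in> carrier Fr"
  using keys_diff[of x y] keys_add[of x y] by auto

lemma relations_in_Fr: "tensor_relations A B V \<subseteq> carrier Fr"
proof
  fix x assume "x \<in> tensor_relations A B V"
  then show "x \<in> carrier Fr"
    unfolding tensor_relations_def
    using sub V.smult_closed
    by (elim UnE CollectE exE conjE)
      (auto simp only: subset_iff A.m_closed A.a_closed V.M.a_closed mem_Sigma_iff frag_of_in_free_Abelian_group
        intro!: Fr_diff)
qed

lemma tker_subgroup: "subgroup tker Fr"
  unfolding tensor_kernel_def
  by (rule group.generate_is_subgroup[OF group_free_Abelian_group relations_in_Fr])

lemma tker_normal: "tker \<lhd> Fr"
  using comm_group.subgroup_imp_normal[OF abelian_free_Abelian_group tker_subgroup] .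

lemma tker_Fr: "k \<in> tker \<Longrightarrow> k \<in> carrier Fr"
  using subgroup.subset[OF tker_subgroup] by blast

lemma tker_closed:
  "0 \<in> tker" "\<lbrakk>x \<in> tker; y \<in> tker\<rbrakk> \<Longrightarrow> x + y \<in> tker" "x \<in> tker \<Longrightarrow> - x \<in> tker"
  "\<lbrakk>x \<in> tker; y \<in> tker\<rbrakk> \<Longrightarrow> x - y \<in> tker"
proof -
  show zero: "0 \<in> tker" using subgroup.one_closed[OF tker_subgroup] by simp
  show add: "x + y \<in> tker" if "x \<in> tker" "y \<in> tker" for x y
    using subgroup.m_closed[OF tker_subgroup that] by simp
  show minus: "- x \<in> tker" if "x \<in> tker" for x
    using subgroup.m_inv_closed[OF tker_subgroup that] tker_Fr[OF that] by simp
  show "\<lbrakk>x \<in> tker; y \<in> tker\<rbrakk> \<Longrightarrow> x - y \<in> tker" using add[of x "- y"] minus[of y] by simp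
qed

lemma class_eq: "cl c = {k + c | k. k \<in> tker}"
  unfolding tensor_class_def r_coset_def by auto

lemma class_eq_iff: "cl c = cl c' \<longleftrightarrow> c - c' \<in> tker"
proof
  assume "cl c = cl c'"
  moreover have "c \<in> cl c" unfolding class_eq using tker_closed(1) by force
  ultimately obtain k where "k \<in> tker" "c = k + c'" unfolding class_eq by blast
  then show "c - c' \<in> tker" by simp
next
  assume d: "c - c' \<in> tker"
  show "cl c = cl c'"
  proof
    show "cl c \<subseteq> cl c'"
    proof
      fix y assume "y \<in> cl c"
      then obtain k where "k \<in> tker" "y = k + c" unfolding class_eq by blast
      then have "k + (c - c') \<in> tker" "y = (k + (c - c')) + c'" using tker_closed(2) d by auto
      then show "y \<in> cl c'" unfolding class_eq by blast
    qed
    show "cl c' \<subseteq> cl c"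
    proof
      fix y assume "y \<in> cl c'"
      then obtain k where "k \<in> tker" "y = k + c'" unfolding class_eq by blast
      then have "k - (c - c') \<in> tker" "y = (k - (c - c')) + c" using tker_closed(4) d by auto
      then show "y \<in> cl c" unfolding class_eq by blast
    qed
  qed
qed

lemma carrier_T: "carrier T = cl ` carrier Fr"
  unfolding induced_module_def Let_def FactGroup_def RCOSETS_def tensor_class_def by auto

lemma class_in_T [simp]: "c \<in> carrier Fr \<Longrightarrow> cl c \<in> carrier T"
  unfolding carrier_T by blast

lemma add_class: "\<lbrakk>c \<in> carrier Fr; c' \<in> carrier Fr\<rbrakk> \<Longrightarrow> cl c \<oplus>\<^bsub>T\<^esub> cl c' = cl (c + c')"
  using normal.rcos_sum[OF tker_normal, of c c']
  unfolding induced_module_def Let_def FactGroup_def tensor_class_def by simp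

lemma zero_T: "\<zero>\<^bsub>T\<^esub> = cl 0"
  unfolding class_eq by (simp add: induced_module_def Let_def FactGroup_def)

lemma L_closed:
  assumes a: "a \<in> carrier A" and c: "c \<in> carrier Fr"
  shows "L a c \<in> carrier Fr"
proof -
  have "Poly_Mapping.keys (L a c) \<subseteq> (\<Union>x \<in> Poly_Mapping.keys c. Poly_Mapping.keys (case x of (a', v) \<Rightarrow> frag_of (a \<otimes> a', v)))"
    by (rule keys_frag_extend)
  also have "\<dots> \<subseteq> carrier A \<times> carrier V" using a c by (force split: prod.splits)
  finally show ?thesis by simp
qed

lemma L_relations:
  assumes a: "a \<in> carrier A" and h: "h \<in> tensor_relations A B V"
  shows "L a h \<in> tensor_relations A B V"
  using h unfolding tensor_relations_def
proof (elim UnE CollectE exE conjE, goal_cases)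
  case (1 a1 a2 v)
  then have "L a h = frag_of (a \<otimes> a1 \<oplus> a \<otimes> a2, v) - frag_of (a \<otimes> a1, v) - frag_of (a \<otimes> a2, v)"
    using a by (simp add: frag_extend_diff A.r_distr)
  then show ?case using 1 a A.m_closed by blast
next
  case (2 a1 v v')
  then have "L a h = frag_of (a \<otimes> a1, v \<oplus>\<^bsub>V\<^esub> v') - frag_of (a \<otimes> a1, v) - frag_of (a \<otimes> a1, v')"
    using a by (simp add: frag_extend_diff)
  then show ?case using 2 a A.m_closed by blast
next
  case (3 a1 b v)
  then have "L a h = frag_of (a \<otimes> a1 \<otimes> b, v) - frag_of (a \<otimes> a1, b \<odot>\<^bsub>V\<^esub> v)"
    using a sub by (simp add: frag_extend_diff A.m_assoc subset_iff)
  then show ?case using 3 a A.m_closed by blast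
qed

text \<open>
  Left multiplication respects the kernel because it turns each defining relation into a relation of the same kind.
\<close>

lemma L_tker:
  assumes a: "a \<in> carrier A" and k: "k \<in> tker"
  shows "L a k \<in> tker"
  using k unfolding tensor_kernel_def
proof (induction rule: generate.induct)
  case one
  then show ?case using tker_closed(1) by (simp add: tensor_kernel_def)
next
  case (incl h)
  show ?case by (rule generate.incl[OF L_relations[OF a incl]])
next
  case (inv h)
  have h: "h \<in> tker" "h \<in> carrier Fr" unfolding tensor_kernel_def
    using inv relations_in_Fr generate.incl by fast+
  have "L a h \<in> tker" unfolding tensor_kernel_def by (rule generate.incl[OF L_relations[OF a inv]])
  then have "- L a h \<in> tker" by (rule tker_closed(3))
  moreover have "inv\<^bsub>Fr\<^esub> h = - h" using h(2) by simp
  ultimately show ?case unfolding tensor_kernel_def by (simp only: frag_extend_minus)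
next
  case (eng h1 h2)
  then show ?case using tker_closed(2)[of "L a h1" "L a h2"]
    unfolding tensor_kernel_def by (simp add: frag_extend_add)
qed

text \<open>
  All members of a class give the same class of products, so the union in the definition of the action has a
  single member.
\<close>

lemma smult_class:
  assumes a: "a \<in> carrier A" and c: "c \<in> carrier Fr"
  shows "a \<odot>\<^bsub>T\<^esub> cl c = cl (L a c)"
proof -
  have "cl (L a c') = cl (L a c)" if c': "c' \<in> cl c" for c'
  proof -
    obtain k where k: "k \<in> tker" "c' = k + c" using c' unfolding class_eq by blast
    have "L a c' - L a c = L a k" unfolding k(2) by (simp add: frag_extend_add)
    then show ?thesis unfolding class_eq_iff using L_tker[OF a k(1)] by simp
  qed
  moreover have "c \<in> cl c" unfolding class_eq using tker_closed(1) by force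
  ultimately have "(\<Union>c' \<in> cl c. cl (L a c')) = cl (L a c)" by blast
  then show ?thesis unfolding induced_module_def Let_def by simp
qed

text \<open>
  The usual case for the empty sum is covered by \<open>c - c\<close>, since there is at least the pair \<open>(0, 0)\<close>.
\<close>

lemma Fr_induct [consumes 1, case_names of diff]:
  assumes c: "c \<in> carrier Fr"
    and of: "\<And>a v. \<lbrakk>a \<in> carrier A; v \<in> carrier V\<rbrakk> \<Longrightarrow> P (frag_of (a, v))"
    and diff: "\<And>x y. \<lbrakk>x \<in> carrier Fr; y \<in> carrier Fr; P x; P y\<rbrakk> \<Longrightarrow> P (x - y)"
  shows "P c"
proof -
  have "frag_of (\<zero>, \<zero>\<^bsub>V\<^esub>) \<in> carrier Fr" by simp
  then have "P 0" using diff[of "frag_of (\<zero>, \<zero>\<^bsub>V\<^esub>)" "frag_of (\<zero>, \<zero>\<^bsub>V\<^esub>)"] of[of "\<zero>" "\<zero>\<^bsub>V\<^esub>"] by simp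
  then show ?thesis using c of diff
    by (intro free_Abelian_group_induct[of c "carrier A \<times> carrier V" P]) auto
qed

lemma left_module_T: "left_module A T"
proof (intro left_module.intro left_module_axioms.intro)
  show "ring A" by (rule A.ring_axioms)
  show "abelian_group T"
  proof (rule abelian_groupI)
    show "\<zero>\<^bsub>T\<^esub> \<in> carrier T" unfolding zero_T using Fr_zero by simp
    fix x assume "x \<in> carrier T"
    then obtain c where c: "c \<in> carrier Fr" "x = cl c" unfolding carrier_T by blast
    show "\<zero>\<^bsub>T\<^esub> \<oplus>\<^bsub>T\<^esub> x = x" unfolding zero_T c(2) add_class[OF Fr_zero c(1)] by simp
    have "cl (- c) \<oplus>\<^bsub>T\<^esub> x = \<zero>\<^bsub>T\<^esub>" unfolding zero_T c(2) add_class[OF Fr_minus[OF c(1)] c(1)] by simp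
    then show "\<exists>y \<in> carrier T. y \<oplus>\<^bsub>T\<^esub> x = \<zero>\<^bsub>T\<^esub>" using class_in_T[OF Fr_minus[OF c(1)]] by blast
    fix y assume "y \<in> carrier T"
    then obtain d where d: "d \<in> carrier Fr" "y = cl d" unfolding carrier_T by blast
    show "x \<oplus>\<^bsub>T\<^esub> y \<in> carrier T" unfolding c(2) d(2) add_class[OF c(1) d(1)] by (rule class_in_T[OF Fr_add[OF c(1) d(1)]])
    show "x \<oplus>\<^bsub>T\<^esub> y = y \<oplus>\<^bsub>T\<^esub> x" unfolding c(2) d(2) add_class[OF c(1) d(1)] add_class[OF d(1) c(1)] by (simp add: add.commute)
    fix z assume "z \<in> carrier T"
    then obtain e where e: "e \<in> carrier Fr" "z = cl e" unfolding carrier_T by blast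
    show "x \<oplus>\<^bsub>T\<^esub> y \<oplus>\<^bsub>T\<^esub> z = x \<oplus>\<^bsub>T\<^esub> (y \<oplus>\<^bsub>T\<^esub> z)"
      unfolding c(2) d(2) e(2) add_class[OF c(1) d(1)] add_class[OF d(1) e(1)]
        add_class[OF Fr_add[OF c(1) d(1)] e(1)] add_class[OF c(1) Fr_add[OF d(1) e(1)]] by (simp add: add.assoc)
  qed
  fix a x assume a: "a \<in> carrier A" and "x \<in> carrier T"
  then obtain c where c: "c \<in> carrier Fr" "x = cl c" unfolding carrier_T by blast
  show "a \<odot>\<^bsub>T\<^esub> x \<in> carrier T"
    unfolding c(2) smult_class[OF a c(1)] by (rule class_in_T[OF L_closed[OF a c(1)]])
next
  fix a x y assume a: "a \<in> carrier A" and "x \<in> carrier T" "y \<in> carrier T"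
  then obtain c d where c: "c \<in> carrier Fr" "x = cl c" and d: "d \<in> carrier Fr" "y = cl d" unfolding carrier_T by blast
  show "a \<odot>\<^bsub>T\<^esub> (x \<oplus>\<^bsub>T\<^esub> y) = a \<odot>\<^bsub>T\<^esub> x \<oplus>\<^bsub>T\<^esub> a \<odot>\<^bsub>T\<^esub> y"
    unfolding c(2) d(2) add_class[OF c(1) d(1)] smult_class[OF a c(1)] smult_class[OF a d(1)]
      smult_class[OF a Fr_add[OF c(1) d(1)]] add_class[OF L_closed[OF a c(1)] L_closed[OF a d(1)]]
    by (simp only: frag_extend_add)
next
  fix a b x assume a: "a \<in> carrier A" and b: "b \<in> carrier A" and "x \<in> carrier T"
  then obtain c where c: "c \<in> carrier Fr" "x = cl c" unfolding carrier_T by blast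
  have "L (a \<oplus> b) c - (L a c + L b c) \<in> tker"
    using c(1)
  proof (induction rule: Fr_induct)
    case (of a' v)
    have "frag_of (a \<otimes> a' \<oplus> b \<otimes> a', v) - frag_of (a \<otimes> a', v) - frag_of (b \<otimes> a', v) \<in> tensor_relations A B V"
      unfolding tensor_relations_def using a b of A.m_closed by blast
    then show ?case
      unfolding tensor_kernel_def using a b of by (auto simp: A.l_distr diff_diff_eq intro: generate.incl)
  next
    case (diff x y)
    have "L (a \<oplus> b) (x - y) - (L a (x - y) + L b (x - y)) =
        (L (a \<oplus> b) x - (L a x + L b x)) - (L (a \<oplus> b) y - (L a y + L b y))"
      by (simp add: frag_extend_diff)
    then show ?case using tker_closed(4)[OF diff(3,4)] by simp
  qed
  then have "cl (L (a \<oplus> b) c) = cl (L a c + L b c)" unfolding class_eq_iff .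
  then show "(a \<oplus> b) \<odot>\<^bsub>T\<^esub> x = a \<odot>\<^bsub>T\<^esub> x \<oplus>\<^bsub>T\<^esub> b \<odot>\<^bsub>T\<^esub> x"
    unfolding c(2) smult_class[OF a c(1)] smult_class[OF b c(1)] smult_class[OF A.a_closed[OF a b] c(1)]
      add_class[OF L_closed[OF a c(1)] L_closed[OF b c(1)]] .
  have "L (a \<otimes> b) c = L a (L b c)"
    using c(1)
  proof (induction rule: Fr_induct)
    case (of a' v)
    then show ?case using a b by (simp add: A.m_assoc)
  next
    case (diff x y)
    then show ?case by (simp add: frag_extend_diff)
  qed
  then show "(a \<otimes> b) \<odot>\<^bsub>T\<^esub> x = a \<odot>\<^bsub>T\<^esub> (b \<odot>\<^bsub>T\<^esub> x)"
    unfolding c(2) smult_class[OF b c(1)] smult_class[OF A.m_closed[OF a b] c(1)] smult_class[OF a L_closed[OF b c(1)]]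
    by simp
next
  fix x assume "x \<in> carrier T"
  then obtain c where c: "c \<in> carrier Fr" "x = cl c" unfolding carrier_T by blast
  have "L \<one> c = c"
    using c(1)
  proof (induction rule: Fr_induct)
    case (of a' v)
    then show ?case by simp
  next
    case (diff x y)
    then show ?case by (simp add: frag_extend_diff)
  qed
  then show "\<one> \<odot>\<^bsub>T\<^esub> x = x" unfolding c(2) smult_class[OF A.one_closed c(1)] by simp
qed

sublocale T: left_module A T by (rule left_module_T)

lemma frag_in_Fr: "\<lbrakk>a \<in> carrier A; v \<in> carrier V\<rbrakk> \<Longrightarrow> frag_of (a, v) \<in> carrier Fr"
  by simp

lemma pure_closed [simp]: "\<lbrakk>a \<in> carrier A; v \<in> carrier V\<rbrakk> \<Longrightarrow> pure a v \<in> carrier T"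
  unfolding pure_tensor_def by (rule class_in_T[OF frag_in_Fr])

lemma smult_pure: "\<lbrakk>a \<in> carrier A; a' \<in> carrier A; v \<in> carrier V\<rbrakk> \<Longrightarrow> a \<odot>\<^bsub>T\<^esub> pure a' v = pure (a \<otimes> a') v"
  unfolding pure_tensor_def by (subst smult_class) simp_all

lemma pure_add_left:
  assumes "a \<in> carrier A" "a' \<in> carrier A" "v \<in> carrier V"
  shows "pure (a \<oplus> a') v = pure a v \<oplus>\<^bsub>T\<^esub> pure a' v"
proof -
  have "frag_of (a \<oplus> a', v) - frag_of (a, v) - frag_of (a', v) \<in> tensor_relations A B V"
    unfolding tensor_relations_def using assms by blast
  then have "frag_of (a \<oplus> a', v) - (frag_of (a, v) + frag_of (a', v)) \<in> tker"
    unfolding tensor_kernel_def diff_diff_eq by (rule generate.incl)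
  then show ?thesis
    unfolding pure_tensor_def add_class[OF frag_in_Fr[OF assms(1,3)] frag_in_Fr[OF assms(2,3)]] class_eq_iff .
qed

lemma pure_balanced:
  assumes "a \<in> carrier A" "b \<in> carrier B" "v \<in> carrier V"
  shows "pure (a \<otimes> b) v = pure a (b \<odot>\<^bsub>V\<^esub> v)"
proof -
  have "frag_of (a \<otimes> b, v) - frag_of (a, b \<odot>\<^bsub>V\<^esub> v) \<in> tensor_relations A B V"
    unfolding tensor_relations_def using assms by blast
  then have "frag_of (a \<otimes> b, v) - frag_of (a, b \<odot>\<^bsub>V\<^esub> v) \<in> tker"
    unfolding tensor_kernel_def by (rule generate.incl)
  then show ?thesis unfolding pure_tensor_def class_eq_iff .
qed

text \<open>
  Sums of pure tensors suffice: since \<open>-(a \<otimes> v) = (-a) \<otimes> v\<close>, no case for negatives is needed. The proof treats a formal sum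
  together with its negative.
\<close>

lemma tensor_induct [consumes 1, case_names pure add]:
  assumes t: "t \<in> carrier T"
    and pure: "\<And>a v. \<lbrakk>a \<in> carrier A; v \<in> carrier V\<rbrakk> \<Longrightarrow> P (pure a v)"
    and add: "\<And>x y. \<lbrakk>x \<in> carrier T; y \<in> carrier T; P x; P y\<rbrakk> \<Longrightarrow> P (x \<oplus>\<^bsub>T\<^esub> y)"
  shows "P t"
proof -
  obtain c where c: "c \<in> carrier Fr" "t = cl c" using t unfolding carrier_T by blast
  have "P (cl c) \<and> P (cl (- c))"
    using c(1)
  proof (induction rule: Fr_induct)
    case (of a v)
    have "pure (\<ominus> a) v \<oplus>\<^bsub>T\<^esub> pure a v = pure \<zero> v"
      using pure_add_left[of "\<ominus> a" a v] of by (simp add: A.l_neg)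
    also have "\<dots> = \<zero>\<^bsub>T\<^esub>"
      using smult_pure[of "\<zero>" a v] T.smult_l_zero[of "pure a v"] of by simp
    finally have "\<ominus>\<^bsub>T\<^esub> pure a v = pure (\<ominus> a) v"
      using of by (intro T.M.minus_equality) simp_all
    moreover have "cl (- frag_of (a, v)) \<oplus>\<^bsub>T\<^esub> pure a v = \<zero>\<^bsub>T\<^esub>"
      unfolding pure_tensor_def zero_T using add_class[OF Fr_minus[OF frag_in_Fr] frag_in_Fr] of by simp
    then have "\<ominus>\<^bsub>T\<^esub> pure a v = cl (- frag_of (a, v))"
      using of class_in_T[OF Fr_minus[OF frag_in_Fr[OF of]]] by (intro T.M.minus_equality) simp_all
    ultimately show ?case using pure[OF of] pure[of "\<ominus> a" v] of unfolding pure_tensor_def by simp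
  next
    case (diff x y)
    have "cl (x - y) = cl x \<oplus>\<^bsub>T\<^esub> cl (- y)" "cl (- (x - y)) = cl y \<oplus>\<^bsub>T\<^esub> cl (- x)"
      using add_class[OF diff(1) Fr_minus[OF diff(2)]] add_class[OF diff(2) Fr_minus[OF diff(1)]] by simp_all
    then show ?case using add diff class_in_T Fr_minus by metis
  qed
  then show ?thesis using c(2) by simp
qed

lemma tensor_universal:
  assumes P: "abelian_group P"
    and closed: "\<And>a v. \<lbrakk>a \<in> carrier A; v \<in> carrier V\<rbrakk> \<Longrightarrow> f a v \<in> carrier P"
    and add_left: "\<And>a a' v. \<lbrakk>a \<in> carrier A; a' \<in> carrier A; v \<in> carrier V\<rbrakk> \<Longrightarrow> f (a \<oplus> a') v = f a v \<oplus>\<^bsub>P\<^esub> f a' v"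
    and add_right: "\<And>a v v'. \<lbrakk>a \<in> carrier A; v \<in> carrier V; v' \<in> carrier V\<rbrakk> \<Longrightarrow> f a (v \<oplus>\<^bsub>V\<^esub> v') = f a v \<oplus>\<^bsub>P\<^esub> f a v'"
    and balanced: "\<And>a b v. \<lbrakk>a \<in> carrier A; b \<in> carrier B; v \<in> carrier V\<rbrakk> \<Longrightarrow> f (a \<otimes> b) v = f a (b \<odot>\<^bsub>V\<^esub> v)"
  obtains F where "F \<in> carrier T \<rightarrow> carrier P"
    and "\<And>x y. \<lbrakk>x \<in> carrier T; y \<in> carrier T\<rbrakk> \<Longrightarrow> F (x \<oplus>\<^bsub>T\<^esub> y) = F x \<oplus>\<^bsub>P\<^esub> F y"
    and "\<And>a v. \<lbrakk>a \<in> carrier A; v \<in> carrier V\<rbrakk> \<Longrightarrow> F (pure a v) = f a v"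
proof -
  interpret P: abelian_group P by fact
  have "(\<lambda>(a, v). f a v) ` (carrier A \<times> carrier V) \<subseteq> carrier (add_monoid P)" using closed by auto
  from P.a_comm_group[THEN comm_group.free_Abelian_group_universal, OF this]
  obtain h where h: "h \<in> hom Fr (add_monoid P)"
    and hf: "\<And>x. x \<in> carrier A \<times> carrier V \<Longrightarrow> h (frag_of x) = (case x of (a, v) \<Rightarrow> f a v)" by metis
  interpret h: group_hom Fr "add_monoid P" h
    using h P.a_group by (intro group_hom.intro group_hom_axioms.intro) simp_all
  have h_closed: "h x \<in> carrier P" if "x \<in> carrier Fr" for x using h.hom_closed[OF that] by simp
  have h_add: "h (x + y) = h x \<oplus>\<^bsub>P\<^esub> h y" if "x \<in> carrier Fr" "y \<in> carrier Fr" for x y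
    using h.hom_mult[OF that] by simp
  have h_minus: "h (- x) = \<ominus>\<^bsub>P\<^esub> h x" if "x \<in> carrier Fr" for x
    using h.hom_inv[OF that] that by (simp add: a_inv_def)
  have h_diff: "h (x - y) = h x \<ominus>\<^bsub>P\<^esub> h y" if "x \<in> carrier Fr" "y \<in> carrier Fr" for x y
    using h_add[OF that(1) Fr_minus[OF that(2)]] h_minus[OF that(2)] by (simp add: P.minus_eq)
  have hf': "h (frag_of (a, v)) = f a v" if "a \<in> carrier A" "v \<in> carrier V" for a v using hf that by simp
  have rel: "h x = \<zero>\<^bsub>P\<^esub>" if "x \<in> tensor_relations A B V" for x
    using that unfolding tensor_relations_def
  proof (elim UnE CollectE exE conjE, goal_cases)
    case (1 a a' v)
    then have fr: "frag_of (a \<oplus> a', v) \<in> carrier Fr" "frag_of (a, v) \<in> carrier Fr" "frag_of (a', v) \<in> carrier Fr" by simp_all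
    have "h x = f (a \<oplus> a') v \<ominus>\<^bsub>P\<^esub> f a v \<ominus>\<^bsub>P\<^esub> f a' v"
      using 1 h_diff[OF Fr_diff[OF fr(1,2)] fr(3)] h_diff[OF fr(1,2)] hf' by simp
    also have "\<dots> = \<zero>\<^bsub>P\<^esub>"
      using 1 add_left closed P.a_comm[of "f a v" "f a' v"] by (simp add: P.minus_eq P.a_assoc P.r_neg)
    finally show ?case .
  next
    case (2 a v v')
    then have fr: "frag_of (a, v \<oplus>\<^bsub>V\<^esub> v') \<in> carrier Fr" "frag_of (a, v) \<in> carrier Fr" "frag_of (a, v') \<in> carrier Fr" by simp_all
    have "h x = f a (v \<oplus>\<^bsub>V\<^esub> v') \<ominus>\<^bsub>P\<^esub> f a v \<ominus>\<^bsub>P\<^esub> f a v'"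
      using 2 h_diff[OF Fr_diff[OF fr(1,2)] fr(3)] h_diff[OF fr(1,2)] hf' by simp
    also have "\<dots> = \<zero>\<^bsub>P\<^esub>"
      using 2 add_right closed P.a_comm[of "f a v" "f a v'"] by (simp add: P.minus_eq P.a_assoc P.r_neg)
    finally show ?case .
  next
    case (3 a b v)
    then have ab: "a \<otimes> b \<in> carrier A" "b \<odot>\<^bsub>V\<^esub> v \<in> carrier V" using sub V.smult_closed by auto
    have "h x = f (a \<otimes> b) v \<ominus>\<^bsub>P\<^esub> f a (b \<odot>\<^bsub>V\<^esub> v)"
      using 3 h_diff[OF frag_in_Fr[OF ab(1)] frag_in_Fr[OF _ ab(2)]] hf' ab by simp
    also have "\<dots> = \<zero>\<^bsub>P\<^esub>" using 3 balanced closed ab by (simp add: P.minus_eq P.r_neg)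
    finally show ?case .
  qed
  have "tker \<subseteq> kernel Fr (add_monoid P) h"
    unfolding tensor_kernel_def
  proof (rule group.generate_subgroup_incl[OF group_free_Abelian_group _ h.subgroup_kernel])
    show "tensor_relations A B V \<subseteq> kernel Fr (add_monoid P) h"
    proof
      fix x assume x: "x \<in> tensor_relations A B V"
      show "x \<in> kernel Fr (add_monoid P) h"
        unfolding kernel_def using rel[OF x] subsetD[OF relations_in_Fr x] by simp
    qed
  qed
  from h.FactGroup_universal_kernel[OF tker_normal this]
  obtain F where F: "F \<in> hom (Fr Mod tker) (add_monoid P)"
    and Fh: "\<And>x. x \<in> carrier Fr \<Longrightarrow> F (tker #>\<^bsub>Fr\<^esub> x) = h x" by metis
  have Fcl: "F (cl x) = h x" if "x \<in> carrier Fr" for x unfolding tensor_class_def using Fh[OF that] .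
  show thesis
  proof (rule that[of F])
    show "F \<in> carrier T \<rightarrow> carrier P" unfolding carrier_T using Fcl h_closed by auto
    fix x y assume "x \<in> carrier T" "y \<in> carrier T"
    then obtain c d where c: "c \<in> carrier Fr" "x = cl c" and d: "d \<in> carrier Fr" "y = cl d" unfolding carrier_T by blast
    show "F (x \<oplus>\<^bsub>T\<^esub> y) = F x \<oplus>\<^bsub>P\<^esub> F y"
      unfolding c(2) d(2) add_class[OF c(1) d(1)] Fcl[OF c(1)] Fcl[OF d(1)] Fcl[OF Fr_add[OF c(1) d(1)]]
      by (rule h_add[OF c(1) d(1)])
  next
    fix a v assume "a \<in> carrier A" "v \<in> carrier V"
    then show "F (pure a v) = f a v" unfolding pure_tensor_def using Fcl hf' by simp
  qed
qed

end


section \<open>Diagonal actions\<close>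

locale diagonal_action =
  K: algebraically_closed K + R: algebra K R + G: comm_group G
  for K :: "('k, 'e) ring_scheme" and R :: "('k, 'r, 'c) module_scheme" and G :: "('g, 'd) monoid_scheme" (structure) +
  fixes act :: "'g \<Rightarrow> 'r \<Rightarrow> 'r" and n :: nat and x :: "nat \<Rightarrow> 'r" and \<chi> :: "nat \<Rightarrow> 'g \<Rightarrow> 'k"
    and N \<Lambda> :: "'g set"
  assumes x_in: "x ` {1..n} \<subseteq> carrier R"
    and x_generates: "generate_algebra K R (x ` {1..n}) = carrier R"
    and G_fin_gen: "\<exists>S. finite S \<and> S \<subseteq> carrier G \<and> generate G S = carrier G"
    and chars: "\<forall>i\<in>{1..n}. \<chi> i \<in> hom G (units_of K)"
    and chars_finite_order:
      "\<forall>i\<in>{1..n}. \<exists>m::nat. 0 < m \<and> (\<forall>g\<in>carrier G. \<chi> i g [^]\<^bsub>K\<^esub> m = \<one>\<^bsub>K\<^esub>)"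
    and action: "group_action G (carrier R) act"
    and action_ring_aut: "\<forall>g\<in>carrier G. act g \<in> ring_iso R R"
    and action_linear: "\<forall>g\<in>carrier G. \<forall>c\<in>carrier K. \<forall>r\<in>carrier R.
      act g (c \<odot>\<^bsub>R\<^esub> r) = c \<odot>\<^bsub>R\<^esub> act g r"
    and action_gens: "\<forall>g\<in>carrier G. \<forall>i\<in>{1..n}. act g (x i) = inv\<^bsub>K\<^esub> (\<chi> i g) \<odot>\<^bsub>R\<^esub> x i"
    and N_eq: "N = carrier G \<inter> (\<Inter>i\<in>{1..n}. kernel G (units_of K) (\<chi> i))"
    and Lambda: "coset_representatives G N \<Lambda>"
begin

lemma skew_action: "skew_action R G act"
proof (intro skew_action.intro skew_action_axioms.intro)
  show "cring R" by unfold_locales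
  show "group G" by (rule G.group_axioms)
  show "act g \<in> ring_hom R R" if "g \<in> carrier G" for g
    using action_ring_aut that unfolding ring_iso_def by auto
  show "act \<one> r = r" if "r \<in> carrier R" for r
    using group_action.id_eq_one[OF action] that by (metis restrict_apply')
  show "act (g \<otimes> h) r = act g (act h r)" if "g \<in> carrier G" "h \<in> carrier G" "r \<in> carrier R" for g h r
    using group_action.composition_rule[OF action that(3,1,2)] .
qed

sublocale S: skew_action R G act by (rule skew_action)

abbreviation A :: "('k, 'g \<Rightarrow> 'r) module" where "A \<equiv> S.A"
abbreviation B :: "('k, 'g \<Rightarrow> 'r) module" where "B \<equiv> skew_group_ring R (G\<lparr>carrier := N\<rparr>) act"
abbreviation \<kappa> :: "'k \<Rightarrow> 'g \<Rightarrow> 'r" where "\<kappa> c \<equiv> S.mon (c \<odot>\<^bsub>R\<^esub> \<one>\<^bsub>R\<^esub>) \<one>"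
abbreviation xx :: "nat \<Rightarrow> 'g \<Rightarrow> 'r" where "xx i \<equiv> S.mon (x i) \<one>"
abbreviation gg :: "'g \<Rightarrow> 'g \<Rightarrow> 'r" where "gg g \<equiv> S.mon \<one>\<^bsub>R\<^esub> g"

abbreviation zero_K (\<open>\<zero>\<^sub>K\<close>) where "\<zero>\<^sub>K \<equiv> \<zero>\<^bsub>K\<^esub>"
abbreviation one_K (\<open>\<one>\<^sub>K\<close>) where "\<one>\<^sub>K \<equiv> \<one>\<^bsub>K\<^esub>"
abbreviation mult_K (infixl \<open>\<otimes>\<^sub>K\<close> 70) where "c \<otimes>\<^sub>K d \<equiv> c \<otimes>\<^bsub>K\<^esub> d"
abbreviation mult_A (infixl \<open>\<otimes>\<^sub>A\<close> 70) where "a \<otimes>\<^sub>A b \<equiv> a \<otimes>\<^bsub>A\<^esub> b"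
abbreviation add_A (infixl \<open>\<oplus>\<^sub>A\<close> 65) where "a \<oplus>\<^sub>A b \<equiv> a \<oplus>\<^bsub>A\<^esub> b"

sublocale A: ring A by (rule S.ring_A)

lemma xi [simp]: "i \<in> {1..n} \<Longrightarrow> x i \<in> carrier R" using x_in by auto

lemma chi_props:
  assumes "i \<in> {1..n}" and "g \<in> carrier G"
  shows "\<chi> i g \<in> carrier K" and "\<chi> i g \<noteq> \<zero>\<^sub>K" and "\<chi> i g \<in> Units K"
    and "h \<in> carrier G \<Longrightarrow> \<chi> i (g \<otimes> h) = \<chi> i g \<otimes>\<^sub>K \<chi> i h"
proof -
  have hom: "\<chi> i \<in> hom G (units_of K)" using chars assms(1) by blast
  show u: "\<chi> i g \<in> Units K" using hom_carrier[OF hom] assms(2) by (auto simp: units_of_def)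
  then show "\<chi> i g \<in> carrier K" "\<chi> i g \<noteq> \<zero>\<^sub>K" unfolding K.field_Units by auto
  show "h \<in> carrier G \<Longrightarrow> \<chi> i (g \<otimes> h) = \<chi> i g \<otimes>\<^sub>K \<chi> i h"
    using hom_mult[OF hom assms(2)] by (simp add: units_of_def)
qed

lemma N_iff: "g \<in> N \<longleftrightarrow> g \<in> carrier G \<and> (\<forall>i\<in>{1..n}. \<chi> i g = \<one>\<^sub>K)"
  unfolding N_eq kernel_def by (auto simp: units_of_def)

lemma chi_one: "i \<in> {1..n} \<Longrightarrow> \<chi> i \<one> = \<one>\<^sub>K"
proof -
  assume i: "i \<in> {1..n}"
  have "\<chi> i \<one> \<otimes>\<^sub>K \<chi> i \<one> = \<chi> i \<one> \<otimes>\<^sub>K \<one>\<^sub>K"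
    using chi_props(4)[OF i G.one_closed G.one_closed] chi_props(1)[OF i G.one_closed] by simp
  then show ?thesis
    using K.m_lcancel[OF chi_props(2)[OF i G.one_closed] chi_props(1)[OF i G.one_closed]
        chi_props(1)[OF i G.one_closed] K.one_closed] by simp
qed

lemma chi_inv: "\<lbrakk>i \<in> {1..n}; g \<in> carrier G\<rbrakk> \<Longrightarrow> \<chi> i (inv g) \<otimes>\<^sub>K \<chi> i g = \<one>\<^sub>K"
  using chi_props(4)[of i "inv g" g] chi_one by simp

lemma N_subgroup: "subgroup N G"
proof (rule G.subgroupI)
  show "N \<subseteq> carrier G" using N_iff by blast
  show "N \<noteq> {}" using N_iff chi_one G.one_closed by blast
  fix g assume g: "g \<in> N"
  show "inv g \<in> N"
    unfolding N_iff
  proof (intro conjI ballI)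
    show "inv g \<in> carrier G" using g N_iff by simp
    fix i assume i: "i \<in> {1..n}"
    show "\<chi> i (inv g) = \<one>\<^sub>K"
      using chi_inv[OF i, of g] chi_props(1)[OF i, of "inv g"] g i N_iff by simp
  qed
  fix h assume "h \<in> N"
  then show "g \<otimes> h \<in> N" using g chi_props(4) N_iff by simp
qed

lemma NG [simp]: "g \<in> N \<Longrightarrow> g \<in> carrier G" using N_iff by blast

lemma N_closed: "\<one> \<in> N" "\<lbrakk>g \<in> N; h \<in> N\<rbrakk> \<Longrightarrow> g \<otimes> h \<in> N" "g \<in> N \<Longrightarrow> inv g \<in> N"
  using subgroup.one_closed[OF N_subgroup] subgroup.m_closed[OF N_subgroup]
    subgroup.m_inv_closed[OF N_subgroup] by auto

lemma separating_character:
  assumes "g \<in> carrier G" "h \<in> carrier G" "g \<otimes> inv h \<notin> N"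
  obtains i where "i \<in> {1..n}" and "\<chi> i g \<noteq> \<chi> i h"
proof -
  obtain i where i: "i \<in> {1..n}" "\<chi> i (g \<otimes> inv h) \<noteq> \<one>\<^sub>K"
    using assms N_iff by auto
  have "\<chi> i g \<noteq> \<chi> i h"
  proof
    assume eq: "\<chi> i g = \<chi> i h"
    have "\<chi> i (g \<otimes> inv h) = \<chi> i (inv h) \<otimes>\<^sub>K \<chi> i h"
      using chi_props(4)[OF i(1) assms(1), of "inv h"] assms chi_props(1)[OF i(1)] eq
      by (simp add: K.m_comm)
    then show False using chi_inv[OF i(1) assms(2)] i(2) by simp
  qed
  with i(1) that show thesis by blast
qed

lemma act_scalar: "\<lbrakk>g \<in> carrier G; c \<in> carrier K\<rbrakk> \<Longrightarrow> act g (c \<odot>\<^bsub>R\<^esub> \<one>\<^bsub>R\<^esub>) = c \<odot>\<^bsub>R\<^esub> \<one>\<^bsub>R\<^esub>"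
  using action_linear by simp

lemma R_generators: "x ` {1..n} \<union> (\<lambda>c. c \<odot>\<^bsub>R\<^esub> \<one>\<^bsub>R\<^esub>) ` carrier K \<subseteq> carrier R"
  using x_in by auto

lemma R_induct [consumes 1, case_names one gen scalar minus add mult]:
  assumes r: "r \<in> carrier R"
    and one: "P \<one>\<^bsub>R\<^esub>"
    and gen: "\<And>i. i \<in> {1..n} \<Longrightarrow> P (x i)"
    and scalar: "\<And>c. c \<in> carrier K \<Longrightarrow> P (c \<odot>\<^bsub>R\<^esub> \<one>\<^bsub>R\<^esub>)"
    and minus: "\<And>r. \<lbrakk>r \<in> carrier R; P r\<rbrakk> \<Longrightarrow> P (\<ominus>\<^bsub>R\<^esub> r)"
    and add: "\<And>r s. \<lbrakk>r \<in> carrier R; s \<in> carrier R; P r; P s\<rbrakk> \<Longrightarrow> P (r \<oplus>\<^bsub>R\<^esub> s)"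
    and mult: "\<And>r s. \<lbrakk>r \<in> carrier R; s \<in> carrier R; P r; P s\<rbrakk> \<Longrightarrow> P (r \<otimes>\<^bsub>R\<^esub> s)"
  shows "P r"
proof -
  have "r \<in> generate_ring R (x ` {1..n} \<union> (\<lambda>c. c \<odot>\<^bsub>R\<^esub> \<one>\<^bsub>R\<^esub>) ` carrier K)"
    using r x_generates unfolding generate_algebra_def by simp
  then have "r \<in> carrier R \<and> P r"
  proof (induction rule: generate_ring.induct)
    case (incl h)
    then show ?case using gen scalar R_generators by auto
  qed (use one minus add mult in auto)
  then show ?thesis ..
qed

text \<open>
  An element of \<open>N\<close> fixes the generators \<open>x\<^sub>i\<close> and the scalars, hence all of \<open>R\<close>.
\<close>

lemma act_N:
  assumes "h \<in> N" and "r \<in> carrier R"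
  shows "act h r = r"
  using assms(2)
proof (induction rule: R_induct)
  case (gen i)
  have "inv\<^bsub>K\<^esub> \<one>\<^sub>K = \<one>\<^sub>K" by simp
  then show ?case using gen assms(1) action_gens N_iff by simp
next
  case (minus r)
  have "act h (\<ominus>\<^bsub>R\<^esub> r) \<oplus>\<^bsub>R\<^esub> act h r = \<zero>\<^bsub>R\<^esub>"
    using S.act_simps(4)[of h "\<ominus>\<^bsub>R\<^esub> r" r] assms(1) minus by (simp add: R.l_neg)
  then have "\<ominus>\<^bsub>R\<^esub> r = act h (\<ominus>\<^bsub>R\<^esub> r)"
    using minus assms(1) by (intro R.minus_equality) simp_all
  then show ?case by simp
qed (use assms(1) act_scalar in simp_all)

section \<open>Coset representatives\<close>

lemma Lambda_G [simp]: "l \<in> \<Lambda> \<Longrightarrow> l \<in> carrier G"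
  using Lambda unfolding coset_representatives_def by blast

lemma coset_rep:
  assumes g: "g \<in> carrier G"
  shows "coset_rep G N \<Lambda> g \<in> \<Lambda>" and "inv (coset_rep G N \<Lambda> g) \<otimes> g \<in> N"
    and "\<And>l. \<lbrakk>l \<in> \<Lambda>; l \<otimes> inv g \<in> N\<rbrakk> \<Longrightarrow> l = coset_rep G N \<Lambda> g"
proof -
  have "N #> g \<in> rcosets N" using g subgroup.subset[OF N_subgroup] by (rule_tac G.rcosetsI)
  then have ex: "\<exists>!l. l \<in> \<Lambda> \<and> l \<in> N #> g" using Lambda unfolding coset_representatives_def by blast
  have rep: "coset_rep G N \<Lambda> g \<in> \<Lambda> \<and> coset_rep G N \<Lambda> g \<in> N #> g"
    unfolding coset_rep_def by (rule theI'[OF ex])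
  then show 1: "coset_rep G N \<Lambda> g \<in> \<Lambda>" by blast
  from rep obtain h where h: "h \<in> N" "coset_rep G N \<Lambda> g = h \<otimes> g" unfolding r_coset_def by blast
  have "inv (coset_rep G N \<Lambda> g) \<otimes> g = inv h"
    using h g by (simp add: G.inv_mult_group G.m_assoc G.m_comm[of "inv g"])
  then show "inv (coset_rep G N \<Lambda> g) \<otimes> g \<in> N" using N_closed h by simp
  fix l assume l: "l \<in> \<Lambda>" "l \<otimes> inv g \<in> N"
  have "l = (l \<otimes> inv g) \<otimes> g" using l g by (simp add: G.m_assoc)
  then have "l \<in> N #> g" using l(2) unfolding r_coset_def by blast
  then show "l = coset_rep G N \<Lambda> g" using ex rep l(1) by blast
qed

lemma Lambda_unique:
  assumes "l \<in> \<Lambda>" "l' \<in> \<Lambda>" "inv l \<otimes> l' \<in> N"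
  shows "l = l'"
proof -
  have "l' = coset_rep G N \<Lambda> l" "l = coset_rep G N \<Lambda> l"
    using coset_rep(3)[of l l'] coset_rep(3)[of l l] assms N_closed(1) by (simp_all add: G.m_comm)
  then show ?thesis by simp
qed

lemma card_Lambda: "card \<Lambda> = order (G Mod N)"
proof -
  have "bij_betw (\<lambda>l. N #> l) \<Lambda> (rcosets N)"
  proof (rule bij_betw_imageI)
    show "inj_on (\<lambda>l. N #> l) \<Lambda>"
    proof (rule inj_onI)
      fix l l' assume l: "l \<in> \<Lambda>" "l' \<in> \<Lambda>" "N #> l = N #> l'"
      have "l \<in> N #> l" "l' \<in> N #> l'" using G.rcos_self[OF Lambda_G[OF l(1)] N_subgroup]
          G.rcos_self[OF Lambda_G[OF l(2)] N_subgroup] unfolding l(3) by simp_all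
      moreover have "N #> l \<in> rcosets N"
        using l subgroup.subset[OF N_subgroup] by (simp add: G.rcosetsI)
      ultimately show "l = l'" using Lambda l unfolding coset_representatives_def by metis
    qed
    show "(\<lambda>l. N #> l) ` \<Lambda> = rcosets N"
    proof
      show "(\<lambda>l. N #> l) ` \<Lambda> \<subseteq> rcosets N"
        using subgroup.subset[OF N_subgroup] by (auto intro: G.rcosetsI)
      show "rcosets N \<subseteq> (\<lambda>l. N #> l) ` \<Lambda>"
      proof
        fix C assume C: "C \<in> rcosets N"
        then obtain l where l: "l \<in> \<Lambda>" "l \<in> C" using Lambda unfolding coset_representatives_def by metis
        obtain g where g: "g \<in> carrier G" "C = N #> g" using C unfolding RCOSETS_def by blast
        have "C = N #> l" using G.repr_independence[OF _ _ N_subgroup, of l g] l g by simp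
        then show "C \<in> (\<lambda>l. N #> l) ` \<Lambda>" using l(1) by blast
      qed
    qed
  qed
  then show ?thesis unfolding order_def FactGroup_def using bij_betw_same_card by auto
qed

text \<open>
  The values of a character of finite order are roots of unity of one fixed order, of which \<open>K\<close> has finitely many. A
  representative is determined by its values under the characters.
\<close>

lemma finite_Lambda: "finite \<Lambda>"
proof -
  define \<Phi> where "\<Phi> l = restrict (\<lambda>i. \<chi> i l) {1..n}" for l
  have "finite (\<chi> i ` carrier G)" if i: "i \<in> {1..n}" for i
  proof -
    obtain m :: nat where m: "0 < m" "\<forall>g\<in>carrier G. \<chi> i g [^]\<^bsub>K\<^esub> m = \<one>\<^sub>K"
      using chars_finite_order i by blast
    have "\<chi> i ` carrier G \<subseteq> {y \<in> carrier K. y [^]\<^bsub>K\<^esub> m = \<one>\<^sub>K}"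
      using m(2) chi_props(1)[OF i] by auto
    then show ?thesis using K.finite_roots_of_unity[OF m(1)] by (rule finite_subset)
  qed
  then have "finite (Pi\<^sub>E {1..n} (\<lambda>i. \<chi> i ` carrier G))" by (intro finite_PiE) auto
  moreover have "\<Phi> ` \<Lambda> \<subseteq> Pi\<^sub>E {1..n} (\<lambda>i. \<chi> i ` carrier G)"
    unfolding \<Phi>_def by auto
  ultimately have "finite (\<Phi> ` \<Lambda>)" by (rule rev_finite_subset)
  moreover have "inj_on \<Phi> \<Lambda>"
  proof (rule inj_onI)
    fix l l' assume l: "l \<in> \<Lambda>" "l' \<in> \<Lambda>" "\<Phi> l = \<Phi> l'"
    have "\<chi> i l = \<chi> i l'" if "i \<in> {1..n}" for i
      using fun_cong[OF l(3), of i] that unfolding \<Phi>_def by simp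
    then have "l' \<otimes> inv l \<in> N" using separating_character[of l' l] l by (metis Lambda_G)
    then show "l = l'" using Lambda_unique[OF l(1,2)] l by (simp add: G.m_comm)
  qed
  ultimately show ?thesis by (rule finite_imageD)
qed

section \<open>The subring \<open>R[N]\<close> and the scalars\<close>

lemma B_iff: "b \<in> carrier B \<longleftrightarrow> b \<in> carrier A \<and> (\<forall>g. g \<notin> N \<longrightarrow> b g = \<zero>\<^bsub>R\<^esub>)"
  using S.skew_ring_subgroup_incl[OF N_subgroup] by blast

lemma BA: "b \<in> carrier B \<Longrightarrow> b \<in> carrier A" using B_iff by blast

lemma B_ops [simp]: "monoid.mult B = monoid.mult A" "add B = add A" "\<one>\<^bsub>B\<^esub> = \<one>\<^bsub>A\<^esub>" "\<zero>\<^bsub>B\<^esub> = \<zero>\<^bsub>A\<^esub>" "smult B = smult A"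
  by (simp_all add: skew_group_ring_def)

lemma B_record: "B = A\<lparr>carrier := carrier B\<rparr>"
  by (rule skew_group_ring_subgroup)

sublocale SB: skew_action R "G\<lparr>carrier := N\<rparr>" act
  by (rule S.skew_action_subgroup[OF N_subgroup])

lemma mon_B [simp]: "\<lbrakk>r \<in> carrier R; g \<in> N\<rbrakk> \<Longrightarrow> S.mon r g \<in> carrier B"
  using SB.mon_closed by simp

text \<open>
  The action of \<open>N\<close> on \<open>R\<close> is trivial, so \<open>(r g) (s h) = (r s) (g h)\<close> for \<open>g\<close> and \<open>h\<close> in \<open>N\<close>.
\<close>

lemma B_comm:
  assumes "a \<in> carrier B" and "b \<in> carrier B"
  shows "a \<otimes>\<^sub>A b = b \<otimes>\<^sub>A a"
  using assms(1)
proof (induction rule: SB.skew_induct)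
  case (mon r g)
  show ?case using assms(2)
  proof (induction rule: SB.skew_induct)
    case (mon s h)
    then show ?case using \<open>r \<in> carrier R\<close> \<open>g \<in> carrier (G\<lparr>carrier := N\<rparr>)\<close>
      by (simp add: S.mon_mult_mon act_N R.m_comm G.m_comm)
  next
    case (add b b')
    then show ?case using \<open>r \<in> carrier R\<close> \<open>g \<in> carrier (G\<lparr>carrier := N\<rparr>)\<close>
      by (simp add: A.r_distr A.l_distr BA)
  qed
next
  case (add a a')
  then show ?case using assms(2) by (simp add: A.r_distr A.l_distr BA)
qed

sublocale B: cring B
proof (intro cring.intro comm_monoid.intro comm_monoid_axioms.intro)
  show "ring B" by (rule SB.ring_A)
  then show "monoid B" by (rule ring.is_monoid)
  show "a \<otimes>\<^bsub>B\<^esub> b = b \<otimes>\<^bsub>B\<^esub> a" if "a \<in> carrier B" "b \<in> carrier B" for a b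
    using B_comm[OF that] by simp
qed

lemma kappa_eq: "c \<in> carrier K \<Longrightarrow> c \<odot>\<^bsub>A\<^esub> \<one>\<^bsub>A\<^esub> = \<kappa> c"
  by (auto simp: S.skew_ops(3,4) skew_monom_def)

lemma kappa_closed [simp]: "c \<in> carrier K \<Longrightarrow> \<kappa> c \<in> carrier A" "c \<in> carrier K \<Longrightarrow> \<kappa> c \<in> carrier B"
  using N_closed(1) by simp_all

lemma mon_add: "\<lbrakk>r \<in> carrier R; s \<in> carrier R\<rbrakk> \<Longrightarrow> S.mon (r \<oplus>\<^bsub>R\<^esub> s) g = S.mon r g \<oplus>\<^sub>A S.mon s g"
  by (auto simp: S.skew_ops skew_monom_def)

lemma kappa_hom: "\<kappa> \<in> ring_hom K A"
proof (rule ring_hom_memI)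
  fix c d assume c: "c \<in> carrier K" and d: "d \<in> carrier K"
  show "\<kappa> (c \<otimes>\<^sub>K d) = \<kappa> c \<otimes>\<^sub>A \<kappa> d"
    using c d by (simp add: S.mon_mult_mon act_scalar R.smult_assoc1 R.smult_assoc2)
  show "\<kappa> (c \<oplus>\<^bsub>K\<^esub> d) = \<kappa> c \<oplus>\<^sub>A \<kappa> d"
    using c d mon_add[of "c \<odot>\<^bsub>R\<^esub> \<one>\<^bsub>R\<^esub>" "d \<odot>\<^bsub>R\<^esub> \<one>\<^bsub>R\<^esub>" "\<one>"] by (simp add: R.smult_l_distr)
qed (simp_all add: S.skew_ops(3))

lemma kappa_B_hom: "\<kappa> \<in> ring_hom K B"
  using kappa_hom unfolding ring_hom_def by auto

lemma kappa_mon: "\<lbrakk>c \<in> carrier K; r \<in> carrier R; g \<in> carrier G\<rbrakk> \<Longrightarrow> \<kappa> c \<otimes>\<^sub>A S.mon r g = S.mon (c \<odot>\<^bsub>R\<^esub> r) g"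
  by (simp add: S.mon_mult_mon S.act_one R.smult_assoc2)

lemma kappa_central:
  assumes "c \<in> carrier K" and "a \<in> carrier A"
  shows "\<kappa> c \<otimes>\<^sub>A a = a \<otimes>\<^sub>A \<kappa> c"
  using assms(2)
proof (induction rule: S.skew_induct)
  case (mon r g)
  then have "S.mon r g \<otimes>\<^sub>A \<kappa> c = S.mon (c \<odot>\<^bsub>R\<^esub> r) g"
    using assms(1) R.smult_assoc2[of c "\<one>\<^bsub>R\<^esub>" r] R.m_comm[of r "c \<odot>\<^bsub>R\<^esub> \<one>\<^bsub>R\<^esub>"]
    by (simp add: S.mon_mult_mon act_scalar)
  then show ?case using kappa_mon assms(1) mon by simp
next
  case (add a b)
  then show ?case using assms(1) by (simp add: A.r_distr A.l_distr)
qed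

lemma gg_mult: "\<lbrakk>g \<in> carrier G; h \<in> carrier G\<rbrakk> \<Longrightarrow> gg g \<otimes>\<^sub>A gg h = gg (g \<otimes> h)"
  by (simp add: S.mon_mult_mon)

lemma gg_one: "gg \<one> = \<one>\<^bsub>A\<^esub>" by (simp add: S.skew_ops(3))

lemma xx_gg:
  assumes i: "i \<in> {1..n}" and g: "g \<in> carrier G"
  shows "xx i \<otimes>\<^sub>A gg g = \<kappa> (\<chi> i g) \<otimes>\<^sub>A (gg g \<otimes>\<^sub>A xx i)"
proof -
  have inv: "inv\<^bsub>K\<^esub> (\<chi> i g) \<in> carrier K" "\<chi> i g \<otimes>\<^sub>K inv\<^bsub>K\<^esub> (\<chi> i g) = \<one>\<^sub>K"
    using chi_props(3)[OF i g] by simp_all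
  have "gg g \<otimes>\<^sub>A xx i = S.mon (inv\<^bsub>K\<^esub> (\<chi> i g) \<odot>\<^bsub>R\<^esub> x i) g"
    using action_gens i g inv by (simp add: S.mon_mult_mon del: atLeastAtMost_iff)
  then have "\<kappa> (\<chi> i g) \<otimes>\<^sub>A (gg g \<otimes>\<^sub>A xx i) = S.mon (\<chi> i g \<odot>\<^bsub>R\<^esub> (inv\<^bsub>K\<^esub> (\<chi> i g) \<odot>\<^bsub>R\<^esub> x i)) g"
    using kappa_mon[OF chi_props(1)[OF i g] _ g] inv i by (simp del: atLeastAtMost_iff)
  also have "\<chi> i g \<odot>\<^bsub>R\<^esub> (inv\<^bsub>K\<^esub> (\<chi> i g) \<odot>\<^bsub>R\<^esub> x i) = x i"
    using R.smult_assoc1[OF chi_props(1)[OF i g] inv(1) xi[OF i]] inv(2) i by (simp del: atLeastAtMost_iff)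
  finally show ?thesis using i g by (simp add: S.mon_mult_mon S.act_one del: atLeastAtMost_iff)
qed

text \<open>
  With \<open>l\<close> the representative of \<open>g\<close>, the right factor lies in \<open>R[N]\<close>. This is how elements of \<open>R # G\<close> are written as
  sums of products \<open>l b\<close>.
\<close>

lemma mon_factor:
  assumes r: "r \<in> carrier R" and g: "g \<in> carrier G" and l: "l \<in> carrier G"
  shows "S.mon r g = gg l \<otimes>\<^sub>A S.mon (act (inv l) r) (inv l \<otimes> g)"
  using assms by (simp add: S.mon_mult_mon G.m_assoc[symmetric])

text \<open>
  The projection of \<open>R # G\<close> onto \<open>R[N]\<close> along the other cosets.
\<close>

definition proj :: "('g \<Rightarrow> 'r) \<Rightarrow> 'g \<Rightarrow> 'r" where
  "proj a = (\<lambda>g. if g \<in> N then a g else \<zero>\<^bsub>R\<^esub>)"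

lemma proj_closed: "a \<in> carrier A \<Longrightarrow> proj a \<in> carrier B"
  unfolding B_iff S.skew_carrier proj_def by (auto intro: rev_finite_subset)

lemma proj_add: "proj (a \<oplus>\<^sub>A b) = proj a \<oplus>\<^sub>A proj b"
  unfolding proj_def S.skew_ops by auto

lemma proj_mon: "proj (S.mon r g) = (if g \<in> N then S.mon r g else \<zero>\<^bsub>A\<^esub>)"
  unfolding proj_def S.skew_ops skew_monom_def by auto

lemma proj_B: "b \<in> carrier B \<Longrightarrow> proj b = b"
  unfolding B_iff proj_def by auto

lemma proj_mult:
  assumes a: "a \<in> carrier A" and b: "b \<in> carrier B"
  shows "proj (a \<otimes>\<^sub>A b) = proj a \<otimes>\<^sub>A b"
  using a
proof (induction rule: S.skew_induct)
  case (mon r g)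
  show ?case
  proof (cases "g \<in> N")
    case True
    then have "S.mon r g \<otimes>\<^sub>A b \<in> carrier B" using B.m_closed[OF mon_B[OF mon(1) True] b] by simp
    then show ?thesis using proj_B[of "S.mon r g \<otimes>\<^sub>A b"] proj_mon True by simp
  next
    case False
    have "proj (S.mon r g \<otimes>\<^sub>A b) k = \<zero>\<^bsub>R\<^esub>" for k
    proof (cases "k \<in> N")
      case True
      have "inv g \<otimes> k \<notin> N"
      proof
        assume "inv g \<otimes> k \<in> N"
        then have "k \<otimes> inv (inv g \<otimes> k) \<in> N" using True N_closed by simp
        moreover have "k \<otimes> inv (inv g \<otimes> k) = g"
          using True mon by (simp add: G.inv_mult_group G.m_assoc[symmetric])
        ultimately show False using False by simp
      qed
      then show ?thesis
        using S.mon_mult[OF mon BA[OF b], of k] True b mon B_iff unfolding proj_def by simp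
    qed (simp add: proj_def)
    then have "proj (S.mon r g \<otimes>\<^sub>A b) = \<zero>\<^bsub>A\<^esub>" unfolding S.skew_ops by blast
    then show ?thesis using False BA[OF b] by (simp add: proj_mon)
  qed
next
  case (add a a')
  then show ?case using BA[OF b] proj_closed BA by (simp add: A.l_distr proj_add)
qed

end


section \<open>Modules over the skew group ring as vector spaces\<close>

text \<open>
  The two records carry the same addition but are of different types, so that this is not an equality of modules.
\<close>

lemma finsum_restrict_scalars: "finsum (restrict_scalars A M) f S = finsum M f S"
  by (simp add: finsum_def finprod_def restrict_scalars_def)

lemma finsum_additive_image:
  assumes "abelian_group M" and "abelian_group M'" and "h \<in> carrier M \<rightarrow> carrier M'"
    and add: "\<And>x y. \<lbrakk>x \<in> carrier M; y \<in> carrier M\<rbrakk> \<Longrightarrow> h (x \<oplus>\<^bsub>M\<^esub> y) = h x \<oplus>\<^bsub>M'\<^esub> h y"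
    and "finite S" and "f \<in> S \<rightarrow> carrier M"
  shows "h (\<Oplus>\<^bsub>M\<^esub>s\<in>S. f s) = (\<Oplus>\<^bsub>M'\<^esub>s\<in>S. h (f s))"
proof -
  interpret M: abelian_group M by fact
  interpret M': abelian_group M' by fact
  have "h \<zero>\<^bsub>M\<^esub> \<oplus>\<^bsub>M'\<^esub> h \<zero>\<^bsub>M\<^esub> = h \<zero>\<^bsub>M\<^esub>" using add[of "\<zero>\<^bsub>M\<^esub>" "\<zero>\<^bsub>M\<^esub>"] by simp
  moreover have "h \<zero>\<^bsub>M\<^esub> \<in> carrier M'" using assms(3) by auto
  ultimately have zero: "h \<zero>\<^bsub>M\<^esub> = \<zero>\<^bsub>M'\<^esub>" by (simp add: M'.add.l_cancel_one)
  show ?thesis using assms(5,6)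
  proof (induction rule: finite_induct)
    case (insert s S)
    have "(\<lambda>s. h (f s)) \<in> S \<rightarrow> carrier M'" "h (f s) \<in> carrier M'" using insert.prems assms(3) by auto
    moreover have "finsum M f S \<in> carrier M" "f s \<in> carrier M" using insert.prems by (auto intro: M.finsum_closed)
    ultimately show ?case using insert by (simp add: add)
  qed (simp add: zero)
qed

context diagonal_action
begin

lemma restrict_scalars_vectorspace:
  assumes "left_module A M"
  shows "vectorspace K (restrict_scalars A M)"
proof -
  interpret M: left_module A M by fact
  have "module K (restrict_scalars A M)"
  proof (intro module.intro module_axioms.intro)
    show "cring K" by unfold_locales
    show "abelian_group (restrict_scalars A M)"
      by (rule abelian_groupI) (use M.M.l_neg in \<open>auto simp: restrict_scalars_def M.M.a_assoc M.M.a_comm M.M.a_lcomm\<close>)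
    fix c d m assume c: "c \<in> carrier K" and d: "d \<in> carrier K" and "m \<in> carrier (restrict_scalars A M)"
    then have m: "m \<in> carrier M" by (simp add: restrict_scalars_def)
    show "c \<odot>\<^bsub>restrict_scalars A M\<^esub> m \<in> carrier (restrict_scalars A M)"
      using c m M.smult_closed by (simp add: restrict_scalars_def kappa_eq)
    show "(c \<oplus>\<^bsub>K\<^esub> d) \<odot>\<^bsub>restrict_scalars A M\<^esub> m =
        c \<odot>\<^bsub>restrict_scalars A M\<^esub> m \<oplus>\<^bsub>restrict_scalars A M\<^esub> d \<odot>\<^bsub>restrict_scalars A M\<^esub> m"
      using c d m M.smult_l_distr ring_hom_add[OF kappa_hom c d] by (simp add: restrict_scalars_def kappa_eq)
    show "(c \<otimes>\<^sub>K d) \<odot>\<^bsub>restrict_scalars A M\<^esub> m = c \<odot>\<^bsub>restrict_scalars A M\<^esub> (d \<odot>\<^bsub>restrict_scalars A M\<^esub> m)"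
      using c d m M.smult_assoc1 ring_hom_mult[OF kappa_hom c d] by (simp add: restrict_scalars_def kappa_eq)
    fix m' assume "m' \<in> carrier (restrict_scalars A M)"
    then have m': "m' \<in> carrier M" by (simp add: restrict_scalars_def)
    show "c \<odot>\<^bsub>restrict_scalars A M\<^esub> (m \<oplus>\<^bsub>restrict_scalars A M\<^esub> m') =
        c \<odot>\<^bsub>restrict_scalars A M\<^esub> m \<oplus>\<^bsub>restrict_scalars A M\<^esub> c \<odot>\<^bsub>restrict_scalars A M\<^esub> m'"
      using c m m' M.smult_r_distr by (simp add: restrict_scalars_def kappa_eq)
  next
    fix m assume "m \<in> carrier (restrict_scalars A M)"
    then have m: "m \<in> carrier M" by (simp add: restrict_scalars_def)
    then show "\<one>\<^sub>K \<odot>\<^bsub>restrict_scalars A M\<^esub> m = m"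
      using M.smult_one ring_hom_one[OF kappa_hom] by (simp add: restrict_scalars_def kappa_eq)
  qed
  moreover have "field K" by unfold_locales
  ultimately show ?thesis by (rule vectorspace.intro)
qed

lemma mon_zero [simp]: "S.mon \<zero>\<^bsub>R\<^esub> g = \<zero>\<^bsub>A\<^esub>"
  by (auto simp: S.skew_ops skew_monom_def)

lemma restrict_scalars_smult:
  "c \<in> carrier K \<Longrightarrow> c \<odot>\<^bsub>restrict_scalars A M\<^esub> m = \<kappa> c \<odot>\<^bsub>M\<^esub> m"
  "c \<in> carrier K \<Longrightarrow> c \<odot>\<^bsub>restrict_scalars B M\<^esub> m = \<kappa> c \<odot>\<^bsub>M\<^esub> m"
  by (simp_all add: restrict_scalars_def kappa_eq)

end

section \<open>The module induced from a line\<close>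

locale weight_line = diagonal_action K R G act n x \<chi> N \<Lambda> + V: left_module "skew_group_ring R (G\<lparr>carrier := N\<rparr>) act" V
  for K :: "('k, 'e) ring_scheme" and R :: "('k, 'r, 'c) module_scheme" and G :: "('g, 'd) monoid_scheme" (structure)
    and act n x \<chi> N \<Lambda> and V :: "('g \<Rightarrow> 'r, 'v, 'w) module_scheme" +
  fixes v :: 'v
  assumes v_in: "v \<in> carrier V" and v_nonzero: "v \<noteq> \<zero>\<^bsub>V\<^esub>"
    and V_line: "carrier V = {c \<odot>\<^bsub>restrict_scalars (skew_group_ring R (G\<lparr>carrier := N\<rparr>) act) V\<^esub> v | c. c \<in> carrier K}"
    and x_torsion_free: "\<And>i. i \<in> {1..n} \<Longrightarrow> skew_monom R (x i) \<one> \<odot>\<^bsub>V\<^esub> v \<noteq> \<zero>\<^bsub>V\<^esub>"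
begin

abbreviation smult_V (infixl \<open>\<odot>\<^sub>V\<close> 70) where "b \<odot>\<^sub>V u \<equiv> b \<odot>\<^bsub>V\<^esub> u"
abbreviation zero_V (\<open>\<zero>\<^sub>V\<close>) where "\<zero>\<^sub>V \<equiv> \<zero>\<^bsub>V\<^esub>"

lemma V_eq: "carrier V = {\<kappa> c \<odot>\<^sub>V v | c. c \<in> carrier K}"
  unfolding V_line by (intro Collect_cong) (metis restrict_scalars_smult(2))

lemma kappa_v_zero: "\<lbrakk>c \<in> carrier K; \<kappa> c \<odot>\<^sub>V v = \<zero>\<^sub>V\<rbrakk> \<Longrightarrow> c = \<zero>\<^sub>K"
proof (rule ccontr)
  assume c: "c \<in> carrier K" "\<kappa> c \<odot>\<^sub>V v = \<zero>\<^sub>V" "c \<noteq> \<zero>\<^sub>K"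
  then have u: "inv\<^bsub>K\<^esub> c \<in> carrier K" "inv\<^bsub>K\<^esub> c \<otimes>\<^sub>K c = \<one>\<^sub>K"
    using K.field_Units by (auto intro!: K.Units_l_inv)
  have "v = \<kappa> (inv\<^bsub>K\<^esub> c \<otimes>\<^sub>K c) \<odot>\<^sub>V v"
    using ring_hom_one[OF kappa_B_hom] V.smult_one[OF v_in] u by simp
  also have "\<dots> = \<kappa> (inv\<^bsub>K\<^esub> c) \<odot>\<^sub>V (\<kappa> c \<odot>\<^sub>V v)"
    using ring_hom_mult[OF kappa_B_hom u(1) c(1)] V.smult_assoc1[of "\<kappa> (inv\<^bsub>K\<^esub> c)" "\<kappa> c" v] u(1) c(1) v_in by simp
  also have "\<dots> = \<zero>\<^sub>V" using c u by simp
  finally show False using v_nonzero by simp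
qed

lemma kappa_v_inj:
  assumes "c \<in> carrier K" "d \<in> carrier K" "\<kappa> c \<odot>\<^sub>V v = \<kappa> d \<odot>\<^sub>V v"
  shows "c = d"
proof -
  interpret k: ring_hom_ring K B \<kappa>
    by (rule ring_hom_ringI2[OF K.ring_axioms B.ring_axioms kappa_B_hom])
  have "\<kappa> (c \<ominus>\<^bsub>K\<^esub> d) = \<kappa> c \<oplus>\<^bsub>B\<^esub> \<ominus>\<^bsub>B\<^esub> \<kappa> d"
    unfolding K.minus_eq using k.hom_add[OF assms(1) K.a_inv_closed[OF assms(2)]] k.hom_a_inv[OF assms(2)] by simp
  then have "\<kappa> (c \<ominus>\<^bsub>K\<^esub> d) \<odot>\<^sub>V v = \<kappa> c \<odot>\<^sub>V v \<oplus>\<^bsub>V\<^esub> \<ominus>\<^bsub>V\<^esub> (\<kappa> d \<odot>\<^sub>V v)"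
    using V.smult_l_distr[of "\<kappa> c" "\<ominus>\<^bsub>B\<^esub> \<kappa> d" v] V.smult_l_minus[of "\<kappa> d" v] B.a_inv_closed assms(1,2) v_in
    by (metis kappa_closed(2))
  then have "\<kappa> (c \<ominus>\<^bsub>K\<^esub> d) \<odot>\<^sub>V v = \<zero>\<^sub>V"
    using assms V.smult_closed[of "\<kappa> d" v] v_in by (simp add: V.M.r_neg)
  then show ?thesis using kappa_v_zero[of "c \<ominus>\<^bsub>K\<^esub> d"] assms by simp
qed

text \<open>
  The scalar by which \<open>b\<close> acts on the line \<open>V\<close>. It is unique by \<open>kappa_v_inj\<close>.
\<close>

definition weight :: "('g \<Rightarrow> 'r) \<Rightarrow> 'k" where
  "weight b = (SOME c. c \<in> carrier K \<and> b \<odot>\<^sub>V v = \<kappa> c \<odot>\<^sub>V v)"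

lemma weight:
  assumes "b \<in> carrier B"
  shows "weight b \<in> carrier K" and "b \<odot>\<^sub>V v = \<kappa> (weight b) \<odot>\<^sub>V v"
proof -
  have "b \<odot>\<^sub>V v \<in> carrier V" using V.smult_closed assms v_in by simp
  then have "\<exists>c. c \<in> carrier K \<and> b \<odot>\<^sub>V v = \<kappa> c \<odot>\<^sub>V v" using V_eq by blast
  from someI_ex[OF this] show "weight b \<in> carrier K" "b \<odot>\<^sub>V v = \<kappa> (weight b) \<odot>\<^sub>V v"
    unfolding weight_def by auto
qed

lemma weight_mult:
  assumes b: "b \<in> carrier B" and b': "b' \<in> carrier B"
  shows "weight (b \<otimes>\<^sub>A b') = weight b \<otimes>\<^sub>K weight b'"
proof (rule kappa_v_inj)
  note w = weight[OF b] weight[OF b']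
  have bb: "b \<otimes>\<^sub>A b' \<in> carrier B" using B.m_closed[OF b b'] by simp
  show "weight (b \<otimes>\<^sub>A b') \<in> carrier K" "weight b \<otimes>\<^sub>K weight b' \<in> carrier K"
    using weight[OF bb] w by simp_all
  have "\<kappa> (weight (b \<otimes>\<^sub>A b')) \<odot>\<^sub>V v = b \<odot>\<^sub>V (b' \<odot>\<^sub>V v)"
    using weight(2)[OF bb] V.smult_assoc1[OF b b' v_in] by simp
  also have "\<dots> = b \<odot>\<^sub>V (\<kappa> (weight b') \<odot>\<^sub>V v)" using w by simp
  also have "\<dots> = (\<kappa> (weight b') \<otimes>\<^bsub>B\<^esub> b) \<odot>\<^sub>V v"
    using V.smult_assoc1[OF b kappa_closed(2)[OF w(3)] v_in] B.m_comm[OF b kappa_closed(2)[OF w(3)]] by simp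
  also have "\<dots> = \<kappa> (weight b') \<odot>\<^sub>V (\<kappa> (weight b) \<odot>\<^sub>V v)"
    using V.smult_assoc1[OF kappa_closed(2)[OF w(3)] b v_in] w by simp
  also have "\<dots> = \<kappa> (weight b' \<otimes>\<^sub>K weight b) \<odot>\<^sub>V v"
    using V.smult_assoc1[OF kappa_closed(2)[OF w(3)] kappa_closed(2)[OF w(1)] v_in]
      ring_hom_mult[OF kappa_B_hom w(3) w(1)] by simp
  finally show "\<kappa> (weight (b \<otimes>\<^sub>A b')) \<odot>\<^sub>V v = \<kappa> (weight b \<otimes>\<^sub>K weight b') \<odot>\<^sub>V v"
    using K.m_comm w by simp
qed

lemma weight_one: "weight \<one>\<^bsub>A\<^esub> = \<one>\<^sub>K"
proof (rule kappa_v_inj)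
  have one: "\<one>\<^bsub>A\<^esub> \<in> carrier B" using B.one_closed by simp
  show "weight \<one>\<^bsub>A\<^esub> \<in> carrier K" using weight(1)[OF one] .
  show "\<kappa> (weight \<one>\<^bsub>A\<^esub>) \<odot>\<^sub>V v = \<kappa> \<one>\<^sub>K \<odot>\<^sub>V v"
    using weight(2)[OF one] ring_hom_one[OF kappa_hom] by simp
qed simp

abbreviation "kk i \<equiv> weight (xx i)"
abbreviation "ll h \<equiv> weight (gg h)"

lemma xx_B [simp]: "i \<in> {1..n} \<Longrightarrow> xx i \<in> carrier B" using N_closed(1) by simp
lemma xx_A [simp]: "i \<in> {1..n} \<Longrightarrow> xx i \<in> carrier A" by simp

lemma kk_nonzero: "i \<in> {1..n} \<Longrightarrow> kk i \<in> carrier K \<and> kk i \<noteq> \<zero>\<^sub>K"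
proof -
  assume i: "i \<in> {1..n}"
  have "\<kappa> \<zero>\<^sub>K = \<zero>\<^bsub>A\<^esub>" using ring_hom_zero[OF kappa_hom K.ring_axioms A.ring_axioms] .
  then have "\<kappa> \<zero>\<^sub>K \<odot>\<^sub>V v = \<zero>\<^sub>V" using V.smult_l_zero[OF v_in] by simp
  then show ?thesis using weight[OF xx_B[OF i]] x_torsion_free[OF i] by metis
qed

lemma ll_hom: "ll \<in> hom (G\<lparr>carrier := N\<rparr>) (units_of K)"
proof (rule homI)
  fix h assume "h \<in> carrier (G\<lparr>carrier := N\<rparr>)"
  then have h: "h \<in> N" by simp
  have "ll h \<otimes>\<^sub>K ll (inv h) = \<one>\<^sub>K"
    using weight_mult[of "gg h" "gg (inv h)"] h N_closed gg_mult[of h "inv h"] gg_one weight_one by simp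
  then have "ll h \<noteq> \<zero>\<^sub>K" using weight(1)[of "gg (inv h)"] h N_closed by auto
  then show "ll h \<in> carrier (units_of K)"
    using weight(1)[of "gg h"] h K.field_Units by (simp add: units_of_def)
  fix h' assume "h' \<in> carrier (G\<lparr>carrier := N\<rparr>)"
  then have h': "h' \<in> N" by simp
  show "ll (h \<otimes>\<^bsub>G\<lparr>carrier := N\<rparr>\<^esub> h') = ll h \<otimes>\<^bsub>units_of K\<^esub> ll h'"
    using weight_mult[of "gg h" "gg h'"] gg_mult[of h h'] h h' by (simp add: units_of_def)
qed

sublocale I: induced A B V
  using BA by unfold_locales auto

abbreviation "T \<equiv> induced_module A B V"
abbreviation smult_T (infixl \<open>\<odot>\<^sub>T\<close> 70) where "a \<odot>\<^sub>T t \<equiv> a \<odot>\<^bsub>T\<^esub> t"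
abbreviation add_T (infixl \<open>\<oplus>\<^sub>T\<close> 65) where "s \<oplus>\<^sub>T t \<equiv> s \<oplus>\<^bsub>T\<^esub> t"
abbreviation zero_T (\<open>\<zero>\<^sub>T\<close>) where "\<zero>\<^sub>T \<equiv> \<zero>\<^bsub>T\<^esub>"

definition vv :: "'g \<Rightarrow> (('g \<Rightarrow> 'r) \<times> 'v \<Rightarrow>\<^sub>0 int) set" where "vv g = pure_tensor A B V (gg g) v"

lemma vv_closed [simp]: "g \<in> carrier G \<Longrightarrow> vv g \<in> carrier T"
  unfolding vv_def using v_in by simp

text \<open>
  A factor from \<open>B\<close> crosses the tensor sign and becomes a scalar there; scalars are central, so it comes out on the left.
\<close>

lemma pure_B: "\<lbrakk>a \<in> carrier A; b \<in> carrier B\<rbrakk> \<Longrightarrow> I.pure (a \<otimes>\<^sub>A b) v = \<kappa> (weight b) \<odot>\<^sub>T I.pure a v"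
proof -
  assume a: "a \<in> carrier A" and b: "b \<in> carrier B"
  note w = weight[OF b]
  have "I.pure (a \<otimes>\<^sub>A b) v = I.pure (a \<otimes>\<^sub>A \<kappa> (weight b)) v"
    using I.pure_balanced[OF a b v_in] I.pure_balanced[OF a kappa_closed(2)[OF w(1)] v_in] w by simp
  also have "\<dots> = \<kappa> (weight b) \<odot>\<^sub>T I.pure a v"
    using kappa_central[OF w(1) a] I.smult_pure[OF kappa_closed(1)[OF w(1)] a v_in] by simp
  finally show ?thesis .
qed

lemma kappa_mult_T: "\<lbrakk>c \<in> carrier K; d \<in> carrier K; t \<in> carrier T\<rbrakk> \<Longrightarrow> \<kappa> (c \<otimes>\<^sub>K d) \<odot>\<^sub>T t = \<kappa> c \<odot>\<^sub>T (\<kappa> d \<odot>\<^sub>T t)"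
  using ring_hom_mult[OF kappa_hom] I.T.smult_assoc1 by simp

lemma xx_vv:
  assumes i: "i \<in> {1..n}" and g: "g \<in> carrier G"
  shows "xx i \<odot>\<^sub>T vv g = \<kappa> (\<chi> i g \<otimes>\<^sub>K kk i) \<odot>\<^sub>T vv g"
proof -
  note c = chi_props(1)[OF i g] and k = kk_nonzero[OF i]
  have gA: "gg g \<in> carrier A" using g by simp
  have "xx i \<odot>\<^sub>T vv g = I.pure (\<kappa> (\<chi> i g) \<otimes>\<^sub>A (gg g \<otimes>\<^sub>A xx i)) v"
    unfolding vv_def xx_gg[OF i g, symmetric] by (rule I.smult_pure[OF xx_A[OF i] gA v_in])
  also have "\<dots> = \<kappa> (\<chi> i g) \<odot>\<^sub>T I.pure (gg g \<otimes>\<^sub>A xx i) v"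
    by (rule I.smult_pure[symmetric, OF kappa_closed(1)[OF c] A.m_closed[OF gA xx_A[OF i]] v_in])
  also have "I.pure (gg g \<otimes>\<^sub>A xx i) v = \<kappa> (kk i) \<odot>\<^sub>T vv g"
    unfolding vv_def by (rule pure_B[OF gA xx_B[OF i]])
  also have "\<kappa> (\<chi> i g) \<odot>\<^sub>T (\<kappa> (kk i) \<odot>\<^sub>T vv g) = \<kappa> (\<chi> i g \<otimes>\<^sub>K kk i) \<odot>\<^sub>T vv g"
    using kappa_mult_T[OF c _ vv_closed[OF g]] k by simp
  finally show ?thesis .
qed

lemma gg_vv: "\<lbrakk>g \<in> carrier G; h \<in> carrier G\<rbrakk> \<Longrightarrow> gg g \<odot>\<^sub>T vv h = vv (g \<otimes> h)"
  unfolding vv_def using I.smult_pure[of "gg g" "gg h" v] gg_mult v_in by simp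

lemma vv_mult_N: "\<lbrakk>g \<in> carrier G; h \<in> N\<rbrakk> \<Longrightarrow> vv (g \<otimes> h) = \<kappa> (ll h) \<odot>\<^sub>T vv g"
  unfolding vv_def using pure_B[of "gg g" "gg h"] gg_mult by simp

lemma gg_action:
  assumes g: "g \<in> \<Lambda>" "g' \<in> \<Lambda>" and h: "h \<in> N"
  shows "gg (h \<otimes> g) \<odot>\<^sub>T vv g' =
    \<kappa> (ll (coset_cocycle G N \<Lambda> g g' \<otimes> h)) \<odot>\<^sub>T vv (coset_rep G N \<Lambda> (g \<otimes> g'))"
    and "coset_cocycle G N \<Lambda> g g' \<in> N"
proof -
  let ?r = "coset_rep G N \<Lambda> (g \<otimes> g')" and ?c = "coset_cocycle G N \<Lambda> g g'"
  have G: "g \<in> carrier G" "g' \<in> carrier G" "h \<in> carrier G" using g h by simp_all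
  have gg': "g \<otimes> g' \<in> carrier G" using G by simp
  have r: "?r \<in> carrier G" using coset_rep(1)[OF gg'] by simp
  show c: "?c \<in> N"
    using coset_rep(2)[OF gg'] r gg' unfolding coset_cocycle_def by (simp add: G.m_comm)
  have "h \<otimes> g \<otimes> g' = ?r \<otimes> (?c \<otimes> h)"
  proof -
    have "?r \<otimes> (?c \<otimes> h) = (?r \<otimes> inv ?r) \<otimes> (h \<otimes> (g \<otimes> g'))"
      unfolding coset_cocycle_def using r gg' G by (simp add: G.m_ac)
    then show ?thesis using r gg' G by (simp add: G.m_assoc)
  qed
  then show "gg (h \<otimes> g) \<odot>\<^sub>T vv g' = \<kappa> (ll (?c \<otimes> h)) \<odot>\<^sub>T vv ?r"
    using gg_vv[of "h \<otimes> g" g'] vv_mult_N[OF r N_closed(2)[OF c h]] G by simp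
qed

abbreviation comb :: "('g \<Rightarrow> 'k) \<Rightarrow> (('g \<Rightarrow> 'r) \<times> 'v \<Rightarrow>\<^sub>0 int) set" where
  "comb c \<equiv> (\<Oplus>\<^bsub>T\<^esub>l\<in>\<Lambda>. \<kappa> (c l) \<odot>\<^sub>T vv l)"

lemma term_closed: "\<lbrakk>c \<in> \<Lambda> \<rightarrow> carrier K; l \<in> \<Lambda>\<rbrakk> \<Longrightarrow> \<kappa> (c l) \<odot>\<^sub>T vv l \<in> carrier T"
  by (rule I.T.smult_closed) (auto intro!: kappa_closed(1))

lemma kappa_zero_T: "t \<in> carrier T \<Longrightarrow> \<kappa> \<zero>\<^sub>K \<odot>\<^sub>T t = \<zero>\<^sub>T"
  using ring_hom_zero[OF kappa_hom K.ring_axioms A.ring_axioms] I.T.smult_l_zero by simp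

text \<open>
  Since \<open>\<Lambda>\<close> is finite, linear combinations are indexed by all of \<open>\<Lambda>\<close>, with zero coefficients where necessary.
\<close>

lemma comb_single:
  assumes l: "l \<in> \<Lambda>" and c: "c \<in> carrier K"
  shows "comb (\<lambda>l'. if l' = l then c else \<zero>\<^sub>K) = \<kappa> c \<odot>\<^sub>T vv l"
proof -
  have "comb (\<lambda>l'. if l' = l then c else \<zero>\<^sub>K) = (\<Oplus>\<^bsub>T\<^esub>l'\<in>\<Lambda>. if l = l' then \<kappa> c \<odot>\<^sub>T vv l' else \<zero>\<^sub>T)"
    using c I.T.smult_closed by (intro I.T.M.finsum_cong') (simp_all add: Pi_def)
  also have "\<dots> = \<kappa> c \<odot>\<^sub>T vv l"
    using finite_Lambda l c I.T.smult_closed by (intro I.T.M.finsum_singleton) auto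
  finally show ?thesis .
qed

text \<open>
  By \<open>mon_factor\<close> and \<open>pure_B\<close>, the tensor \<open>r g \<otimes> v\<close> is a scalar multiple of \<open>v\<^sub>l\<close> for the representative \<open>l\<close> of \<open>g\<close>.
\<close>

lemma spanning:
  assumes "t \<in> carrier T"
  shows "\<exists>c \<in> \<Lambda> \<rightarrow> carrier K. t = comb c"
proof -
  have comb_add: "\<exists>c \<in> \<Lambda> \<rightarrow> carrier K. comb c1 \<oplus>\<^sub>T comb c2 = comb c"
    if c: "c1 \<in> \<Lambda> \<rightarrow> carrier K" "c2 \<in> \<Lambda> \<rightarrow> carrier K" for c1 c2
  proof
    show "(\<lambda>l. c1 l \<oplus>\<^bsub>K\<^esub> c2 l) \<in> \<Lambda> \<rightarrow> carrier K" using c by auto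
    have "comb (\<lambda>l. c1 l \<oplus>\<^bsub>K\<^esub> c2 l) = (\<Oplus>\<^bsub>T\<^esub>l\<in>\<Lambda>. \<kappa> (c1 l) \<odot>\<^sub>T vv l \<oplus>\<^sub>T \<kappa> (c2 l) \<odot>\<^sub>T vv l)"
    proof (rule I.T.M.finsum_cong')
      show "(\<lambda>l. \<kappa> (c1 l) \<odot>\<^sub>T vv l \<oplus>\<^sub>T \<kappa> (c2 l) \<odot>\<^sub>T vv l) \<in> \<Lambda> \<rightarrow> carrier T"
        using term_closed c by auto
      fix l assume l: "l \<in> \<Lambda>"
      then have cl: "c1 l \<in> carrier K" "c2 l \<in> carrier K" using c by auto
      show "\<kappa> (c1 l \<oplus>\<^bsub>K\<^esub> c2 l) \<odot>\<^sub>T vv l = \<kappa> (c1 l) \<odot>\<^sub>T vv l \<oplus>\<^sub>T \<kappa> (c2 l) \<odot>\<^sub>T vv l"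
        unfolding ring_hom_add[OF kappa_hom cl]
        by (rule I.T.smult_l_distr[OF kappa_closed(1)[OF cl(1)] kappa_closed(1)[OF cl(2)]]) (use l in simp)
    qed simp
    also have "\<dots> = comb c1 \<oplus>\<^sub>T comb c2"
      using term_closed c by (intro I.T.M.finsum_addf) auto
    finally show "comb c1 \<oplus>\<^sub>T comb c2 = comb (\<lambda>l. c1 l \<oplus>\<^bsub>K\<^esub> c2 l)" by simp
  qed
  have base: "\<exists>c \<in> \<Lambda> \<rightarrow> carrier K. I.pure a v = comb c" if "a \<in> carrier A" for a
    using that
  proof (induction rule: S.skew_induct)
    case (mon r g)
    let ?l = "coset_rep G N \<Lambda> g"
    let ?b = "S.mon (act (inv ?l) r) (inv ?l \<otimes> g)"
    note l = coset_rep[OF mon(2)]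
    have lG: "?l \<in> carrier G" using l(1) by simp
    have b: "?b \<in> carrier B" using l(2) lG mon by simp
    have "I.pure (S.mon r g) v = \<kappa> (weight ?b) \<odot>\<^sub>T vv ?l"
      unfolding mon_factor[OF mon lG] vv_def by (rule pure_B[OF _ b]) (use lG in simp)
    also have "\<dots> = comb (\<lambda>l'. if l' = ?l then weight ?b else \<zero>\<^sub>K)"
      using comb_single[OF l(1) weight(1)[OF b]] by simp
    finally show ?case using weight(1)[OF b] by (intro bexI) auto
  next
    case (add a b)
    then obtain c1 c2 where "c1 \<in> \<Lambda> \<rightarrow> carrier K" "I.pure a v = comb c1" "c2 \<in> \<Lambda> \<rightarrow> carrier K" "I.pure b v = comb c2"
      by (elim bexE)
    then show ?case using I.pure_add_left[OF add(1,2) v_in] comb_add[of c1 c2] by simp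
  qed
  from assms show ?thesis
  proof (induction rule: I.tensor_induct)
    case (pure a u)
    then obtain c where c: "c \<in> carrier K" "u = \<kappa> c \<odot>\<^sub>V v" using V_eq by auto
    have "I.pure a u = I.pure (a \<otimes>\<^sub>A \<kappa> c) v"
      unfolding c(2) by (rule I.pure_balanced[symmetric, OF pure(1) kappa_closed(2)[OF c(1)] v_in])
    then show ?case using base[OF A.m_closed[OF pure(1) kappa_closed(1)[OF c(1)]]] by simp
  next
    case (add x y)
    then obtain c1 c2 where "c1 \<in> \<Lambda> \<rightarrow> carrier K" "x = comb c1" "c2 \<in> \<Lambda> \<rightarrow> carrier K" "y = comb c2"
      by (elim bexE)
    then show ?case using comb_add[of c1 c2] by simp
  qed
qed

text \<open>
  The right \<open>B\<close>-linearity of \<open>proj\<close> is the balancedness of \<open>(a, u) \<mapsto> proj(a) u\<close>.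
\<close>

lemma projection_hom:
  "\<exists>F \<in> carrier T \<rightarrow> carrier V.
     (\<forall>s\<in>carrier T. \<forall>t\<in>carrier T. F (s \<oplus>\<^sub>T t) = F s \<oplus>\<^bsub>V\<^esub> F t) \<and>
     (\<forall>a\<in>carrier A. F (I.pure a v) = proj a \<odot>\<^sub>V v)"
proof (rule I.tensor_universal[of V "\<lambda>a u. proj a \<odot>\<^sub>V u"])
  show "abelian_group V" by (rule V.M.abelian_group_axioms)
  fix a assume a: "a \<in> carrier A"
  fix u assume u: "u \<in> carrier V"
  show "proj a \<odot>\<^sub>V u \<in> carrier V" by (rule V.smult_closed[OF proj_closed[OF a] u])
  show "proj (a \<oplus>\<^sub>A a') \<odot>\<^sub>V u = proj a \<odot>\<^sub>V u \<oplus>\<^bsub>V\<^esub> proj a' \<odot>\<^sub>V u" if "a' \<in> carrier A" for a'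
    using V.smult_l_distr[OF proj_closed[OF a] proj_closed[OF that] u] by (simp add: proj_add)
  show "proj a \<odot>\<^sub>V (u \<oplus>\<^bsub>V\<^esub> u') = proj a \<odot>\<^sub>V u \<oplus>\<^bsub>V\<^esub> proj a \<odot>\<^sub>V u'" if "u' \<in> carrier V" for u'
    by (rule V.smult_r_distr[OF proj_closed[OF a] u that])
  show "proj (a \<otimes>\<^sub>A b) \<odot>\<^sub>V u = proj a \<odot>\<^sub>V (b \<odot>\<^sub>V u)" if "b \<in> carrier B" for b
    using V.smult_assoc1[OF proj_closed[OF a] that u] proj_mult[OF a that] by simp
next
  fix F assume "F \<in> carrier T \<rightarrow> carrier V"
    "\<And>s t. \<lbrakk>s \<in> carrier T; t \<in> carrier T\<rbrakk> \<Longrightarrow> F (s \<oplus>\<^sub>T t) = F s \<oplus>\<^bsub>V\<^esub> F t"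
    "\<And>a u. \<lbrakk>a \<in> carrier A; u \<in> carrier V\<rbrakk> \<Longrightarrow> F (I.pure a u) = proj a \<odot>\<^sub>V u"
  then show ?thesis using v_in by (intro bexI[of _ F]) simp_all
qed

text \<open>
  The functional is \<open>t \<mapsto> F(l\<^sup>-\<^sup>1 t)\<close> with the map \<open>F\<close> induced by \<open>proj\<close>: it sends \<open>v\<^bsub>l'\<^esub>\<close> to \<open>proj(l\<^sup>-\<^sup>1 l') v\<close>, and \<open>l\<^sup>-\<^sup>1 l'\<close> lies in
  \<open>N\<close> only for \<open>l' = l\<close>.
\<close>

lemma coordinate:
  assumes l: "l \<in> \<Lambda>"
  shows "\<exists>F \<in> carrier T \<rightarrow> carrier V.
     (\<forall>s\<in>carrier T. \<forall>t\<in>carrier T. F (s \<oplus>\<^sub>T t) = F s \<oplus>\<^bsub>V\<^esub> F t) \<and>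
     (\<forall>c\<in>carrier K. \<forall>l'\<in>\<Lambda>. F (\<kappa> c \<odot>\<^sub>T vv l') = (if l' = l then \<kappa> c \<odot>\<^sub>V v else \<zero>\<^sub>V))"
proof -
  obtain F where F: "F \<in> carrier T \<rightarrow> carrier V"
    and F_add: "\<forall>s\<in>carrier T. \<forall>t\<in>carrier T. F (s \<oplus>\<^sub>T t) = F s \<oplus>\<^bsub>V\<^esub> F t"
    and F_pure: "\<forall>a\<in>carrier A. F (I.pure a v) = proj a \<odot>\<^sub>V v"
    using projection_hom by blast
  have li: "inv l \<in> carrier G" using l by simp
  have gl: "gg (inv l) \<in> carrier A" using l by simp
  show ?thesis
  proof (intro bexI[of _ "\<lambda>t. F (gg (inv l) \<odot>\<^sub>T t)"] conjI ballI)
    show "(\<lambda>t. F (gg (inv l) \<odot>\<^sub>T t)) \<in> carrier T \<rightarrow> carrier V" using F I.T.smult_closed[OF gl] by auto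
    show "F (gg (inv l) \<odot>\<^sub>T (s \<oplus>\<^sub>T t)) = F (gg (inv l) \<odot>\<^sub>T s) \<oplus>\<^bsub>V\<^esub> F (gg (inv l) \<odot>\<^sub>T t)"
      if "s \<in> carrier T" "t \<in> carrier T" for s t
      using I.T.smult_r_distr[OF gl that] F_add I.T.smult_closed[OF gl] that by simp
    fix c l' assume c: "c \<in> carrier K" and l': "l' \<in> \<Lambda>"
    have g: "inv l \<otimes> l' \<in> carrier G" using l l' by simp
    have "gg (inv l) \<odot>\<^sub>T (\<kappa> c \<odot>\<^sub>T vv l') = \<kappa> c \<odot>\<^sub>T (gg (inv l) \<odot>\<^sub>T vv l')"
      using I.T.smult_assoc1[OF gl kappa_closed(1)[OF c], of "vv l'"]
        I.T.smult_assoc1[OF kappa_closed(1)[OF c] gl, of "vv l'"] kappa_central[OF c gl] l' by simp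
    also have "\<dots> = \<kappa> c \<odot>\<^sub>T vv (inv l \<otimes> l')" using gg_vv[OF li, of l'] l' by simp
    also have "\<dots> = I.pure (S.mon (c \<odot>\<^bsub>R\<^esub> \<one>\<^bsub>R\<^esub>) (inv l \<otimes> l')) v"
      unfolding vv_def kappa_mon[OF c R.one_closed g, symmetric]
      by (rule I.smult_pure[OF kappa_closed(1)[OF c] _ v_in]) (use g in simp)
    finally have eq: "F (gg (inv l) \<odot>\<^sub>T (\<kappa> c \<odot>\<^sub>T vv l')) =
        proj (S.mon (c \<odot>\<^bsub>R\<^esub> \<one>\<^bsub>R\<^esub>) (inv l \<otimes> l')) \<odot>\<^sub>V v"
      using F_pure c g by simp
    show "F (gg (inv l) \<odot>\<^sub>T (\<kappa> c \<odot>\<^sub>T vv l')) = (if l' = l then \<kappa> c \<odot>\<^sub>V v else \<zero>\<^sub>V)"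
    proof (cases "l' = l")
      case True
      then show ?thesis using eq l N_closed(1) by (simp add: proj_mon)
    next
      case False
      then have "inv l \<otimes> l' \<notin> N" using Lambda_unique[OF l l'] by blast
      then show ?thesis using eq False V.smult_l_zero[OF v_in] by (simp add: proj_mon)
    qed
  qed
qed

lemma independent:
  assumes c: "c \<in> \<Lambda> \<rightarrow> carrier K" and zero: "comb c = \<zero>\<^sub>T" and l: "l \<in> \<Lambda>"
  shows "c l = \<zero>\<^sub>K"
proof -
  obtain F where F: "F \<in> carrier T \<rightarrow> carrier V"
    and F_add: "\<And>s t. \<lbrakk>s \<in> carrier T; t \<in> carrier T\<rbrakk> \<Longrightarrow> F (s \<oplus>\<^sub>T t) = F s \<oplus>\<^bsub>V\<^esub> F t"
    and F_vv: "\<forall>c\<in>carrier K. \<forall>l'\<in>\<Lambda>. F (\<kappa> c \<odot>\<^sub>T vv l') = (if l' = l then \<kappa> c \<odot>\<^sub>V v else \<zero>\<^sub>V)"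
    using coordinate[OF l] by (elim bexE conjE) simp
  have cK: "c l' \<in> carrier K" if "l' \<in> \<Lambda>" for l' using c that by auto
  have cv: "\<kappa> (c l) \<odot>\<^sub>V v \<in> carrier V" by (rule V.smult_closed[OF kappa_closed(2)[OF cK[OF l]] v_in])
  have "F (\<zero>\<^sub>T \<oplus>\<^sub>T \<zero>\<^sub>T) = F \<zero>\<^sub>T \<oplus>\<^bsub>V\<^esub> F \<zero>\<^sub>T" by (rule F_add) simp_all
  moreover have "F \<zero>\<^sub>T \<in> carrier V" using F by auto
  ultimately have "F \<zero>\<^sub>T = \<zero>\<^sub>V" by (simp add: V.M.add.l_cancel_one')
  moreover have "F (comb c) = (\<Oplus>\<^bsub>V\<^esub>l'\<in>\<Lambda>. F (\<kappa> (c l') \<odot>\<^sub>T vv l'))"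
    using term_closed[OF c]
    by (intro finsum_additive_image[OF I.T.M.abelian_group_axioms V.M.abelian_group_axioms F F_add finite_Lambda]) auto
  moreover have "\<dots> = (\<Oplus>\<^bsub>V\<^esub>l'\<in>\<Lambda>. if l = l' then \<kappa> (c l) \<odot>\<^sub>V v else \<zero>\<^sub>V)"
    using F_vv cK cv by (intro V.M.finsum_cong') auto
  moreover have "\<dots> = \<kappa> (c l) \<odot>\<^sub>V v"
    using finite_Lambda l cv by (intro V.M.finsum_singleton) auto
  ultimately have "\<kappa> (c l) \<odot>\<^sub>V v = \<zero>\<^sub>V" using zero by simp
  then show ?thesis using kappa_v_zero[OF cK[OF l]] by simp
qed

lemma vv_inj: "inj_on vv \<Lambda>"
proof (rule inj_onI, rule ccontr)
  fix l l' assume l: "l \<in> \<Lambda>" "l' \<in> \<Lambda>" "vv l = vv l'" "l \<noteq> l'"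
  obtain F where F_vv: "\<forall>c\<in>carrier K. \<forall>l'\<in>\<Lambda>. F (\<kappa> c \<odot>\<^sub>T vv l') = (if l' = l then \<kappa> c \<odot>\<^sub>V v else \<zero>\<^sub>V)"
    using coordinate[OF l(1)] by blast
  have "F (\<kappa> \<one>\<^sub>K \<odot>\<^sub>T vv l) = \<kappa> \<one>\<^sub>K \<odot>\<^sub>V v" "F (\<kappa> \<one>\<^sub>K \<odot>\<^sub>T vv l') = \<zero>\<^sub>V"
    using bspec[OF bspec[OF F_vv K.one_closed] l(1)] bspec[OF bspec[OF F_vv K.one_closed] l(2)] l(4) by simp_all
  then have "\<kappa> \<one>\<^sub>K \<odot>\<^sub>V v = \<zero>\<^sub>V" using l(3) by simp
  then show False using kappa_v_zero[of "\<one>\<^sub>K"] by simp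
qed

lemma Lambda_nonempty: "\<Lambda> \<noteq> {}"
  using coset_rep(1)[OF G.one_closed] by blast

text \<open>
  The operator is a product of factors \<open>x\<^sub>i - c\<close>, one for each \<open>s \<in> S\<close>, in which \<open>c\<close> is the eigenvalue of \<open>x\<^sub>i\<close> at \<open>v\<^sub>s\<close> and
  \<open>i\<close> is chosen so that the eigenvalue at \<open>v\<^sub>l\<close> differs from \<open>c\<close>.
\<close>

lemma isolating_operator:
  assumes l: "l \<in> \<Lambda>" and S: "finite S" "S \<subseteq> \<Lambda>" "l \<notin> S"
  shows "\<exists>b \<in> carrier A. \<exists>e \<in> carrier K. e \<noteq> \<zero>\<^sub>K \<and> b \<odot>\<^sub>T vv l = \<kappa> e \<odot>\<^sub>T vv l \<and> (\<forall>s\<in>S. b \<odot>\<^sub>T vv s = \<zero>\<^sub>T)"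
  using S
proof (induction S rule: finite_induct)
  case empty
  show ?case
    by (rule bexI[of _ "\<one>\<^bsub>A\<^esub>"], rule bexI[of _ "\<one>\<^sub>K"]) (use ring_hom_one[OF kappa_hom] in simp_all)
next
  case (insert s S)
  then obtain b e where b: "b \<in> carrier A" and e: "e \<in> carrier K" "e \<noteq> \<zero>\<^sub>K"
    and bl: "b \<odot>\<^sub>T vv l = \<kappa> e \<odot>\<^sub>T vv l" and bS: "\<forall>s\<in>S. b \<odot>\<^sub>T vv s = \<zero>\<^sub>T" by auto
  have s: "s \<in> \<Lambda>" "s \<noteq> l" using insert.prems by auto
  then have "l \<otimes> inv s \<notin> N" using Lambda_unique[OF s(1) l] l by (auto simp: G.m_comm)
  then obtain i where i: "i \<in> {1..n}" "\<chi> i l \<noteq> \<chi> i s" using separating_character[of l s] l s by auto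
  note k = kk_nonzero[OF i(1)]
  \<comment> \<open>The eigenvalue of \<open>x\<^sub>i\<close> at \<open>v\<^sub>g\<close>; it separates \<open>l\<close> from \<open>s\<close> because \<open>k\<^sub>i\<close> is not zero.\<close>
  define m where "m g = \<chi> i g \<otimes>\<^sub>K kk i" for g
  have m: "m g \<in> carrier K" if "g \<in> \<Lambda>" for g using chi_props(1)[OF i(1)] k that by (simp add: m_def)
  have ml: "m l \<ominus>\<^bsub>K\<^esub> m s \<noteq> \<zero>\<^sub>K"
  proof
    assume "m l \<ominus>\<^bsub>K\<^esub> m s = \<zero>\<^sub>K"
    then have "m l = m s" using m l s by simp
    then show False
      using i(2) K.m_rcancel[of "kk i" "\<chi> i l" "\<chi> i s"] k chi_props(1)[OF i(1)] l s unfolding m_def by auto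
  qed
  let ?y = "xx i \<oplus>\<^sub>A \<kappa> (\<ominus>\<^bsub>K\<^esub> m s)"
  have ms: "\<ominus>\<^bsub>K\<^esub> m s \<in> carrier K" using m s by simp
  have yA: "?y \<in> carrier A" using i ms by (intro A.a_closed kappa_closed(1) xx_A)
  have y: "?y \<odot>\<^sub>T vv g = \<kappa> (m g \<ominus>\<^bsub>K\<^esub> m s) \<odot>\<^sub>T vv g" if g: "g \<in> \<Lambda>" for g
  proof -
    have "?y \<odot>\<^sub>T vv g = xx i \<odot>\<^sub>T vv g \<oplus>\<^sub>T \<kappa> (\<ominus>\<^bsub>K\<^esub> m s) \<odot>\<^sub>T vv g"
      by (rule I.T.smult_l_distr[OF xx_A[OF i(1)] kappa_closed(1)[OF ms]]) (use g in simp)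
    also have "xx i \<odot>\<^sub>T vv g = \<kappa> (m g) \<odot>\<^sub>T vv g" unfolding m_def by (rule xx_vv[OF i(1)]) (use g in simp)
    also have "\<kappa> (m g) \<odot>\<^sub>T vv g \<oplus>\<^sub>T \<kappa> (\<ominus>\<^bsub>K\<^esub> m s) \<odot>\<^sub>T vv g = (\<kappa> (m g) \<oplus>\<^sub>A \<kappa> (\<ominus>\<^bsub>K\<^esub> m s)) \<odot>\<^sub>T vv g"
      by (rule I.T.smult_l_distr[symmetric, OF kappa_closed(1)[OF m[OF g]] kappa_closed(1)[OF ms]]) (use g in simp)
    also have "\<kappa> (m g) \<oplus>\<^sub>A \<kappa> (\<ominus>\<^bsub>K\<^esub> m s) = \<kappa> (m g \<ominus>\<^bsub>K\<^esub> m s)"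
      unfolding K.minus_eq by (rule ring_hom_add[symmetric, OF kappa_hom m[OF g] ms])
    finally show ?thesis .
  qed
  have by': "(b \<otimes>\<^sub>A ?y) \<odot>\<^sub>T vv g = \<kappa> (m g \<ominus>\<^bsub>K\<^esub> m s) \<odot>\<^sub>T (b \<odot>\<^sub>T vv g)" if g: "g \<in> \<Lambda>" for g
  proof -
    have mm: "m g \<ominus>\<^bsub>K\<^esub> m s \<in> carrier K" using m g s by simp
    have vg: "vv g \<in> carrier T" using g by simp
    have "(b \<otimes>\<^sub>A ?y) \<odot>\<^sub>T vv g = b \<odot>\<^sub>T (\<kappa> (m g \<ominus>\<^bsub>K\<^esub> m s) \<odot>\<^sub>T vv g)"
      unfolding I.T.smult_assoc1[OF b yA vg] y[OF g] ..
    also have "\<dots> = \<kappa> (m g \<ominus>\<^bsub>K\<^esub> m s) \<odot>\<^sub>T (b \<odot>\<^sub>T vv g)"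
      unfolding I.T.smult_assoc1[OF b kappa_closed(1)[OF mm] vg, symmetric] kappa_central[OF mm b, symmetric]
      by (rule I.T.smult_assoc1[OF kappa_closed(1)[OF mm] b vg])
    finally show ?thesis .
  qed
  show ?case
  proof (intro bexI conjI ballI)
    show "b \<otimes>\<^sub>A ?y \<in> carrier A" by (rule A.m_closed[OF b yA])
    have mls: "m l \<ominus>\<^bsub>K\<^esub> m s \<in> carrier K" using m l s by simp
    show "(m l \<ominus>\<^bsub>K\<^esub> m s) \<otimes>\<^sub>K e \<in> carrier K" using mls e by simp
    show "(m l \<ominus>\<^bsub>K\<^esub> m s) \<otimes>\<^sub>K e \<noteq> \<zero>\<^sub>K" using ml mls e K.integral_iff by simp
    show "(b \<otimes>\<^sub>A ?y) \<odot>\<^sub>T vv l = \<kappa> ((m l \<ominus>\<^bsub>K\<^esub> m s) \<otimes>\<^sub>K e) \<odot>\<^sub>T vv l"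
      unfolding by'[OF l] bl by (rule kappa_mult_T[symmetric, OF mls e(1)]) (use l in simp)
    fix s' assume "s' \<in> insert s S"
    then consider "s' = s" | "s' \<in> S" "s' \<in> \<Lambda>" using insert.prems by auto
    then show "(b \<otimes>\<^sub>A ?y) \<odot>\<^sub>T vv s' = \<zero>\<^sub>T"
    proof cases
      case 1
      have "m s \<ominus>\<^bsub>K\<^esub> m s = \<zero>\<^sub>K" using m[OF s(1)] by simp
      moreover have "b \<odot>\<^sub>T vv s \<in> carrier T" by (rule I.T.smult_closed[OF b]) (use s in simp)
      ultimately show ?thesis unfolding 1 by'[OF s(1)] using kappa_zero_T by simp
    next
      case 2
      have "m s' \<ominus>\<^bsub>K\<^esub> m s \<in> carrier K" using m 2 s by simp
      from kappa_closed(1)[OF this] show ?thesis unfolding by'[OF 2(2)] using bS 2(1) by simp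
    qed
  qed
qed

text \<open>
  An isolating operator turns a nonzero element of a submodule into a nonzero multiple of some \<open>v\<^sub>l\<close>. The group elements
  \<open>g l\<^sup>-\<^sup>1\<close> then carry \<open>v\<^sub>l\<close> to all the other basis vectors.
\<close>

theorem induced_simple: "simple_module A T"
  unfolding simple_module_def
proof (intro conjI allI impI)
  show "left_module A T" by (rule I.left_module_T)
  obtain l0 where l0: "l0 \<in> \<Lambda>" using Lambda_nonempty by blast
  have vv_nonzero: "vv l0 \<noteq> \<zero>\<^sub>T"
  proof
    assume z: "vv l0 = \<zero>\<^sub>T"
    have one: "(\<lambda>l. if l = l0 then \<one>\<^sub>K else \<zero>\<^sub>K) \<in> \<Lambda> \<rightarrow> carrier K" by auto
    have "comb (\<lambda>l. if l = l0 then \<one>\<^sub>K else \<zero>\<^sub>K) = \<zero>\<^sub>T"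
      unfolding comb_single[OF l0 K.one_closed] z by (rule I.T.smult_r_zero[OF kappa_closed(1)[OF K.one_closed]])
    from independent[OF one this l0] show False by simp
  qed
  then show "carrier T \<noteq> {\<zero>\<^sub>T}" using vv_closed l0 by (metis Lambda_G singletonD)
  fix H assume "Module.submodule H A T"
  note H = I.T.left_submoduleD[OF this]
  show "H = {\<zero>\<^sub>T} \<or> H = carrier T"
  proof (cases "H \<subseteq> {\<zero>\<^sub>T}")
    case True
    then show ?thesis using H(2) by blast
  next
    case False
    then obtain z where z: "z \<in> H" "z \<noteq> \<zero>\<^sub>T" by blast
    obtain c where c: "c \<in> \<Lambda> \<rightarrow> carrier K" "z = comb c" using spanning H(1) z(1) by blast
    have cK: "c l \<in> carrier K" if "l \<in> \<Lambda>" for l using c that by auto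
    have "\<exists>l \<in> \<Lambda>. c l \<noteq> \<zero>\<^sub>K"
    proof (rule ccontr)
      assume "\<not> (\<exists>l \<in> \<Lambda>. c l \<noteq> \<zero>\<^sub>K)"
      then have "comb c = (\<Oplus>\<^bsub>T\<^esub>l\<in>\<Lambda>. \<zero>\<^sub>T)" by (intro I.T.M.finsum_cong') simp_all
      then show False using z(2) c(2) by simp
    qed
    then obtain l where l: "l \<in> \<Lambda>" "c l \<noteq> \<zero>\<^sub>K" by blast
    obtain b e where b: "b \<in> carrier A" and e: "e \<in> carrier K" "e \<noteq> \<zero>\<^sub>K"
      and bl: "b \<odot>\<^sub>T vv l = \<kappa> e \<odot>\<^sub>T vv l" and bS: "\<forall>s\<in>\<Lambda> - {l}. b \<odot>\<^sub>T vv s = \<zero>\<^sub>T"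
      using isolating_operator[OF l(1), of "\<Lambda> - {l}"] finite_Lambda by auto
    have bt: "b \<odot>\<^sub>T (\<kappa> (c s) \<odot>\<^sub>T vv s) = \<kappa> (c s) \<odot>\<^sub>T (b \<odot>\<^sub>T vv s)" if s: "s \<in> \<Lambda>" for s
      using I.T.smult_assoc1[OF b kappa_closed(1)[OF cK[OF s]], of "vv s"]
        I.T.smult_assoc1[OF kappa_closed(1)[OF cK[OF s]] b, of "vv s"] kappa_central[OF cK[OF s] b] s by simp
    let ?w = "\<kappa> (c l \<otimes>\<^sub>K e) \<odot>\<^sub>T vv l"
    have ce: "c l \<otimes>\<^sub>K e \<in> carrier K" "c l \<otimes>\<^sub>K e \<noteq> \<zero>\<^sub>K" using cK l e K.integral_iff by auto
    have w: "?w \<in> carrier T" by (rule I.T.smult_closed[OF kappa_closed(1)[OF ce(1)]]) (use l in simp)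
    have "b \<odot>\<^sub>T z = (\<Oplus>\<^bsub>T\<^esub>s\<in>\<Lambda>. b \<odot>\<^sub>T (\<kappa> (c s) \<odot>\<^sub>T vv s))"
      unfolding c(2) using term_closed[OF c(1)] by (intro I.T.smult_finsum[OF finite_Lambda b]) auto
    also have "\<dots> = (\<Oplus>\<^bsub>T\<^esub>s\<in>\<Lambda>. if l = s then ?w else \<zero>\<^sub>T)"
    proof (rule I.T.M.finsum_cong')
      fix s assume s: "s \<in> \<Lambda>"
      show "b \<odot>\<^sub>T (\<kappa> (c s) \<odot>\<^sub>T vv s) = (if l = s then ?w else \<zero>\<^sub>T)"
      proof (cases "l = s")
        case True
        then show ?thesis unfolding bt[OF s] using bl kappa_mult_T[OF cK[OF s] e(1), of "vv s"] s by simp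
      next
        case False
        then show ?thesis unfolding bt[OF s] using bS s kappa_closed(1)[OF cK[OF s]] by simp
      qed
    qed (use w in auto)
    also have "\<dots> = ?w" using finite_Lambda l(1) w by (intro I.T.M.finsum_singleton) auto
    finally have "?w \<in> H" using H(5)[OF b z(1)] by simp
    moreover have inv: "inv\<^bsub>K\<^esub> (c l \<otimes>\<^sub>K e) \<in> carrier K" "inv\<^bsub>K\<^esub> (c l \<otimes>\<^sub>K e) \<otimes>\<^sub>K (c l \<otimes>\<^sub>K e) = \<one>\<^sub>K"
      using ce K.field_Units by (auto intro!: K.Units_l_inv)
    ultimately have "\<kappa> (inv\<^bsub>K\<^esub> (c l \<otimes>\<^sub>K e)) \<odot>\<^sub>T ?w \<in> H" using H(5)[OF kappa_closed(1)] by blast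
    then have vl: "vv l \<in> H"
      using kappa_mult_T[OF inv(1) ce(1), of "vv l"] l(1) inv(2) ring_hom_one[OF kappa_hom] I.T.smult_one by simp
    have vg: "vv g \<in> H" if g: "g \<in> \<Lambda>" for g
    proof -
      have "gg (g \<otimes> inv l) \<odot>\<^sub>T vv l = vv g" using gg_vv[of "g \<otimes> inv l" l] l(1) g by (simp add: G.m_assoc)
      moreover have "gg (g \<otimes> inv l) \<in> carrier A" using g l by simp
      ultimately show ?thesis using H(5) vl by metis
    qed
    have sum: "(\<Oplus>\<^bsub>T\<^esub>s\<in>F. \<kappa> (d s) \<odot>\<^sub>T vv s) \<in> H" if "finite F" "F \<subseteq> \<Lambda>" "d \<in> \<Lambda> \<rightarrow> carrier K" for F d
      using that
    proof (induction F rule: finite_induct)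
      case empty
      then show ?case using H(2) by simp
    next
      case (insert s F)
      have d: "d s \<in> carrier K" "s \<in> \<Lambda>" using insert.prems by auto
      have "(\<lambda>s. \<kappa> (d s) \<odot>\<^sub>T vv s) \<in> F \<rightarrow> carrier T" "\<kappa> (d s) \<odot>\<^sub>T vv s \<in> carrier T"
        using term_closed[OF insert.prems(2)] insert.prems by auto
      then show ?case using insert H(3)[OF H(5)[OF kappa_closed(1)[OF d(1)] vg[OF d(2)]]] by simp
    qed
    have "carrier T \<subseteq> H"
    proof
      fix t assume "t \<in> carrier T"
      then obtain d where "d \<in> \<Lambda> \<rightarrow> carrier K" "t = comb d" using spanning by blast
      then show "t \<in> H" using sum[OF finite_Lambda subset_refl] by simp
    qed
    then show ?thesis using H(1) by blast
  qed
qed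

theorem induced_basis:
  "vectorspace K (restrict_scalars A T)"
  "vectorspace.basis K (restrict_scalars A T) (vv ` \<Lambda>)"
  "vectorspace.fin_dim K (restrict_scalars A T)"
  "vectorspace.dim K (restrict_scalars A T) = order (G Mod N)"
proof -
  let ?T = "restrict_scalars A T"
  show vs: "vectorspace K ?T" by (rule restrict_scalars_vectorspace[OF I.left_module_T])
  interpret W: vectorspace K ?T by (rule vs)
  have car: "carrier ?T = carrier T" "\<zero>\<^bsub>?T\<^esub> = \<zero>\<^sub>T" by (simp_all add: restrict_scalars_def)
  have sub: "vv ` \<Lambda> \<subseteq> carrier ?T" using car by auto
  have fin: "finite (vv ` \<Lambda>)" using finite_Lambda by simp
  have lc: "W.lincomb a (vv ` \<Lambda>) = comb (\<lambda>l. a (vv l))" if a: "a \<in> vv ` \<Lambda> \<rightarrow> carrier K" for a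
  proof -
    have "W.lincomb a (vv ` \<Lambda>) = (\<Oplus>\<^bsub>T\<^esub>w\<in>vv ` \<Lambda>. a w \<odot>\<^bsub>?T\<^esub> w)"
      unfolding W.lincomb_def finsum_restrict_scalars ..
    also have "\<dots> = (\<Oplus>\<^bsub>T\<^esub>l\<in>\<Lambda>. a (vv l) \<odot>\<^bsub>?T\<^esub> vv l)"
    proof (rule I.T.M.finsum_reindex[OF _ vv_inj])
      show "(\<lambda>w. a w \<odot>\<^bsub>?T\<^esub> w) \<in> vv ` \<Lambda> \<rightarrow> carrier T"
        unfolding car(1)[symmetric]
      proof
        fix w assume w: "w \<in> vv ` \<Lambda>"
        show "a w \<odot>\<^bsub>?T\<^esub> w \<in> carrier ?T"
          using W.smult_closed[OF funcset_mem[OF a w] subsetD[OF sub w]] .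
      qed
    qed
    also have "\<dots> = comb (\<lambda>l. a (vv l))"
    proof (rule I.T.M.finsum_cong')
      show "(\<lambda>l. \<kappa> (a (vv l)) \<odot>\<^sub>T vv l) \<in> \<Lambda> \<rightarrow> carrier T"
        using term_closed[of "\<lambda>l. a (vv l)"] a by auto
      show "a (vv l) \<odot>\<^bsub>?T\<^esub> vv l = \<kappa> (a (vv l)) \<odot>\<^sub>T vv l" if "l \<in> \<Lambda>" for l
        by (rule restrict_scalars_smult(1)[OF funcset_mem[OF a imageI[OF that]]])
    qed simp
    finally show ?thesis .
  qed
  have li: "W.lin_indpt (vv ` \<Lambda>)"
  proof (rule W.finite_lin_indpt2[OF fin sub])
    fix a assume a: "a \<in> vv ` \<Lambda> \<rightarrow> carrier K" and "W.lincomb a (vv ` \<Lambda>) = \<zero>\<^bsub>?T\<^esub>"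
    then have z: "comb (\<lambda>l. a (vv l)) = \<zero>\<^sub>T" using lc car by simp
    have "(\<lambda>l. a (vv l)) \<in> \<Lambda> \<rightarrow> carrier K" using a by auto
    from independent[OF this z] show "\<forall>w\<in>vv ` \<Lambda>. a w = \<zero>\<^sub>K" by blast
  qed
  have gen: "W.gen_set (vv ` \<Lambda>)"
  proof
    show "W.span (vv ` \<Lambda>) \<subseteq> carrier ?T" using W.span_is_subset2[OF sub] .
    show "carrier ?T \<subseteq> W.span (vv ` \<Lambda>)"
    proof
      fix t assume "t \<in> carrier ?T"
      then obtain c where c: "c \<in> \<Lambda> \<rightarrow> carrier K" "t = comb c" using spanning car by auto
      let ?a = "\<lambda>w. c (the_inv_into \<Lambda> vv w)"
      have a: "?a \<in> vv ` \<Lambda> \<rightarrow> carrier K" using c(1) the_inv_into_f_f[OF vv_inj] by auto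
      have "comb (\<lambda>l. ?a (vv l)) = comb c"
        using term_closed[OF c(1)] the_inv_into_f_f[OF vv_inj] by (intro I.T.M.finsum_cong') auto
      then have "t = W.lincomb ?a (vv ` \<Lambda>)" using lc[OF a] c(2) by simp
      then show "t \<in> W.span (vv ` \<Lambda>)" unfolding W.finite_span[OF fin sub] using a by blast
    qed
  qed
  show basis: "W.basis (vv ` \<Lambda>)" unfolding W.basis_def using li gen sub by blast
  show "W.fin_dim" unfolding W.fin_dim_def using fin sub gen by blast
  show "W.dim = order (G Mod N)"
    using W.dim_basis[OF fin basis] card_image[OF vv_inj] card_Lambda by simp
qed

end


section \<open>Homomorphisms and submodules\<close>

text \<open>
  Schur's lemma: the kernel and the image of a nonzero homomorphism between simple modules are trivial submodules.
\<close>

lemma simple_modules_isomorphic: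
  assumes M: "simple_module A M" and M': "simple_module A M'"
    and h: "h \<in> module_hom A M' M" and t: "t \<in> carrier M'" "h t \<noteq> \<zero>\<^bsub>M\<^esub>"
  shows "isomorphic_modules A M M'"
proof -
  interpret M: left_module A M using M unfolding simple_module_def by blast
  interpret M': left_module A M' using M' unfolding simple_module_def by blast
  have hc: "h x \<in> carrier M" if "x \<in> carrier M'" for x using module_hom_closed[OF h] that by auto
  note ha = module_hom_add[OF h] and hs = module_hom_smult[OF h]
  have zero: "h \<zero>\<^bsub>M'\<^esub> = \<zero>\<^bsub>M\<^esub>"
    using hs[OF M.A.zero_closed M'.M.zero_closed] hc[OF M'.M.zero_closed] by simp
  have "Module.submodule {x \<in> carrier M'. h x = \<zero>\<^bsub>M\<^esub>} A M'"
    by (rule M'.left_submoduleI) (use zero ha hs M'.smult_closed in auto)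
  then have "{x \<in> carrier M'. h x = \<zero>\<^bsub>M\<^esub>} = {\<zero>\<^bsub>M'\<^esub>} \<or> {x \<in> carrier M'. h x = \<zero>\<^bsub>M\<^esub>} = carrier M'"
    using M' unfolding simple_module_def by blast
  then have ker: "x = \<zero>\<^bsub>M'\<^esub>" if "x \<in> carrier M'" "h x = \<zero>\<^bsub>M\<^esub>" for x using t that by blast
  have minus: "h (\<ominus>\<^bsub>M'\<^esub> x) = \<ominus>\<^bsub>M\<^esub> h x" if x: "x \<in> carrier M'" for x
  proof (rule M.M.minus_equality[symmetric])
    show "h (\<ominus>\<^bsub>M'\<^esub> x) \<oplus>\<^bsub>M\<^esub> h x = \<zero>\<^bsub>M\<^esub>"
      using ha[of "\<ominus>\<^bsub>M'\<^esub> x" x] x zero by (simp add: M'.M.l_neg)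
  qed (use hc x in auto)
  have inj: "inj_on h (carrier M')"
  proof (rule inj_onI)
    fix x y assume xy: "x \<in> carrier M'" "y \<in> carrier M'" "h x = h y"
    have "h (x \<ominus>\<^bsub>M'\<^esub> y) = h x \<oplus>\<^bsub>M\<^esub> \<ominus>\<^bsub>M\<^esub> h y"
      unfolding M'.M.minus_eq using ha[of x "\<ominus>\<^bsub>M'\<^esub> y"] minus xy by simp
    then have "h (x \<ominus>\<^bsub>M'\<^esub> y) = \<zero>\<^bsub>M\<^esub>" using xy hc[OF xy(2)] by (simp add: M.M.r_neg)
    then have "x \<ominus>\<^bsub>M'\<^esub> y = \<zero>\<^bsub>M'\<^esub>" using ker xy by simp
    then show "x = y" using xy by simp
  qed
  have "Module.submodule (h ` carrier M') A M"
  proof (rule M.left_submoduleI)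
    show "h ` carrier M' \<subseteq> carrier M" using hc by blast
    show "\<zero>\<^bsub>M\<^esub> \<in> h ` carrier M'" using zero M'.M.zero_closed by force
    fix x y assume "x \<in> h ` carrier M'" "y \<in> h ` carrier M'"
    then obtain p q where "p \<in> carrier M'" "x = h p" "q \<in> carrier M'" "y = h q" by blast
    then show "x \<oplus>\<^bsub>M\<^esub> y \<in> h ` carrier M'" using ha[of p q] by (intro image_eqI[of _ _ "p \<oplus>\<^bsub>M'\<^esub> q"]) simp_all
  next
    fix a x assume a: "a \<in> carrier A" and "x \<in> h ` carrier M'"
    then obtain p where "p \<in> carrier M'" "x = h p" by blast
    then show "a \<odot>\<^bsub>M\<^esub> x \<in> h ` carrier M'"
      using hs[OF a, of p] M'.smult_closed[OF a] by (intro image_eqI[of _ _ "a \<odot>\<^bsub>M'\<^esub> p"]) simp_all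
  qed
  then have "h ` carrier M' = {\<zero>\<^bsub>M\<^esub>} \<or> h ` carrier M' = carrier M"
    using M unfolding simple_module_def by blast
  then have surj: "h ` carrier M' = carrier M" using t by blast
  let ?i = "inv_into (carrier M') h"
  have hi: "h (?i y) = y" "?i y \<in> carrier M'" if "y \<in> carrier M" for y
    using that surj by (auto intro: f_inv_into_f inv_into_into)
  have "?i \<in> module_hom A M M'"
    unfolding module_hom_def
  proof (intro CollectI conjI allI impI)
    show "?i \<in> carrier M \<rightarrow> carrier M'" using hi by blast
    fix x y assume xy: "x \<in> carrier M \<and> y \<in> carrier M"
    show "?i (x \<oplus>\<^bsub>M\<^esub> y) = ?i x \<oplus>\<^bsub>M'\<^esub> ?i y"
      using ha[of "?i x" "?i y"] hi xy by (intro inv_into_f_eq[OF inj]) simp_all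
  next
    fix a x assume ax: "a \<in> carrier A \<and> x \<in> carrier M"
    show "?i (a \<odot>\<^bsub>M\<^esub> x) = a \<odot>\<^bsub>M'\<^esub> ?i x"
      using hs[of a "?i x"] hi ax M'.smult_closed by (intro inv_into_f_eq[OF inj]) simp_all
  qed
  moreover have "bij_betw ?i (carrier M) (carrier M')"
    using bij_betw_inv_into[of h "carrier M'" "carrier M"] inj surj unfolding bij_betw_def by blast
  ultimately show ?thesis unfolding isomorphic_modules_def by blast
qed

lemma (in left_module) cyclic_submodule:
  assumes m: "m \<in> carrier M"
  shows "Module.submodule {a \<odot>\<^bsub>M\<^esub> m | a. a \<in> carrier A} A M"
proof (rule left_submoduleI)
  show "{a \<odot>\<^bsub>M\<^esub> m | a. a \<in> carrier A} \<subseteq> carrier M" using smult_closed m by auto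
  show "\<zero>\<^bsub>M\<^esub> \<in> {a \<odot>\<^bsub>M\<^esub> m | a. a \<in> carrier A}" using smult_l_zero[OF m] by force
  fix y z assume "y \<in> {a \<odot>\<^bsub>M\<^esub> m | a. a \<in> carrier A}" "z \<in> {a \<odot>\<^bsub>M\<^esub> m | a. a \<in> carrier A}"
  then obtain a b where ab: "a \<in> carrier A" "b \<in> carrier A" "y = a \<odot>\<^bsub>M\<^esub> m" "z = b \<odot>\<^bsub>M\<^esub> m" by blast
  then show "y \<oplus>\<^bsub>M\<^esub> z \<in> {a \<odot>\<^bsub>M\<^esub> m | a. a \<in> carrier A}"
    using smult_l_distr[OF ab(1,2) m] A.a_closed[OF ab(1,2)] by (intro CollectI exI[of _ "a \<oplus> b"]) simp
next
  fix a y assume a: "a \<in> carrier A" and "y \<in> {a \<odot>\<^bsub>M\<^esub> m | a. a \<in> carrier A}"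
  then obtain b where b: "b \<in> carrier A" "y = b \<odot>\<^bsub>M\<^esub> m" by blast
  then show "a \<odot>\<^bsub>M\<^esub> y \<in> {a \<odot>\<^bsub>M\<^esub> m | a. a \<in> carrier A}"
    using smult_assoc1[OF a b(1) m] A.m_closed[OF a b(1)] by (intro CollectI exI[of _ "a \<otimes> b"]) simp
qed

lemma (in left_module) insert_submodule:
  assumes H: "Module.submodule H A M" and m: "m \<in> carrier M"
  shows "Module.submodule {u \<oplus>\<^bsub>M\<^esub> a \<odot>\<^bsub>M\<^esub> m | u a. u \<in> H \<and> a \<in> carrier A} A M" (is "Module.submodule ?S A M")
    and "H \<subseteq> {u \<oplus>\<^bsub>M\<^esub> a \<odot>\<^bsub>M\<^esub> m | u a. u \<in> H \<and> a \<in> carrier A}"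
    and "m \<in> {u \<oplus>\<^bsub>M\<^esub> a \<odot>\<^bsub>M\<^esub> m | u a. u \<in> H \<and> a \<in> carrier A}"
proof -
  note h = left_submoduleD[OF H]
  have hM: "u \<in> carrier M" if "u \<in> H" for u using h(1) that by blast
  show HS: "H \<subseteq> ?S"
  proof
    fix u assume u: "u \<in> H"
    then have "u = u \<oplus>\<^bsub>M\<^esub> \<zero> \<odot>\<^bsub>M\<^esub> m" using hM m by simp
    then show "u \<in> ?S" using u A.zero_closed by blast
  qed
  have "m = \<zero>\<^bsub>M\<^esub> \<oplus>\<^bsub>M\<^esub> \<one> \<odot>\<^bsub>M\<^esub> m" using m smult_one by simp
  then show "m \<in> ?S" using h(2) A.one_closed by blast
  show "Module.submodule ?S A M"
  proof (rule left_submoduleI)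
    show "?S \<subseteq> carrier M" using hM m smult_closed by auto
    show "\<zero>\<^bsub>M\<^esub> \<in> ?S" using HS h(2) by blast
    fix y z assume "y \<in> ?S" "z \<in> ?S"
    then obtain u a u' a' where y: "u \<in> H" "a \<in> carrier A" "y = u \<oplus>\<^bsub>M\<^esub> a \<odot>\<^bsub>M\<^esub> m"
      and z: "u' \<in> H" "a' \<in> carrier A" "z = u' \<oplus>\<^bsub>M\<^esub> a' \<odot>\<^bsub>M\<^esub> m" by blast
    have c: "u \<in> carrier M" "u' \<in> carrier M" "a \<odot>\<^bsub>M\<^esub> m \<in> carrier M" "a' \<odot>\<^bsub>M\<^esub> m \<in> carrier M"
      using y z hM m smult_closed by auto
    have "y \<oplus>\<^bsub>M\<^esub> z = (u \<oplus>\<^bsub>M\<^esub> u') \<oplus>\<^bsub>M\<^esub> (a \<oplus> a') \<odot>\<^bsub>M\<^esub> m"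
      unfolding smult_l_distr[OF y(2) z(2) m] y(3) z(3) using c by (simp add: M.a_ac)
    then show "y \<oplus>\<^bsub>M\<^esub> z \<in> ?S" using h(3)[OF y(1) z(1)] A.a_closed[OF y(2) z(2)] by blast
  next
    fix b y assume b: "b \<in> carrier A" and "y \<in> ?S"
    then obtain u a where y: "u \<in> H" "a \<in> carrier A" "y = u \<oplus>\<^bsub>M\<^esub> a \<odot>\<^bsub>M\<^esub> m" by blast
    have "b \<odot>\<^bsub>M\<^esub> y = b \<odot>\<^bsub>M\<^esub> u \<oplus>\<^bsub>M\<^esub> (b \<otimes> a) \<odot>\<^bsub>M\<^esub> m"
      unfolding y(3) smult_r_distr[OF b hM[OF y(1)] smult_closed[OF y(2) m]] smult_assoc1[OF b y(2) m] ..
    then show "b \<odot>\<^bsub>M\<^esub> y \<in> ?S" using h(5)[OF b y(1)] A.m_closed[OF b y(2)] by blast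
  qed
qed

section \<open>Finite generation of \<open>R[N]\<close>\<close>

context diagonal_action
begin

text \<open>
  Schreier's argument. Let \<open>S\<close> consist of the elements \<open>\<gamma>(l, s)\<close>, for \<open>l \<in> \<Lambda>\<close> and \<open>s\<close> a generator of \<open>G\<close> or the inverse of
  one, and of the representative of \<open>N\<close> itself. If \<open>H\<close> is the subgroup generated by \<open>S\<close>, then \<open>H \<Lambda>\<close> is
  stable under right multiplication by the generators and their inverses, so it is all of \<open>G\<close>. An element of \<open>N\<close> in \<open>h \<Lambda>\<close>
  can only involve the representative of \<open>N\<close>.
\<close>

lemma N_finitely_generated:
  obtains S where "finite S" and "S \<subseteq> N" and "N \<subseteq> generate G S"
proof -
  obtain S0 where S0: "finite S0" "S0 \<subseteq> carrier G" "generate G S0 = carrier G" using G_fin_gen by blast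
  let ?rep = "coset_rep G N \<Lambda>"
  define \<gamma> where "\<gamma> l s = inv (?rep (l \<otimes> s)) \<otimes> (l \<otimes> s)" for l s
  define S1 where "S1 = S0 \<union> (\<lambda>s. inv s) ` S0"
  have S1: "finite S1" "S1 \<subseteq> carrier G" using S0 by (auto simp: S1_def)
  let ?l0 = "?rep \<one>"
  have l0: "?l0 \<in> \<Lambda>" using coset_rep(1) by simp
  have l0N: "?l0 \<in> N"
  proof -
    have "inv ?l0 \<in> N" using coset_rep(2)[OF G.one_closed] l0 by simp
    from N_closed(3)[OF this] show ?thesis using l0 by simp
  qed
  define S where "S = insert ?l0 ((\<lambda>(l, s). \<gamma> l s) ` (\<Lambda> \<times> S1))"
  have fin: "finite S" unfolding S_def using finite_Lambda S1 by simp
  have sub: "S \<subseteq> N"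
    unfolding S_def \<gamma>_def using coset_rep(2) l0N S1 Lambda_G by (auto simp: subset_iff)
  have SG: "S \<subseteq> carrier G" using sub by auto
  interpret H: subgroup "generate G S" G by (rule G.generate_is_subgroup[OF SG])
  have HN: "generate G S \<subseteq> N" using G.generate_subgroup_incl[OF sub N_subgroup] .
  let ?Q = "\<lambda>z. \<exists>h \<in> generate G S. \<exists>l \<in> \<Lambda>. z = h \<otimes> l"
  have step: "?Q (z \<otimes> s)" if z: "?Q z" and s: "s \<in> S1" for z s
  proof -
    obtain h l where h: "h \<in> generate G S" and l: "l \<in> \<Lambda>" and zz: "z = h \<otimes> l" using z by blast
    have sG: "s \<in> carrier G" "l \<in> carrier G" "h \<in> carrier G" using s S1 l h by auto
    have r: "?rep (l \<otimes> s) \<in> \<Lambda>" using coset_rep(1) sG by simp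
    have "\<gamma> l s \<in> generate G S" using l s by (intro generate.incl) (auto simp: S_def)
    moreover have "z \<otimes> s = (h \<otimes> \<gamma> l s) \<otimes> ?rep (l \<otimes> s)"
    proof -
      have "\<gamma> l s \<otimes> ?rep (l \<otimes> s) = l \<otimes> s"
        unfolding \<gamma>_def using sG Lambda_G[OF r] G.m_comm[of "inv (?rep (l \<otimes> s))" "l \<otimes> s"]
        by (simp add: G.m_assoc)
      moreover have "\<gamma> l s \<in> carrier G" unfolding \<gamma>_def using sG Lambda_G[OF r] by simp
      ultimately show ?thesis unfolding zz using sG Lambda_G[OF r] by (simp add: G.m_assoc)
    qed
    ultimately show ?thesis using h r H.m_closed by blast
  qed
  have gen_step: "\<forall>z. z \<in> carrier G \<and> ?Q z \<longrightarrow> ?Q (z \<otimes> y)" if "y \<in> generate G S0" for y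
    using that
  proof (induction rule: generate.induct)
    case one
    then show ?case by simp
  next
    case (incl s)
    then show ?case using step by (simp add: S1_def)
  next
    case (inv s)
    then show ?case using step by (simp add: S1_def)
  next
    case (eng y1 y2)
    have "y1 \<in> carrier G" "y2 \<in> carrier G" using eng.hyps S0(3) by auto
    then show ?case using eng.IH by (simp add: G.m_assoc[symmetric])
  qed
  have Q1: "?Q \<one>"
  proof -
    have "?l0 \<in> generate G S" by (rule generate.incl) (simp add: S_def)
    then have "inv ?l0 \<in> generate G S" by (rule H.m_inv_closed)
    moreover have "\<one> = inv ?l0 \<otimes> ?l0" using Lambda_G[OF l0] by simp
    ultimately show ?thesis using l0 by blast
  qed
  have Q: "?Q y" if y: "y \<in> carrier G" for y
  proof -
    have "y \<in> generate G S0" using y S0(3) by simp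
    then have "?Q (\<one> \<otimes> y)" using gen_step[THEN spec, THEN mp, OF _ conjI[OF G.one_closed Q1]] by simp
    then show ?thesis using y by simp
  qed
  have "N \<subseteq> generate G S"
  proof
    fix y assume y: "y \<in> N"
    then obtain h l where h: "h \<in> generate G S" and l: "l \<in> \<Lambda>" and yl: "y = h \<otimes> l" using Q[of y] by auto
    have hN: "h \<in> N" using h HN by blast
    have "l = inv h \<otimes> y" unfolding yl using hN l by (simp add: G.m_assoc[symmetric])
    then have "l \<in> N" using N_closed hN y by simp
    then have "l = ?l0" using coset_rep(3)[OF G.one_closed l] l by simp
    then have "l \<in> generate G S" by (auto intro!: generate.incl simp: S_def)
    then show "y \<in> generate G S" unfolding yl using h H.m_closed by blast
  qed
  with fin sub that show thesis by blast
qed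

lemma B_finitely_generated:
  obtains U where "finite U" and "U \<subseteq> carrier B" and "carrier B \<subseteq> generate_ring B (\<kappa> ` carrier K \<union> U)"
proof -
  obtain S where S: "finite S" "S \<subseteq> N" "N \<subseteq> generate G S" by (rule N_finitely_generated)
  define U where "U = xx ` {1..n} \<union> gg ` S \<union> (\<lambda>s. gg (inv s)) ` S"
  have U: "finite U" "U \<subseteq> carrier B" unfolding U_def using S N_closed by auto
  let ?E = "generate_ring B (\<kappa> ` carrier K \<union> U)"
  have gens: "\<kappa> ` carrier K \<union> U \<subseteq> carrier B" using U by (auto intro!: kappa_closed(2))
  have E: "\<one>\<^bsub>A\<^esub> \<in> ?E" "\<And>a b. \<lbrakk>a \<in> ?E; b \<in> ?E\<rbrakk> \<Longrightarrow> a \<otimes>\<^sub>A b \<in> ?E" "\<And>a b. \<lbrakk>a \<in> ?E; b \<in> ?E\<rbrakk> \<Longrightarrow> a \<oplus>\<^sub>A b \<in> ?E"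
    using generate_ring.one[of B] generate_ring.eng_mult[of _ B] generate_ring.eng_add[of _ B] by simp_all
  have inE: "u \<in> \<kappa> ` carrier K \<union> U \<Longrightarrow> u \<in> ?E" for u by (rule generate_ring.incl)
  have r: "S.mon r \<one> \<in> ?E" if "r \<in> carrier R" for r
    using that
  proof (induction rule: R_induct)
    case one
    then show ?case using E(1) gg_one by simp
  next
    case (gen i)
    then show ?case by (intro inE) (auto simp: U_def)
  next
    case (scalar c)
    then show ?case by (intro inE) auto
  next
    case (minus r)
    have "\<ominus>\<^bsub>B\<^esub> S.mon r \<one> = S.mon (\<ominus>\<^bsub>R\<^esub> r) \<one>"
    proof (rule B.minus_equality)
      show "S.mon (\<ominus>\<^bsub>R\<^esub> r) \<one> \<oplus>\<^bsub>B\<^esub> S.mon r \<one> = \<zero>\<^bsub>B\<^esub>"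
        using mon_add[of "\<ominus>\<^bsub>R\<^esub> r" r "\<one>"] minus by (simp add: R.l_neg)
    qed (use minus N_closed(1) in simp_all)
    then show ?case using generate_ring.a_inv[OF minus.IH] by simp
  next
    case (add r s)
    then show ?case using E(3) mon_add[of r s "\<one>"] by simp
  next
    case (mult r s)
    then show ?case using E(2)[OF mult.IH] by (simp add: S.mon_mult_mon S.act_one)
  qed
  have g: "gg h \<in> ?E" if "h \<in> generate G S" for h
    using that
  proof (induction rule: generate.induct)
    case one
    then show ?case using E(1) gg_one by simp
  next
    case (incl h)
    then show ?case by (intro inE) (auto simp: U_def)
  next
    case (inv h)
    then show ?case by (intro inE) (auto simp: U_def)
  next
    case (eng h1 h2)
    have "S \<subseteq> carrier G" using S(2) by auto
    then have "h1 \<in> carrier G" "h2 \<in> carrier G" using eng.hyps G.generate_in_carrier by blast+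
    then show ?case using E(2)[OF eng.IH] gg_mult by simp
  qed
  have "carrier B \<subseteq> ?E"
  proof
    fix b assume "b \<in> carrier B"
    then show "b \<in> ?E"
    proof (induction rule: SB.skew_induct)
      case (mon s h)
      then have h: "h \<in> N" by simp
      have "S.mon s h = S.mon s \<one> \<otimes>\<^sub>A gg h" using mon(1) h by (simp add: S.mon_mult_mon S.act_one)
      then show ?case using E(2)[OF r[OF mon(1)] g] h S(3) by auto
    next
      case (add a b)
      then show ?case using E(3) by simp
    qed
  qed
  with U that show thesis by blast
qed

text \<open>
  \<open>N\<close> is normal in the abelian group \<open>G\<close>.
\<close>

lemma B_conjugate:
  assumes g: "g \<in> carrier G" and b: "b \<in> carrier B"
  shows "gg g \<otimes>\<^sub>A b \<otimes>\<^sub>A gg (inv g) \<in> carrier B"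
  using b
proof (induction rule: SB.skew_induct)
  case (mon r h)
  then have h: "h \<in> N" by simp
  have "g \<otimes> h \<otimes> inv g = h" using h g by (simp add: G.m_comm[of g h] G.m_assoc)
  then show ?case using mon(1) h g by (simp add: S.mon_mult_mon)
next
  case (add a b)
  then show ?case using g BA B.a_closed[OF add.IH] by (simp add: A.r_distr A.l_distr)
qed

end

section \<open>Simple modules over the skew group ring\<close>

locale simple_A_module = diagonal_action K R G act n x \<chi> N \<Lambda> + M: left_module "skew_group_ring R G act" M
  for K :: "('k, 'e) ring_scheme" and R :: "('k, 'r, 'c) module_scheme" and G :: "('g, 'd) monoid_scheme" (structure)
    and act n x \<chi> N \<Lambda> and M :: "('g \<Rightarrow> 'r, 'm) module" +
  assumes M_simple: "simple_module (skew_group_ring R G act) M"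
begin

abbreviation smult_M (infixl \<open>\<odot>\<^sub>M\<close> 70) where "a \<odot>\<^sub>M m \<equiv> a \<odot>\<^bsub>M\<^esub> m"
abbreviation add_M (infixl \<open>\<oplus>\<^sub>M\<close> 65) where "m \<oplus>\<^sub>M m' \<equiv> m \<oplus>\<^bsub>M\<^esub> m'"
abbreviation zero_M (\<open>\<zero>\<^sub>M\<close>) where "\<zero>\<^sub>M \<equiv> \<zero>\<^bsub>M\<^esub>"

lemma M_nonzero: obtains m where "m \<in> carrier M" and "m \<noteq> \<zero>\<^sub>M"
  using M_simple M.M.zero_closed unfolding simple_module_def by blast

lemma M_submodule: "Module.submodule H A M \<Longrightarrow> H = {\<zero>\<^sub>M} \<or> H = carrier M"
  using M_simple unfolding simple_module_def by blast

lemma left_module_BM: "left_module B M"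
proof -
  have "ring (A\<lparr>carrier := carrier B\<rparr>)" by (subst B_record[symmetric]) (rule B.ring_axioms)
  moreover have "carrier B \<subseteq> carrier A" using BA by blast
  ultimately have "left_module (A\<lparr>carrier := carrier B\<rparr>) M" by (rule M.left_module_subring)
  then show ?thesis by (subst B_record)
qed

sublocale MB: left_module B M by (rule left_module_BM)

lemma gg_cancel:
  assumes "g \<in> carrier G" "m \<in> carrier M"
  shows "gg (inv g) \<odot>\<^sub>M (gg g \<odot>\<^sub>M m) = m" and "gg g \<odot>\<^sub>M (gg (inv g) \<odot>\<^sub>M m) = m"
  using M.smult_assoc1[of "gg (inv g)" "gg g" m] M.smult_assoc1[of "gg g" "gg (inv g)" m]
    gg_mult[of "inv g" g] gg_mult[of g "inv g"] gg_one M.smult_one assms by simp_all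

lemma gg_nonzero:
  assumes "g \<in> carrier G" "m \<in> carrier M" "m \<noteq> \<zero>\<^sub>M"
  shows "gg g \<odot>\<^sub>M m \<noteq> \<zero>\<^sub>M"
proof
  assume "gg g \<odot>\<^sub>M m = \<zero>\<^sub>M"
  then have "m = gg (inv g) \<odot>\<^sub>M \<zero>\<^sub>M" using gg_cancel(1)[OF assms(1,2)] by simp
  also have "\<dots> = \<zero>\<^sub>M" by (rule M.smult_r_zero) (use assms in simp)
  finally show False using assms(3) by simp
qed

text \<open>
  Here the factors from \<open>B\<close> stand on the left of the representatives: every element of \<open>A\<close> is a sum of products \<open>b l\<close>.
\<close>

lemma generated_over_B:
  assumes m: "m \<in> carrier M" "m \<noteq> \<zero>\<^sub>M" and H: "Module.submodule H B M"
    and gens: "(\<lambda>l. gg l \<odot>\<^sub>M m) ` \<Lambda> \<subseteq> H"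
  shows "H = carrier M"
proof -
  note h = MB.left_submoduleD[OF H]
  have aH: "a \<odot>\<^sub>M m \<in> H" if "a \<in> carrier A" for a
    using that
  proof (induction rule: S.skew_induct)
    case (mon r g)
    let ?l = "coset_rep G N \<Lambda> g"
    have l: "?l \<in> \<Lambda>" "?l \<in> carrier G" using coset_rep(1)[OF mon(2)] by simp_all
    have N: "inv ?l \<otimes> g \<in> N" using coset_rep(2)[OF mon(2)] .
    have "inv ?l \<otimes> g \<otimes> ?l = g" using l mon by (simp add: G.m_comm[of "inv ?l" g] G.m_assoc)
    then have "S.mon r g = S.mon r (inv ?l \<otimes> g) \<otimes>\<^sub>A gg ?l" using l mon by (simp add: S.mon_mult_mon)
    then have "S.mon r g \<odot>\<^sub>M m = S.mon r (inv ?l \<otimes> g) \<odot>\<^sub>M (gg ?l \<odot>\<^sub>M m)"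
      using M.smult_assoc1[of "S.mon r (inv ?l \<otimes> g)" "gg ?l" m] l mon m by simp
    then show ?case using h(5)[OF mon_B[OF mon(1) N]] gens l by auto
  next
    case (add a b)
    then show ?case using M.smult_l_distr[OF add(1,2) m(1)] h(3) by simp
  qed
  from M_submodule[OF M.cyclic_submodule[OF m(1)]] have "{a \<odot>\<^sub>M m | a. a \<in> carrier A} = carrier M"
  proof
    assume z: "{a \<odot>\<^sub>M m | a. a \<in> carrier A} = {\<zero>\<^sub>M}"
    have "\<one>\<^bsub>A\<^esub> \<odot>\<^sub>M m \<in> {a \<odot>\<^sub>M m | a. a \<in> carrier A}" using A.one_closed by blast
    then show ?thesis using z m M.smult_one by simp
  qed
  moreover have "{a \<odot>\<^sub>M m | a. a \<in> carrier A} \<subseteq> H" using aH by auto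
  ultimately have "carrier M \<subseteq> H" by simp
  then show ?thesis using h(1) by (rule antisym[rotated])
qed

text \<open>
  By \<open>generated_over_B\<close> a submodule is proper if and only if it misses one of the finitely many generators \<open>l m\<close>, and this
  property passes to unions of chains.
\<close>

lemma maximal_B_submodule:
  obtains M' where "Module.submodule M' B M" and "M' \<noteq> carrier M"
    and "\<And>H. \<lbrakk>Module.submodule H B M; M' \<subseteq> H; H \<noteq> carrier M\<rbrakk> \<Longrightarrow> H = M'"
proof -
  obtain m where m: "m \<in> carrier M" "m \<noteq> \<zero>\<^sub>M" by (rule M_nonzero)
  let ?gens = "(\<lambda>l. gg l \<odot>\<^sub>M m) ` \<Lambda>"
  have gensM: "?gens \<subseteq> carrier M" using m M.smult_closed by auto
  let ?P = "{H. Module.submodule H B M \<and> \<not> ?gens \<subseteq> H}"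
  have P_iff: "H \<in> ?P \<longleftrightarrow> Module.submodule H B M \<and> H \<noteq> carrier M" for H
    using generated_over_B[OF m, of H] gensM by auto
  have "\<exists>M' \<in> ?P. \<forall>H \<in> ?P. M' \<subseteq> H \<longrightarrow> H = M'"
  proof (rule subset_Zorn_nonempty)
    have "Module.submodule {\<zero>\<^sub>M} B M" by (rule MB.left_submoduleI) auto
    moreover have "{\<zero>\<^sub>M} \<noteq> carrier M" using m by blast
    ultimately have "{\<zero>\<^sub>M} \<in> ?P" by (intro P_iff[THEN iffD2] conjI)
    then show "?P \<noteq> {}" by (metis empty_iff)
    fix C assume C: "C \<noteq> {}" "subset.chain ?P C"
    then have sub: "Module.submodule H B M" and ngens: "\<not> ?gens \<subseteq> H" if "H \<in> C" for H
      using that unfolding subset.chain_def by auto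
    note h = MB.left_submoduleD[OF sub]
    have "Module.submodule (\<Union>C) B M"
    proof (rule MB.left_submoduleI)
      show "\<Union>C \<subseteq> carrier M" using h(1) by blast
      show "\<zero>\<^sub>M \<in> \<Union>C" using h(2) C(1) by blast
      fix y z assume "y \<in> \<Union>C" "z \<in> \<Union>C"
      then obtain H where "H \<in> C" "y \<in> H" "z \<in> H"
        using C(2) unfolding subset_chain_def by blast
      then show "y \<oplus>\<^sub>M z \<in> \<Union>C" using h(3) by blast
    next
      fix a y assume "a \<in> carrier B" "y \<in> \<Union>C"
      then show "a \<odot>\<^sub>M y \<in> \<Union>C" using h(5) by blast
    qed
    moreover have "\<not> ?gens \<subseteq> \<Union>C"
    proof
      assume "?gens \<subseteq> \<Union>C"
      then obtain H where "H \<in> C" "?gens \<subseteq> H"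
        using finite_subset_Union_chain[of ?gens C ?P] finite_Lambda C by blast
      then show False using ngens by blast
    qed
    ultimately show "\<Union>C \<in> ?P" by blast
  qed
  then obtain M' where M': "M' \<in> ?P" and max: "\<forall>H \<in> ?P. M' \<subseteq> H \<longrightarrow> H = M'" by blast
  show thesis
  proof (rule that[of M'])
    show "Module.submodule M' B M" "M' \<noteq> carrier M" using M'[THEN P_iff[THEN iffD1]] by simp_all
    show "H = M'" if "Module.submodule H B M" "M' \<subseteq> H" "H \<noteq> carrier M" for H
      using bspec[OF max, of H] P_iff[THEN iffD2, OF conjI[OF that(1,3)]] that(2) by simp
  qed
qed

text \<open>
  \<open>I\<close> is the annihilator in \<open>M/M'\<close> of the class of a vector \<open>m\<close> outside \<open>M'\<close>. The quotient is simple, that is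
  \<open>M' + B z = M\<close> for every \<open>z\<close> outside \<open>M'\<close>; with \<open>z = j m\<close> this makes \<open>j\<close> invertible modulo \<open>I\<close>, and with \<open>z = m\<close> and
  commutativity it shows that \<open>I\<close> annihilates the whole quotient.
\<close>

lemma maximal_annihilator:
  assumes M': "Module.submodule M' B M" "M' \<noteq> carrier M"
    and max: "\<And>H. \<lbrakk>Module.submodule H B M; M' \<subseteq> H; H \<noteq> carrier M\<rbrakk> \<Longrightarrow> H = M'"
  obtains I where "maximalideal I B" and "\<And>i m. \<lbrakk>i \<in> I; m \<in> carrier M\<rbrakk> \<Longrightarrow> i \<odot>\<^sub>M m \<in> M'"
proof -
  note h = MB.left_submoduleD[OF M'(1)]
  obtain m where m: "m \<in> carrier M" "m \<notin> M'" using M' h(1) by blast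
  have sum: "\<exists>u \<in> M'. \<exists>b \<in> carrier B. y = u \<oplus>\<^sub>M b \<odot>\<^sub>M z" if z: "z \<in> carrier M" "z \<notin> M'" and y: "y \<in> carrier M" for y z
  proof -
    have "{u \<oplus>\<^sub>M b \<odot>\<^sub>M z | u b. u \<in> M' \<and> b \<in> carrier B} = carrier M"
    proof (rule ccontr)
      assume "{u \<oplus>\<^sub>M b \<odot>\<^sub>M z | u b. u \<in> M' \<and> b \<in> carrier B} \<noteq> carrier M"
      from max[OF MB.insert_submodule(1,2)[OF M'(1) z(1)] this] MB.insert_submodule(3)[OF M'(1) z(1)]
      show False using z(2) by simp
    qed
    then have "y \<in> {u \<oplus>\<^sub>M b \<odot>\<^sub>M z | u b. u \<in> M' \<and> b \<in> carrier B}" using y by simp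
    then show ?thesis by blast
  qed
  let ?I = "{b \<in> carrier B. b \<odot>\<^sub>M m \<in> M'}"
  have ideal: "ideal ?I B"
  proof (rule idealI)
    show "ring B" by (rule B.ring_axioms)
    show "subgroup ?I (add_monoid B)"
    proof (rule B.add.subgroupI)
      show "?I \<subseteq> carrier B" by blast
      have "\<zero>\<^bsub>B\<^esub> \<odot>\<^sub>M m \<in> M'" using MB.smult_l_zero[OF m(1)] h(2) by simp
      then show "?I \<noteq> {}" using B.zero_closed by blast
      fix a assume a: "a \<in> ?I"
      show "\<ominus>\<^bsub>B\<^esub> a \<in> ?I" using a MB.smult_l_minus[of a m] m(1) h(4) by simp
      fix b assume b: "b \<in> ?I"
      show "a \<oplus>\<^bsub>B\<^esub> b \<in> ?I" using a b MB.smult_l_distr[of a b m] m(1) h(3) B.a_closed[of a b] by auto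
    qed
    fix a b assume a: "a \<in> ?I" and b: "b \<in> carrier B"
    then show 1: "b \<otimes>\<^bsub>B\<^esub> a \<in> ?I" using MB.smult_assoc1[of b a m] m(1) h(5) B.m_closed[of b a] by auto
    show "a \<otimes>\<^bsub>B\<^esub> b \<in> ?I" using 1 B.m_comm[of a b] a b by simp
  qed
  have "maximalideal ?I B"
  proof (rule maximalidealI[OF ideal])
    have "\<one>\<^bsub>B\<^esub> \<notin> ?I" using MB.smult_one[OF m(1)] m(2) by simp
    then show "carrier B \<noteq> ?I" using B.one_closed by blast
    fix J assume J: "ideal J B" "?I \<subseteq> J" "J \<subseteq> carrier B"
    interpret J: ideal J B by fact
    show "J = ?I \<or> J = carrier B"
    proof (rule disjCI)
      assume "J \<noteq> carrier B"
      show "J = ?I"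
      proof (rule ccontr)
        assume "J \<noteq> ?I"
        then obtain j where j: "j \<in> J" "j \<in> carrier B" "j \<odot>\<^sub>M m \<notin> M'" using J by blast
        obtain u b where u: "u \<in> M'" and b: "b \<in> carrier B" and eq: "m = u \<oplus>\<^sub>M b \<odot>\<^sub>M (j \<odot>\<^sub>M m)"
          using sum[OF MB.smult_closed[OF j(2) m(1)] j(3) m(1)] by blast
        have bj: "b \<otimes>\<^bsub>B\<^esub> j \<in> carrier B" "b \<otimes>\<^bsub>B\<^esub> j \<in> J" using b j J.I_l_closed by auto
        have uM: "u \<in> carrier M" using u h(1) by blast
        have bjm: "(b \<otimes>\<^bsub>B\<^esub> j) \<odot>\<^sub>M m \<in> carrier M" by (rule MB.smult_closed[OF bj(1) m(1)])
        have "(\<one>\<^bsub>B\<^esub> \<ominus>\<^bsub>B\<^esub> b \<otimes>\<^bsub>B\<^esub> j) \<odot>\<^sub>M m = m \<oplus>\<^sub>M \<ominus>\<^bsub>M\<^esub> ((b \<otimes>\<^bsub>B\<^esub> j) \<odot>\<^sub>M m)"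
          unfolding B.minus_eq MB.smult_l_distr[OF B.one_closed B.a_inv_closed[OF bj(1)] m(1)]
            MB.smult_l_minus[OF bj(1) m(1)] MB.smult_one[OF m(1)] ..
        also have "\<dots> = (u \<oplus>\<^sub>M (b \<otimes>\<^bsub>B\<^esub> j) \<odot>\<^sub>M m) \<oplus>\<^sub>M \<ominus>\<^bsub>M\<^esub> ((b \<otimes>\<^bsub>B\<^esub> j) \<odot>\<^sub>M m)"
          using eq MB.smult_assoc1[OF b j(2) m(1)] by simp
        also have "\<dots> = u" using uM bjm by (simp add: M.M.a_assoc M.M.r_neg)
        finally have eq': "(\<one>\<^bsub>B\<^esub> \<ominus>\<^bsub>B\<^esub> b \<otimes>\<^bsub>B\<^esub> j) \<odot>\<^sub>M m = u" .
        have "\<one>\<^bsub>B\<^esub> \<ominus>\<^bsub>B\<^esub> b \<otimes>\<^bsub>B\<^esub> j \<in> ?I"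
          by (intro CollectI conjI B.minus_closed B.one_closed bj(1)) (unfold eq', rule u)
        then have "\<one>\<^bsub>B\<^esub> \<ominus>\<^bsub>B\<^esub> b \<otimes>\<^bsub>B\<^esub> j \<in> J" by (rule subsetD[OF J(2)])
        then have "(\<one>\<^bsub>B\<^esub> \<ominus>\<^bsub>B\<^esub> b \<otimes>\<^bsub>B\<^esub> j) \<oplus>\<^bsub>B\<^esub> b \<otimes>\<^bsub>B\<^esub> j \<in> J" using bj(2) by (rule J.a_closed)
        moreover have "(\<one>\<^bsub>B\<^esub> \<ominus>\<^bsub>B\<^esub> b \<otimes>\<^bsub>B\<^esub> j) \<oplus>\<^bsub>B\<^esub> b \<otimes>\<^bsub>B\<^esub> j = \<one>\<^bsub>B\<^esub>"
          using B.a_assoc[OF B.one_closed B.a_inv_closed[OF bj(1)] bj(1)] B.l_neg[OF bj(1)]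
            B.r_zero[OF B.one_closed] unfolding B.minus_eq by (simp only:)
        ultimately have "J = carrier B" using J.one_imp_carrier by simp
        then show False using \<open>J \<noteq> carrier B\<close> by blast
      qed
    qed
  qed
  moreover have "i \<odot>\<^sub>M y \<in> M'" if i: "i \<in> ?I" and y: "y \<in> carrier M" for i y
  proof -
    obtain u b where u: "u \<in> M'" and b: "b \<in> carrier B" and eq: "y = u \<oplus>\<^sub>M b \<odot>\<^sub>M m" using sum[OF m y] by blast
    have iB: "i \<in> carrier B" and im: "i \<odot>\<^sub>M m \<in> M'" using i by auto
    have uM: "u \<in> carrier M" using u h(1) by blast
    have "i \<odot>\<^sub>M y = i \<odot>\<^sub>M u \<oplus>\<^sub>M b \<odot>\<^sub>M (i \<odot>\<^sub>M m)"
      unfolding eq MB.smult_r_distr[OF iB uM MB.smult_closed[OF b m(1)]]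
        MB.smult_assoc1[OF b iB m(1), symmetric] MB.smult_assoc1[OF iB b m(1), symmetric] B.m_comm[OF b iB] ..
    then show ?thesis using h(3)[OF h(5)[OF iB u] h(5)[OF b im]] by simp
  qed
  ultimately show thesis by (rule that)
qed

text \<open>
  Suppose that \<open>I\<close> annihilates no nonzero vector. If \<open>y\<close> is nonzero and \<open>l \<in> \<Lambda>\<close>, then some \<open>i \<in> I\<close> does not annihilate
  \<open>l\<^sup>-\<^sup>1 y\<close>, and \<open>y' = l i l\<^sup>-\<^sup>1 y\<close> is a nonzero vector of \<open>l M'\<close>. Since \<open>l i l\<^sup>-\<^sup>1\<close> belongs to \<open>B\<close>, the vector \<open>y'\<close>
  remains in those translates of \<open>M'\<close> to which \<open>y\<close> belongs. After all of \<open>\<Lambda>\<close> has been treated, the vector lies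
  in every translate \<open>g M'\<close>. But the intersection of the translates is a proper \<open>A\<close>-submodule of \<open>M\<close>.
\<close>

lemma killed_vector:
  assumes M': "Module.submodule M' B M" "M' \<noteq> carrier M"
    and I: "I \<subseteq> carrier B" "\<And>i m. \<lbrakk>i \<in> I; m \<in> carrier M\<rbrakk> \<Longrightarrow> i \<odot>\<^sub>M m \<in> M'"
  shows "\<exists>w \<in> carrier M. w \<noteq> \<zero>\<^sub>M \<and> (\<forall>i\<in>I. i \<odot>\<^sub>M w = \<zero>\<^sub>M)"
proof (rule ccontr)
  assume "\<not> (\<exists>w \<in> carrier M. w \<noteq> \<zero>\<^sub>M \<and> (\<forall>i\<in>I. i \<odot>\<^sub>M w = \<zero>\<^sub>M))"
  then have ex: "\<exists>i\<in>I. i \<odot>\<^sub>M w \<noteq> \<zero>\<^sub>M" if "w \<in> carrier M" "w \<noteq> \<zero>\<^sub>M" for w using that by blast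
  note h = MB.left_submoduleD[OF M'(1)]
  have "\<exists>y \<in> carrier M. y \<noteq> \<zero>\<^sub>M \<and> (\<forall>l\<in>F. gg (inv l) \<odot>\<^sub>M y \<in> M')" if "finite F" "F \<subseteq> \<Lambda>" for F
    using that
  proof (induction F rule: finite_induct)
    case empty
    then show ?case using M_nonzero by blast
  next
    case (insert l F)
    then obtain y where y: "y \<in> carrier M" "y \<noteq> \<zero>\<^sub>M" and yF: "\<forall>l\<in>F. gg (inv l) \<odot>\<^sub>M y \<in> M'" by auto
    have l: "l \<in> carrier G" using insert.prems by simp
    have gl: "gg l \<in> carrier A" "gg (inv l) \<in> carrier A" using l by simp_all
    let ?w = "gg (inv l) \<odot>\<^sub>M y"
    have w: "?w \<in> carrier M" "?w \<noteq> \<zero>\<^sub>M" using M.smult_closed[OF gl(2) y(1)] gg_nonzero[OF _ y] l by simp_all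
    obtain i where i: "i \<in> I" "i \<odot>\<^sub>M ?w \<noteq> \<zero>\<^sub>M" using ex[OF w] by blast
    have iA: "i \<in> carrier A" "i \<in> carrier B" using i I BA by auto
    have iw: "i \<odot>\<^sub>M ?w \<in> carrier M" by (rule M.smult_closed[OF iA(1) w(1)])
    let ?y = "gg l \<odot>\<^sub>M (i \<odot>\<^sub>M ?w)"
    have yl: "gg (inv l) \<odot>\<^sub>M ?y \<in> M'" unfolding gg_cancel(1)[OF l iw] by (rule I(2)[OF i(1) w(1)])
    have "gg (inv l') \<odot>\<^sub>M ?y \<in> M'" if l': "l' \<in> F" for l'
    proof -
      have l'G: "l' \<in> carrier G" using l' insert.prems by auto
      let ?h = "inv l' \<otimes> l"
      let ?b = "gg ?h \<otimes>\<^sub>A i \<otimes>\<^sub>A gg (inv ?h)"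
      have hG: "?h \<in> carrier G" using l l'G by simp
      have b: "?b \<in> carrier B" by (rule B_conjugate[OF hG iA(2)])
      have "inv ?h \<otimes> inv l' = inv l" using l l'G by (simp add: G.inv_mult_group G.m_assoc)
      then have "?b \<otimes>\<^sub>A gg (inv l') = gg ?h \<otimes>\<^sub>A i \<otimes>\<^sub>A gg (inv l)"
        using A.m_assoc[of "gg ?h \<otimes>\<^sub>A i" "gg (inv ?h)" "gg (inv l')"] gg_mult[of "inv ?h" "inv l'"] hG l'G iA
        by simp
      also have "\<dots> = gg (inv l') \<otimes>\<^sub>A (gg l \<otimes>\<^sub>A (i \<otimes>\<^sub>A gg (inv l)))"
        unfolding gg_mult[OF G.inv_closed[OF l'G] l, symmetric] using l l'G iA by (simp add: A.m_assoc)
      finally have "?b \<odot>\<^sub>M (gg (inv l') \<odot>\<^sub>M y) = gg (inv l') \<odot>\<^sub>M ?y"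
        using M.smult_assoc1[OF BA[OF b], of "gg (inv l')" y]
          M.smult_assoc1[of "gg (inv l')" "gg l \<otimes>\<^sub>A (i \<otimes>\<^sub>A gg (inv l))" y]
          M.smult_assoc1[OF gl(1), of "i \<otimes>\<^sub>A gg (inv l)" y] M.smult_assoc1[OF iA(1) gl(2) y(1)] l l'G iA y(1) gl
        by simp
      moreover have "gg (inv l') \<odot>\<^sub>M y \<in> M'" using yF l' by blast
      ultimately show ?thesis using h(5)[OF b] by metis
    qed
    moreover have "?y \<in> carrier M" "?y \<noteq> \<zero>\<^sub>M" using M.smult_closed[OF gl(1) iw] gg_nonzero[OF l iw i(2)] by simp_all
    ultimately show ?case using yl by blast
  qed
  from this[OF finite_Lambda subset_refl]
  obtain y where y: "y \<in> carrier M" "y \<noteq> \<zero>\<^sub>M" and y\<Lambda>: "\<forall>l\<in>\<Lambda>. gg (inv l) \<odot>\<^sub>M y \<in> M'" by blast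
  \<comment> \<open>This is the intersection of the translates: the condition at \<open>g\<close> says \<open>z \<in> g\<^sup>-\<^sup>1 M'\<close>.\<close>
  let ?D = "{z \<in> carrier M. \<forall>g\<in>carrier G. gg g \<odot>\<^sub>M z \<in> M'}"
  have yD: "y \<in> ?D"
  proof (intro CollectI conjI ballI y(1))
    fix g assume g: "g \<in> carrier G"
    let ?l = "coset_rep G N \<Lambda> (inv g)"
    have l: "?l \<in> \<Lambda>" "?l \<in> carrier G" and N: "inv ?l \<otimes> inv g \<in> N"
      using coset_rep(1,2)[of "inv g"] g by simp_all
    let ?h = "inv (inv ?l \<otimes> inv g)"
    have h': "?h \<in> N" by (rule N_closed(3)[OF N])
    have "?h \<otimes> inv ?l = g" using l g by (simp add: G.inv_mult_group G.m_assoc)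
    then have "gg g \<odot>\<^sub>M y = gg ?h \<odot>\<^sub>M (gg (inv ?l) \<odot>\<^sub>M y)"
      using M.smult_assoc1[of "gg ?h" "gg (inv ?l)" y] gg_mult[of ?h "inv ?l"] l NG[OF h'] y by simp
    then show "gg g \<odot>\<^sub>M y \<in> M'" using h(5)[OF mon_B[OF R.one_closed h']] y\<Lambda> l(1) by simp
  qed
  have "Module.submodule ?D A M"
  proof (rule M.left_submoduleI)
    show "?D \<subseteq> carrier M" by blast
    show "\<zero>\<^sub>M \<in> ?D" using M.smult_r_zero h(2) by simp
    show add_D: "p \<oplus>\<^sub>M q \<in> ?D" if "p \<in> ?D" "q \<in> ?D" for p q
      using that M.smult_r_distr[of _ p q] h(3) by auto
    fix a z assume a: "a \<in> carrier A" and z: "z \<in> ?D"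
    from a show "a \<odot>\<^sub>M z \<in> ?D"
    proof (induction rule: S.skew_induct)
      case (mon r k)
      have "gg g \<odot>\<^sub>M (S.mon r k \<odot>\<^sub>M z) \<in> M'" if g: "g \<in> carrier G" for g
      proof -
        have gk: "g \<otimes> k \<in> carrier G" using g mon by simp
        have r: "S.mon (act g r) \<one> \<in> carrier B" using g mon N_closed(1) by simp
        have "gg g \<otimes>\<^sub>A S.mon r k = S.mon (act g r) \<one> \<otimes>\<^sub>A gg (g \<otimes> k)"
          using g mon gk by (simp add: S.mon_mult_mon S.act_one)
        then have "gg g \<odot>\<^sub>M (S.mon r k \<odot>\<^sub>M z) = S.mon (act g r) \<one> \<odot>\<^sub>M (gg (g \<otimes> k) \<odot>\<^sub>M z)"
          using M.smult_assoc1[of "gg g" "S.mon r k" z] M.smult_assoc1[OF BA[OF r], of "gg (g \<otimes> k)" z]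
            g mon gk z by simp
        then show ?thesis using h(5)[OF r] z gk by simp
      qed
      moreover have "S.mon r k \<odot>\<^sub>M z \<in> carrier M" using M.smult_closed mon z by simp
      ultimately show ?case by blast
    next
      case (add a b)
      then show ?case using M.smult_l_distr[OF add(1,2), of z] z add_D[OF add.IH] by simp
    qed
  qed
  moreover have "?D \<noteq> carrier M"
  proof
    assume "?D = carrier M"
    moreover have "?D \<subseteq> M'"
    proof
      fix z assume z: "z \<in> ?D"
      then have "gg \<one> \<odot>\<^sub>M z \<in> M'" using G.one_closed by blast
      then show "z \<in> M'" using M.smult_one[of z] z gg_one by simp
    qed
    ultimately show False using M'(2) h(1) by blast
  qed
  ultimately have "?D = {\<zero>\<^sub>M}" using M_submodule by blast
  then show False using yD y(2) by blast
qed

lemma weight_vector: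
  obtains w where "w \<in> carrier M" and "w \<noteq> \<zero>\<^sub>M"
    and "\<And>b. b \<in> carrier B \<Longrightarrow> \<exists>c \<in> carrier K. b \<odot>\<^sub>M w = \<kappa> c \<odot>\<^sub>M w"
proof -
  obtain M' where M': "Module.submodule M' B M" "M' \<noteq> carrier M"
    and max: "\<And>H. \<lbrakk>Module.submodule H B M; M' \<subseteq> H; H \<noteq> carrier M\<rbrakk> \<Longrightarrow> H = M'"
    using maximal_B_submodule by metis
  obtain I where I: "maximalideal I B" and IM: "\<And>i m. \<lbrakk>i \<in> I; m \<in> carrier M\<rbrakk> \<Longrightarrow> i \<odot>\<^sub>M m \<in> M'"
    using maximal_annihilator[OF M' max] by metis
  interpret I: maximalideal I B by fact
  have IB: "I \<subseteq> carrier B" using I.a_subset .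
  obtain w where w: "w \<in> carrier M" "w \<noteq> \<zero>\<^sub>M" "\<forall>i\<in>I. i \<odot>\<^sub>M w = \<zero>\<^sub>M"
    using killed_vector[OF M' IB IM] by metis
  obtain U where U: "finite U" "U \<subseteq> carrier B" "carrier B \<subseteq> generate_ring B (\<kappa> ` carrier K \<union> U)"
    by (rule B_finitely_generated)
  have "\<exists>c \<in> carrier K. b \<odot>\<^sub>M w = \<kappa> c \<odot>\<^sub>M w" if b: "b \<in> carrier B" for b
  proof -
    obtain c where c: "c \<in> carrier K" and bc: "b \<ominus>\<^bsub>B\<^esub> \<kappa> c \<in> I"
      using finitely_generated_residue_field[OF K.algebraically_closed_axioms B.cring_axioms I kappa_B_hom U b] .
    have kc: "\<kappa> c \<in> carrier B" by (rule kappa_closed(2)[OF c])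
    have bw: "b \<odot>\<^sub>M w \<in> carrier M" "\<kappa> c \<odot>\<^sub>M w \<in> carrier M"
      using MB.smult_closed[OF b w(1)] MB.smult_closed[OF kc w(1)] .
    have "b \<odot>\<^sub>M w \<ominus>\<^bsub>M\<^esub> \<kappa> c \<odot>\<^sub>M w = (b \<ominus>\<^bsub>B\<^esub> \<kappa> c) \<odot>\<^sub>M w"
      unfolding M.M.minus_eq B.minus_eq MB.smult_l_distr[OF b B.a_inv_closed[OF kc] w(1)]
        MB.smult_l_minus[OF kc w(1)] ..
    also have "\<dots> = \<zero>\<^sub>M" using w(3) bc by blast
    finally have "b \<odot>\<^sub>M w = \<kappa> c \<odot>\<^sub>M w" using bw by simp
    then show ?thesis using c by blast
  qed
  with w that show thesis by blast
qed

text \<open>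
  The line \<open>W = K w\<close> through a common eigenvector of \<open>B\<close> is taken inside \<open>M\<close>, so that it inherits the action and
  torsion-freeness. The action map \<open>a \<otimes> u \<mapsto> a u\<close> is then the required homomorphism.
\<close>

theorem simple_is_induced:
  assumes tf: "torsion_free_wrt A (xx ` {1..n}) M"
  shows "\<exists>(W :: ('g \<Rightarrow> 'r, 'm) module) w.
     simple_module B W \<and> torsion_free_wrt B (xx ` {1..n}) W \<and> w \<in> carrier W \<and>
     carrier W = {c \<odot>\<^bsub>restrict_scalars B W\<^esub> w | c. c \<in> carrier K} \<and>
     isomorphic_modules A M (induced_module A B W)"
proof -
  obtain w where w: "w \<in> carrier M" "w \<noteq> \<zero>\<^sub>M"
    and wB: "\<And>b. b \<in> carrier B \<Longrightarrow> \<exists>c \<in> carrier K. b \<odot>\<^sub>M w = \<kappa> c \<odot>\<^sub>M w"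
    using weight_vector by metis
  let ?H = "{\<kappa> c \<odot>\<^sub>M w | c. c \<in> carrier K}"
  \<comment> \<open>The line is also the cyclic \<open>B\<close>-module generated by \<open>w\<close>.\<close>
  have HB: "?H = {b \<odot>\<^sub>M w | b. b \<in> carrier B}" using wB kappa_closed(2) by blast
  have sub: "Module.submodule ?H B M"
    unfolding HB by (rule MB.cyclic_submodule[OF w(1)])
  define W where "W = M\<lparr>carrier := ?H\<rparr>"
  have W_ops: "carrier W = ?H" "\<zero>\<^bsub>W\<^esub> = \<zero>\<^sub>M" "add W = add M" "smult W = smult M"
    by (simp_all add: W_def)
  have HM: "?H \<subseteq> carrier M" using MB.left_submoduleD(1)[OF sub] .
  have W_mod: "left_module B W" unfolding W_def by (rule MB.left_submodule_is_left_module[OF sub])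
  interpret W: left_module B W by (rule W_mod)
  have "\<kappa> \<one>\<^sub>K \<odot>\<^sub>M w = w" using ring_hom_one[OF kappa_hom] M.smult_one[OF w(1)] by simp
  then have wW: "w \<in> carrier W" unfolding W_ops by (intro CollectI exI[of _ "\<one>\<^sub>K"]) simp
  have line: "carrier W = {c \<odot>\<^bsub>restrict_scalars B W\<^esub> w | c. c \<in> carrier K}"
    unfolding W_ops(1) by (intro Collect_cong) (metis restrict_scalars_smult(2) W_ops(4))
  have simple: "simple_module B W"
    unfolding simple_module_def
  proof (intro conjI allI impI)
    show "left_module B W" by (rule W_mod)
    show "carrier W \<noteq> {\<zero>\<^bsub>W\<^esub>}" using wW w(2) W_ops(2) by auto
    fix H assume "Module.submodule H B W"
    note h = W.left_submoduleD[OF this]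
    show "H = {\<zero>\<^bsub>W\<^esub>} \<or> H = carrier W"
    proof (rule disjCI)
      assume "H \<noteq> carrier W"
      show "H = {\<zero>\<^bsub>W\<^esub>}"
      proof (rule ccontr)
        assume "H \<noteq> {\<zero>\<^bsub>W\<^esub>}"
        then obtain y where y: "y \<in> H" "y \<noteq> \<zero>\<^bsub>W\<^esub>" using h(2) by blast
        then obtain c where c: "c \<in> carrier K" "y = \<kappa> c \<odot>\<^sub>M w" using h(1) unfolding W_ops(1) by blast
        have "c \<noteq> \<zero>\<^sub>K"
        proof
          assume "c = \<zero>\<^sub>K"
          then have "y = \<zero>\<^sub>M" using c(2) M.smult_l_zero[OF w(1)] by simp
          then show False using y(2) W_ops(2) by simp
        qed
        then have u: "inv\<^bsub>K\<^esub> c \<in> carrier K" "inv\<^bsub>K\<^esub> c \<otimes>\<^sub>K c = \<one>\<^sub>K"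
          using c(1) K.field_Units by (auto intro!: K.Units_l_inv)
        have "carrier W \<subseteq> H"
        proof
          fix z assume "z \<in> carrier W"
          then obtain d where d: "d \<in> carrier K" "z = \<kappa> d \<odot>\<^sub>M w" unfolding W_ops(1) by blast
          have du: "d \<otimes>\<^sub>K inv\<^bsub>K\<^esub> c \<in> carrier K" using d u by simp
          have "(d \<otimes>\<^sub>K inv\<^bsub>K\<^esub> c) \<otimes>\<^sub>K c = d" using d u c(1) by (simp add: K.m_assoc)
          then have "\<kappa> (d \<otimes>\<^sub>K inv\<^bsub>K\<^esub> c) \<odot>\<^sub>M y = z"
            unfolding c(2) d(2) using M.smult_assoc1[OF kappa_closed(1)[OF du] kappa_closed(1)[OF c(1)] w(1)]
              ring_hom_mult[OF kappa_hom du c(1)] by simp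
          then show "z \<in> H" using h(5)[OF kappa_closed(2)[OF du] y(1)] W_ops(4) by simp
        qed
        then show False using h(1) \<open>H \<noteq> carrier W\<close> by blast
      qed
    qed
  qed
  have pow: "a [^]\<^bsub>B\<^esub> k = a [^]\<^bsub>A\<^esub> k" for a and k :: nat
    by (simp add: nat_pow_def)
  have tfW: "torsion_free_wrt B (xx ` {1..n}) W"
    using tf HM unfolding torsion_free_wrt_def W_ops pow by blast
  interpret wl: weight_line K R G act n x \<chi> N \<Lambda> W w
  proof (intro weight_line.intro weight_line_axioms.intro)
    show "diagonal_action K R G act n x \<chi> N \<Lambda>" by (rule diagonal_action_axioms)
    show "left_module B W" by (rule W_mod)
    show "w \<in> carrier W" by (rule wW)
    show "w \<noteq> \<zero>\<^bsub>W\<^esub>" using w(2) W_ops(2) by simp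
    show "carrier W = {c \<odot>\<^bsub>restrict_scalars B W\<^esub> w | c. c \<in> carrier K}" by (rule line)
    fix i assume i: "i \<in> {1..n}"
    have iA: "xx i \<in> carrier A" using i by simp
    have "xx i [^]\<^bsub>A\<^esub> (1::nat) = xx i" using A.nat_pow_eone[OF iA] .
    then show "xx i \<odot>\<^bsub>W\<^esub> w \<noteq> \<zero>\<^bsub>W\<^esub>"
      using tf w i unfolding torsion_free_wrt_def W_ops by (metis imageI le_refl)
  qed
  let ?T = "induced_module A B W"
  have HM': "u \<in> carrier M" if "u \<in> carrier W" for u using that HM unfolding W_ops(1) by blast
  obtain F where F: "F \<in> carrier ?T \<rightarrow> carrier M"
    and F_add: "\<forall>s\<in>carrier ?T. \<forall>t\<in>carrier ?T. F (s \<oplus>\<^bsub>?T\<^esub> t) = F s \<oplus>\<^sub>M F t"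
    and F_pure: "\<forall>a\<in>carrier A. \<forall>u\<in>carrier W. F (pure_tensor A B W a u) = a \<odot>\<^sub>M u"
  proof (rule wl.I.tensor_universal[of M "\<lambda>a u. a \<odot>\<^sub>M u"])
    show "abelian_group M" by (rule M.M.abelian_group_axioms)
    fix a u assume a: "a \<in> carrier A" and u: "u \<in> carrier W"
    note uM = HM'[OF u]
    show "a \<odot>\<^sub>M u \<in> carrier M" by (rule M.smult_closed[OF a uM])
    show "(a \<oplus>\<^sub>A a') \<odot>\<^sub>M u = a \<odot>\<^sub>M u \<oplus>\<^sub>M a' \<odot>\<^sub>M u" if "a' \<in> carrier A" for a'
      by (rule M.smult_l_distr[OF a that uM])
    show "a \<odot>\<^sub>M (u \<oplus>\<^bsub>W\<^esub> u') = a \<odot>\<^sub>M u \<oplus>\<^sub>M a \<odot>\<^sub>M u'" if "u' \<in> carrier W" for u'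
      unfolding W_ops by (rule M.smult_r_distr[OF a uM HM'[OF that]])
    show "(a \<otimes>\<^sub>A b) \<odot>\<^sub>M u = a \<odot>\<^sub>M (b \<odot>\<^bsub>W\<^esub> u)" if "b \<in> carrier B" for b
      unfolding W_ops by (rule M.smult_assoc1[OF a BA[OF that] uM])
  next
    fix F assume F: "F \<in> carrier ?T \<rightarrow> carrier M"
      "\<And>s t. \<lbrakk>s \<in> carrier ?T; t \<in> carrier ?T\<rbrakk> \<Longrightarrow> F (s \<oplus>\<^bsub>?T\<^esub> t) = F s \<oplus>\<^sub>M F t"
      "\<And>a u. \<lbrakk>a \<in> carrier A; u \<in> carrier W\<rbrakk> \<Longrightarrow> F (pure_tensor A B W a u) = a \<odot>\<^sub>M u"
    show thesis by (rule that[of F]) (use F in simp_all)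
  qed
  have F_smult: "F (a \<odot>\<^bsub>?T\<^esub> t) = a \<odot>\<^sub>M F t" if a: "a \<in> carrier A" and t: "t \<in> carrier ?T" for a t
    using t
  proof (induction rule: wl.I.tensor_induct)
    case (pure a' u)
    then show ?case
      using wl.I.smult_pure[OF a pure] bspec[OF bspec[OF F_pure pure(1)] pure(2)]
        bspec[OF bspec[OF F_pure A.m_closed[OF a pure(1)]] pure(2)] M.smult_assoc1[OF a pure(1) HM'[OF pure(2)]] by simp
  next
    case (add s t)
    have FM: "F s \<in> carrier M" "F t \<in> carrier M" using F add by auto
    show ?case
      unfolding wl.I.T.smult_r_distr[OF a add(1,2)] bspec[OF bspec[OF F_add add(1)] add(2)]
        M.smult_r_distr[OF a FM] add.IH[symmetric]
      by (rule bspec[OF bspec[OF F_add wl.I.T.smult_closed[OF a add(1)]] wl.I.T.smult_closed[OF a add(2)]])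
  qed
  have F_hom: "F \<in> module_hom A ?T M"
    unfolding module_hom_def using F F_add F_smult by simp
  have "F (pure_tensor A B W \<one>\<^bsub>A\<^esub> w) = w"
    using bspec[OF bspec[OF F_pure A.one_closed] wW] M.smult_one[OF w(1)] by simp
  then have "isomorphic_modules A M ?T"
    using simple_modules_isomorphic[OF M_simple wl.induced_simple F_hom wl.I.pure_closed[OF A.one_closed wW]] w(2) by simp
  then show ?thesis using simple tfW wW line by blast
qed

end

section \<open>Classification of the torsion-free simple modules\<close>

context diagonal_action begin

lemma weight_line_of_simple:
  assumes simple: "simple_module B V" and tf: "torsion_free_wrt B (xx ` {1..n}) V" and v: "v \<in> carrier V"
    and line: "carrier V = {c \<odot>\<^bsub>restrict_scalars B V\<^esub> v | c. c \<in> carrier K}"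
  shows "weight_line K R G act n x \<chi> N \<Lambda> V v"
proof (intro weight_line.intro weight_line_axioms.intro)
  show "diagonal_action K R G act n x \<chi> N \<Lambda>" by (rule diagonal_action_axioms)
  show V: "left_module B V" using simple unfolding simple_module_def by blast
  interpret V: left_module B V by (rule V)
  show "v \<in> carrier V" by (rule v)
  show "carrier V = {c \<odot>\<^bsub>restrict_scalars B V\<^esub> v | c. c \<in> carrier K}" by (rule line)
  show nz: "v \<noteq> \<zero>\<^bsub>V\<^esub>"
  proof
    assume "v = \<zero>\<^bsub>V\<^esub>"
    then have "c \<odot>\<^bsub>restrict_scalars B V\<^esub> v = \<zero>\<^bsub>V\<^esub>" if "c \<in> carrier K" for c
      unfolding restrict_scalars_smult(2)[OF that] using V.smult_r_zero[OF kappa_closed(2)[OF that]] by simp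
    then have "carrier V \<subseteq> {\<zero>\<^bsub>V\<^esub>}" unfolding line by auto
    then show False using simple V.M.zero_closed unfolding simple_module_def by blast
  qed
  fix i assume i: "i \<in> {1..n}"
  have "xx i \<in> carrier B" using i N_closed(1) by simp
  then have "xx i [^]\<^bsub>B\<^esub> (1::nat) = xx i" by (rule B.nat_pow_eone)
  then show "xx i \<odot>\<^bsub>V\<^esub> v \<noteq> \<zero>\<^bsub>V\<^esub>"
    using tf v nz i unfolding torsion_free_wrt_def by (metis imageI le_refl)
qed

end

context weight_line begin

theorem induced_action:
  "\<exists>k l.
     (\<forall>i\<in>{1..n}. k i \<in> Units K \<and> xx i \<odot>\<^sub>V v = k i \<odot>\<^bsub>restrict_scalars B V\<^esub> v) \<and>
     l \<in> hom (G\<lparr>carrier := N\<rparr>) (units_of K) \<and>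
     (\<forall>h\<in>N. gg h \<odot>\<^sub>V v = l h \<odot>\<^bsub>restrict_scalars B V\<^esub> v) \<and>
     (\<forall>i\<in>{1..n}. \<forall>g\<in>\<Lambda>. xx i \<odot>\<^sub>T vv g = (\<chi> i g \<otimes>\<^sub>K k i) \<odot>\<^bsub>restrict_scalars A T\<^esub> vv g) \<and>
     (\<forall>g\<in>\<Lambda>. \<forall>g'\<in>\<Lambda>. \<forall>h\<in>N.
        gg (h \<otimes> g) \<odot>\<^sub>T vv g' =
        l (coset_cocycle G N \<Lambda> g g' \<otimes> h)
          \<odot>\<^bsub>restrict_scalars A T\<^esub> vv (coset_rep G N \<Lambda> (g \<otimes> g')))"
proof (intro exI[of _ kk] exI[of _ ll] conjI ballI)
  fix i assume i: "i \<in> {1..n}"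
  note k = kk_nonzero[OF i]
  show "kk i \<in> Units K" using k K.field_Units by simp
  show "xx i \<odot>\<^sub>V v = kk i \<odot>\<^bsub>restrict_scalars B V\<^esub> v"
    using weight(2)[OF xx_B[OF i]] restrict_scalars_smult(2)[of "kk i" V v] k by simp
  fix g assume g: "g \<in> \<Lambda>"
  then have "\<chi> i g \<otimes>\<^sub>K kk i \<in> carrier K" using chi_props(1)[OF i] k by simp
  from restrict_scalars_smult(1)[OF this, of T "vv g"]
  show "xx i \<odot>\<^sub>T vv g = (\<chi> i g \<otimes>\<^sub>K kk i) \<odot>\<^bsub>restrict_scalars A T\<^esub> vv g"
    using xx_vv[OF i, of g] g by simp
next
  show "ll \<in> hom (G\<lparr>carrier := N\<rparr>) (units_of K)" by (rule ll_hom)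
  fix h assume h: "h \<in> N"
  have gh: "gg h \<in> carrier B" using h by simp
  show "gg h \<odot>\<^sub>V v = ll h \<odot>\<^bsub>restrict_scalars B V\<^esub> v"
    using weight(2)[OF gh] restrict_scalars_smult(2)[OF weight(1)[OF gh], of V v] by simp
next
  fix g g' h assume g: "g \<in> \<Lambda>" "g' \<in> \<Lambda>" and h: "h \<in> N"
  have "gg (coset_cocycle G N \<Lambda> g g' \<otimes> h) \<in> carrier B"
    using N_closed(2)[OF gg_action(2)[OF g h] h] by simp
  from restrict_scalars_smult(1)[OF weight(1)[OF this], of T "vv (coset_rep G N \<Lambda> (g \<otimes> g'))"] gg_action(1)[OF g h]
  show "gg (h \<otimes> g) \<odot>\<^sub>T vv g' =
      ll (coset_cocycle G N \<Lambda> g g' \<otimes> h)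
        \<odot>\<^bsub>restrict_scalars A T\<^esub> vv (coset_rep G N \<Lambda> (g \<otimes> g'))" by simp
qed

lemma induced_module_structure:
  "let V' = T; V'\<^sub>K = restrict_scalars A V'; vv = (\<lambda>g. pure_tensor A B V (gg g) v) in
     simple_module A V' \<and>
     vectorspace K V'\<^sub>K \<and> inj_on vv \<Lambda> \<and> vectorspace.basis K V'\<^sub>K (vv ` \<Lambda>) \<and>
     vectorspace.fin_dim K V'\<^sub>K \<and> vectorspace.dim K V'\<^sub>K = order (G Mod N) \<and>
     (\<exists>k l.
       (\<forall>i\<in>{1..n}. k i \<in> Units K \<and> xx i \<odot>\<^sub>V v = k i \<odot>\<^bsub>restrict_scalars B V\<^esub> v) \<and>
       l \<in> hom (G\<lparr>carrier := N\<rparr>) (units_of K) \<and>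
       (\<forall>h\<in>N. gg h \<odot>\<^sub>V v = l h \<odot>\<^bsub>restrict_scalars B V\<^esub> v) \<and>
       (\<forall>i\<in>{1..n}. \<forall>g\<in>\<Lambda>. xx i \<odot>\<^bsub>V'\<^esub> vv g = (\<chi> i g \<otimes>\<^sub>K k i) \<odot>\<^bsub>V'\<^sub>K\<^esub> vv g) \<and>
       (\<forall>g\<in>\<Lambda>. \<forall>g'\<in>\<Lambda>. \<forall>h\<in>N.
          gg (h \<otimes> g) \<odot>\<^bsub>V'\<^esub> vv g' =
          l (coset_cocycle G N \<Lambda> g g' \<otimes> h) \<odot>\<^bsub>V'\<^sub>K\<^esub> vv (coset_rep G N \<Lambda> (g \<otimes> g'))))"
  unfolding Let_def vv_def[symmetric]
  by (intro conjI induced_simple induced_basis vv_inj induced_action)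

end

theorem proposition5p4:
  fixes K :: "'k ring"
    and R :: "('k, 'r) module"
    and G :: "'g monoid"
    and act :: "'g \<Rightarrow> 'r \<Rightarrow> 'r"
    and n :: nat
    and x :: "nat \<Rightarrow> 'r"
    and \<chi> :: "nat \<Rightarrow> 'g \<Rightarrow> 'k"
    and N \<Lambda> :: "'g set"
    and A B :: "('k, 'g \<Rightarrow> 'r) module"
    and xx :: "nat \<Rightarrow> 'g \<Rightarrow> 'r"
    and gg :: "'g \<Rightarrow> 'g \<Rightarrow> 'r"
    and XS :: "('g \<Rightarrow> 'r) set"
  assumes K_alg_closed: "algebraically_closed K"
    and K_char_0: "\<forall>m::nat. 0 < m \<longrightarrow> [m] \<cdot>\<^bsub>K\<^esub> \<one>\<^bsub>K\<^esub> \<noteq> \<zero>\<^bsub>K\<^esub>"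
    and R_algebra: "algebra K R"
    and x_in: "x ` {1..n} \<subseteq> carrier R"
    and x_generates: "generate_algebra K R (x ` {1..n}) = carrier R"
    and G_abelian: "comm_group G"
    and G_fin_gen: "\<exists>S. finite S \<and> S \<subseteq> carrier G \<and> generate G S = carrier G"
    and chars: "\<forall>i\<in>{1..n}. \<chi> i \<in> hom G (units_of K)"
    and chars_finite_order:
      "\<forall>i\<in>{1..n}. \<exists>m::nat. 0 < m \<and> (\<forall>g\<in>carrier G. \<chi> i g [^]\<^bsub>K\<^esub> m = \<one>\<^bsub>K\<^esub>)"
    and action: "group_action G (carrier R) act"
    and action_ring_aut: "\<forall>g\<in>carrier G. act g \<in> ring_iso R R"
    and action_linear: "\<forall>g\<in>carrier G. \<forall>c\<in>carrier K. \<forall>r\<in>carrier R.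
      act g (c \<odot>\<^bsub>R\<^esub> r) = c \<odot>\<^bsub>R\<^esub> act g r"
    and action_gens: "\<forall>g\<in>carrier G. \<forall>i\<in>{1..n}. act g (x i) = inv\<^bsub>K\<^esub> (\<chi> i g) \<odot>\<^bsub>R\<^esub> x i"
    and N_eq: "N = carrier G \<inter> (\<Inter>i\<in>{1..n}. kernel G (units_of K) (\<chi> i))"
    and Lambda: "coset_representatives G N \<Lambda>"
    and A_eq: "A = skew_group_ring R G act"
    and B_eq: "B = skew_group_ring R (G\<lparr>carrier := N\<rparr>) act"
    and xx_eq: "xx = (\<lambda>i. skew_monom R (x i) \<one>\<^bsub>G\<^esub>)"
    and gg_eq: "gg = (\<lambda>g. skew_monom R \<one>\<^bsub>R\<^esub> g)"
    and X_eq: "XS = xx ` {1..n}"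
  shows
    "(\<forall>(V :: ('g \<Rightarrow> 'r, 'v) module) v.
        simple_module B V \<and> torsion_free_wrt B XS V \<and>
        v \<in> carrier V \<and> carrier V = {c \<odot>\<^bsub>restrict_scalars B V\<^esub> v | c. c \<in> carrier K} \<longrightarrow>
        (let V' = induced_module A B V;
             V'\<^sub>K = restrict_scalars A V';
             vv = (\<lambda>g. pure_tensor A B V (gg g) v)
         in
          \<comment> \<open>(1)\<close>
          simple_module A V' \<and>
          \<comment> \<open>(2)\<close>
          vectorspace K V'\<^sub>K \<and> inj_on vv \<Lambda> \<and> vectorspace.basis K V'\<^sub>K (vv ` \<Lambda>) \<and>
          vectorspace.fin_dim K V'\<^sub>K \<and> vectorspace.dim K V'\<^sub>K = order (G Mod N) \<and>
          \<comment> \<open>(3)\<close>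
          (\<exists>k l.
            (\<forall>i\<in>{1..n}. k i \<in> Units K \<and> xx i \<odot>\<^bsub>V\<^esub> v = k i \<odot>\<^bsub>restrict_scalars B V\<^esub> v) \<and>
            l \<in> hom (G\<lparr>carrier := N\<rparr>) (units_of K) \<and>
            (\<forall>h\<in>N. gg h \<odot>\<^bsub>V\<^esub> v = l h \<odot>\<^bsub>restrict_scalars B V\<^esub> v) \<and>
            (\<forall>i\<in>{1..n}. \<forall>g\<in>\<Lambda>.
               xx i \<odot>\<^bsub>V'\<^esub> vv g = (\<chi> i g \<otimes>\<^bsub>K\<^esub> k i) \<odot>\<^bsub>V'\<^sub>K\<^esub> vv g) \<and>
            (\<forall>g\<in>\<Lambda>. \<forall>g'\<in>\<Lambda>. \<forall>h\<in>N.
               gg (h \<otimes>\<^bsub>G\<^esub> g) \<odot>\<^bsub>V'\<^esub> vv g' =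
               l (coset_cocycle G N \<Lambda> g g' \<otimes>\<^bsub>G\<^esub> h)
                 \<odot>\<^bsub>V'\<^sub>K\<^esub> vv (coset_rep G N \<Lambda> (g \<otimes>\<^bsub>G\<^esub> g')))))) \<and>
     \<comment> \<open>(4)\<close>
     (\<forall>M :: ('g \<Rightarrow> 'r, 'm) module.
        simple_module A M \<and> torsion_free_wrt A XS M \<longrightarrow>
        (\<exists>(W :: ('g \<Rightarrow> 'r, 'm) module) w.
           simple_module B W \<and> torsion_free_wrt B XS W \<and>
           w \<in> carrier W \<and> carrier W = {c \<odot>\<^bsub>restrict_scalars B W\<^esub> w | c. c \<in> carrier K} \<and>
           isomorphic_modules A M (induced_module A B W)))"
proof -
  interpret diagonal_action K R G act n x \<chi> N \<Lambda>
    using K_alg_closed R_algebra G_abelian x_in x_generates G_fin_gen chars chars_finite_order action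
      action_ring_aut action_linear action_gens N_eq Lambda
    by (intro diagonal_action.intro diagonal_action_axioms.intro)
  have XS: "XS = (\<lambda>i. skew_monom R (x i) \<one>\<^bsub>G\<^esub>) ` {1..n}" using X_eq xx_eq by simp
  show ?thesis
    unfolding XS A_eq B_eq xx_eq gg_eq
  proof ((rule conjI; intro allI impI), goal_cases)
    case (1 V v)
    then interpret V: weight_line K R G act n x \<chi> N \<Lambda> V v
      by (elim conjE) (rule weight_line_of_simple)
    show ?case by (rule V.induced_module_structure)
  next
    case (2 M)
    then have "left_module (skew_group_ring R G act) M" unfolding simple_module_def by blast
    then interpret M: simple_A_module K R G act n x \<chi> N \<Lambda> M
      using 2 diagonal_action_axioms
      by (intro simple_A_module.intro simple_A_module_axioms.intro) simp_all
    show ?case by (rule M.simple_is_induced) (use 2 in simp)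
  qed
qed

end
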